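(* For $n\ge 2$, consider the complete graph $K_n$ whose edges are given independent identically distributed random costs, either all uniform on $(0,1)$ or all exponential with mean $1$. Let $T_1$ be the minimum-cost spanning tree of $K_n$, and for $k\ge2$ let $T_k$ be the minimum-cost spanning tree of the graph obtained from $K_n$ by deleting the edges of $T_1,\dots,T_{k-1}$ (with $w(T_k):=\infty$ if this graph is disconnected, so that $T_k$ does not exist). Here $w(T)$ denotes the sum of the costs of the edges of $T$. Then for each $k\ge1$ there exists a constant $\gamma_k$ such that, as $n\to\infty$, $w(T_k)\to\gamma_k$ in probability, for both the uniform and the exponential cost distributions.
   Context: Convergence in probability is as $n\to\infty$. The constant $\gamma_k$ does not depend on which of the two cost distributions is used. *)

theory Defs
  imports "HOL-Probability.Probability" "HOL-Library.Countable" "HOL-Library.Nat_Bijection"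
begin

text \<open>Complete graph K_n on vertex set {0..<n}; an edge {i,j} with i<j is the pair (i,j).\<close>
definition Kedges :: "nat \<Rightarrow> (nat \<times> nat) set" where
  "Kedges n = {(i, j). i < j \<and> j < n}"

definition adj :: "(nat \<times> nat) set \<Rightarrow> nat \<Rightarrow> nat \<Rightarrow> bool" where
  "adj T u v \<longleftrightarrow> (u, v) \<in> T \<or> (v, u) \<in> T"

text \<open>The graph (V,T) is connected: any two vertices are joined by a path.\<close>
definition connected_on :: "nat set \<Rightarrow> (nat \<times> nat) set \<Rightarrow> bool" where
  "connected_on V T \<longleftrightarrow> (\<forall>u\<in>V. \<forall>v\<in>V. (u, v) \<in> {(x, y). adj T x y}\<^sup>*)"

text \<open>A cycle: at least 3 distinct vertices, cyclically consecutive ones adjacent.\<close>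
definition has_cycle :: "(nat \<times> nat) set \<Rightarrow> bool" where
  "has_cycle T \<longleftrightarrow> (\<exists>vs. 3 \<le> length vs \<and> distinct vs \<and>
      (\<forall>i < length vs. adj T (vs ! i) (vs ! ((i + 1) mod length vs))))"

text \<open>T is a spanning tree of the graph (V,F).\<close>
definition spanning_tree :: "nat set \<Rightarrow> (nat \<times> nat) set \<Rightarrow> (nat \<times> nat) set \<Rightarrow> bool" where
  "spanning_tree V F T \<longleftrightarrow> T \<subseteq> F \<and> connected_on V T \<and> \<not> has_cycle T"

definition weight :: "(nat \<times> nat \<Rightarrow> real) \<Rightarrow> (nat \<times> nat) set \<Rightarrow> real" where
  "weight c T = (\<Sum>e\<in>T. c e)"

text \<open>A minimum-cost spanning tree of ({0..<n}, F) under costs c; ties (a null event)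
  are broken deterministically by a fixed injective code of the edge set.\<close>
definition mst :: "nat \<Rightarrow> (nat \<times> nat) set \<Rightarrow> (nat \<times> nat \<Rightarrow> real) \<Rightarrow> (nat \<times> nat) set" where
  "mst n F c = arg_min_on (\<lambda>T. to_nat (sorted_list_of_set (prod_encode ` T)))
     {T. spanning_tree {..<n} F T \<and>
         (\<forall>T'. spanning_tree {..<n} F T' \<longrightarrow> weight c T \<le> weight c T')}"

definition has_spanning_tree :: "nat \<Rightarrow> (nat \<times> nat) set \<Rightarrow> bool" where
  "has_spanning_tree n F \<longleftrightarrow> (\<exists>T. spanning_tree {..<n} F T)"

text \<open>avail n c k = edges of K_n minus the edges of T_1,...,T_k.\<close>
primrec avail :: "nat \<Rightarrow> (nat \<times> nat \<Rightarrow> real) \<Rightarrow> nat \<Rightarrow> (nat \<times> nat) set" where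
  "avail n c 0 = Kedges n"
| "avail n c (Suc k) = avail n c k -
      (if has_spanning_tree n (avail n c k) then mst n (avail n c k) c else {})"

text \<open>w(T_k) for k \<ge> 1 (infinity if T_k does not exist).\<close>
definition wT :: "nat \<Rightarrow> nat \<Rightarrow> (nat \<times> nat \<Rightarrow> real) \<Rightarrow> ereal" where
  "wT k n c = (if has_spanning_tree n (avail n c (k - 1))
                 then ereal (weight c (mst n (avail n c (k - 1)) c)) else \<infinity>)"

text \<open>i.i.d. costs on the edges of K_n with common distribution D.\<close>
definition cost_space :: "nat \<Rightarrow> real measure \<Rightarrow> (nat \<times> nat \<Rightarrow> real) measure" where
  "cost_space n D = PiM (Kedges n) (\<lambda>_. D)"

definition unif01 :: "real measure" where
  "unif01 = uniform_measure lborel {0<..<1}"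

definition exp1 :: "real measure" where
  "exp1 = density lborel (exponential_density 1)"

text \<open>Convergence in probability (as n \<rightarrow> \<infinity>) of extended-real random variables X n
  on spaces M n to a real constant g.\<close>
definition conv_in_prob :: "(nat \<Rightarrow> 'a measure) \<Rightarrow> (nat \<Rightarrow> 'a \<Rightarrow> ereal) \<Rightarrow> real \<Rightarrow> bool" where
  "conv_in_prob M X g \<longleftrightarrow> (\<forall>n. X n \<in> borel_measurable (M n)) \<and>
     (\<forall>\<epsilon>>0. (\<lambda>n. measure (M n)
        {\<omega> \<in> space (M n). \<not> (ereal (g - \<epsilon>) < X n \<omega> \<and> X n \<omega> < ereal (g + \<epsilon>))}) \<longlonglongrightarrow> 0)"

end

theory Submission
  imports Defs
begin

text \<open>
  Let the edges arrive in the order of their costs and give each one to the first forest in which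
  it closes no cycle. By Kruskal's rule \<open>T\<^sub>k\<close> is the \<open>k\<close>-th forest, and its cost is the integral
  over time of the number of its components minus 1. With time scaled by \<open>n\<close> it suffices that the
  proportion of components at a fixed time concentrates around a limit, and that late times
  contribute little.

  An edge reaches level \<open>k + 1\<close> only inside a block of level \<open>k\<close>, and up
  to small errors only inside the unique giant block. The giant is unique because the sum of
  \<open>min (\<bar>C\<bar> / L) 1\<close> over the blocks \<open>C\<close> is
  \<open>n / L\<close> at the start and drops by 1 whenever two large blocks merge. Hence the
  proportions of vertices in small blocks of given sizes satisfy, up to small errors, a system of
  differential equations whose right-hand side involves no larger sizes and no higher levels.
  Running two independent copies, possibly with different \<open>n\<close> and different cost
  distributions, Gronwall's inequality shows that the statistics of the copies merge; so they
  concentrate and are Cauchy in \<open>n\<close>, with a limit common to both distributions.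

  At late times most edges between the giant of level \<open>k + 1\<close> and the rest of the giant of level \<open>k\<close>
  have not arrived yet, and each of them shrinks the complement of the giant; this bounds the
  integral of the size of that complement.
\<close>

section \<open>Connectivity relations\<close>

text \<open>That there is only one giant is not shown at any fixed time. Only the time integral of
  \<open>eta\<close> is controlled, by the total drop of the bounded functionals
  \<open>capf\<close>; hence the functional fed into Gronwall's inequality carries a multiple of
  \<open>capf\<close> besides the squared differences. Comparing two copies also spares all theory
  of the limiting equations: neither existence nor uniqueness of a solution is discussed, and the
  mean square distance of independent copies involves only first and second moments of single
  copies. Sizes below \<open>M\<close> on one level depend on sizes below a much larger
  \<open>L\<close> on the level beneath, where \<open>L\<close> depends on \<open>M\<close>, on the
  time horizon and on the accuracy; the induction over levels must therefore speak of all sizes and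
  horizons at once. In the tail, \<open>x\<close> runs up to a fixed fraction of \<open>n\<close>,
  where the error of the idealised generator is too large; there only decreasing functionals are
  used, for which the edges left out of the estimate have the favourable sign. The constant itself
  appears as a limit of Riemann sums, with no formula for it.\<close>

definition cn :: "(nat \<times> nat) set \<Rightarrow> (nat \<times> nat) set" where
  "cn T = {(x, y). adj T x y}\<^sup>*"

lemma cn_refl [simp]: "(x, x) \<in> cn T"
  by (simp add: cn_def)

lemma cn_sym: "(x, y) \<in> cn T \<Longrightarrow> (y, x) \<in> cn T"
proof -
  have "sym {(x, y). adj T x y}"
    by (auto simp: sym_def adj_def)
  then show "(x, y) \<in> cn T \<Longrightarrow> (y, x) \<in> cn T"
    unfolding cn_def by (meson sym_rtrancl symD)
qed

lemma cn_trans: "(x, y) \<in> cn T \<Longrightarrow> (y, z) \<in> cn T \<Longrightarrow> (x, z) \<in> cn T"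
  unfolding cn_def by (rule rtrancl_trans)

lemma cn_mono: "A \<subseteq> B \<Longrightarrow> cn A \<subseteq> cn B"
  unfolding cn_def by (rule rtrancl_mono) (auto simp: adj_def)

lemma cn_edge: "e \<in> T \<Longrightarrow> e \<in> cn T"
  unfolding cn_def by (cases e) (auto simp: adj_def)

lemma cn_subset:
  assumes "A \<subseteq> cn B" shows "cn A \<subseteq> cn B"
proof (rule subrelI)
  fix x y assume "(x, y) \<in> cn A"
  then show "(x, y) \<in> cn B"
    unfolding cn_def[of A]
  proof (induction rule: rtrancl_induct)
    case (step y z)
    then have "(y, z) \<in> cn B"
      using assms cn_sym by (auto simp: adj_def)
    with step show ?case using cn_trans by blast
  qed simp
qed

text \<open>A path can be shortened so that it crosses the new edge at most once, in one of its two
  directions.\<close>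

lemma cn_insert:
  "(x, y) \<in> cn (insert (u, v) T) \<longleftrightarrow>
    (x, y) \<in> cn T \<or> (x, u) \<in> cn T \<and> (v, y) \<in> cn T \<or> (x, v) \<in> cn T \<and> (u, y) \<in> cn T"
  (is "?l \<longleftrightarrow> ?r")
proof
  assume ?l
  then show ?r
    unfolding cn_def[of "insert _ _"]
  proof (induction rule: rtrancl_induct)
    case (step y z)
    from step(2) have "(y, z) \<in> cn T \<or> (y = u \<and> z = v) \<or> (y = v \<and> z = u)"
      using cn_edge cn_sym by (auto simp: adj_def)
    then show ?case
      using step.IH cn_trans cn_refl by metis
  qed simp
next
  have "cn T \<subseteq> cn (insert (u, v) T)" by (rule cn_mono) auto
  moreover have "(u, v) \<in> cn (insert (u, v) T)" by (rule cn_edge) simp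
  moreover assume ?r
  ultimately show ?l
    using cn_trans cn_sym by (metis subsetD)
qed

lemma cn_insert_absorb: "e \<in> cn T \<Longrightarrow> cn (insert e T) = cn T"
  by (rule equalityI; rule cn_subset) (auto intro: cn_edge)

lemma connected_on_cn: "connected_on V T \<longleftrightarrow> (\<forall>u\<in>V. \<forall>v\<in>V. (u, v) \<in> cn T)"
  by (simp add: connected_on_def cn_def)

section \<open>Levels of the greedy forest decomposition\<close>

text \<open>\<open>lev c E j\<close> consists of the edges rejected by the first \<open>j\<close> forests when the edges of \<open>E\<close>
  arrive in the order of their costs.\<close>

primrec lev :: "(nat \<times> nat \<Rightarrow> real) \<Rightarrow> (nat \<times> nat) set \<Rightarrow> nat \<Rightarrow> (nat \<times> nat) set" where
  "lev c E 0 = E"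
| "lev c E (Suc j) = {e \<in> lev c E j. e \<in> cn {f \<in> lev c E j. c f < c e}}"

text \<open>A state \<open>S\<close> lists the edges seen at each level, so \<open>rl S (Suc j)\<close> is the partition of the vertices
  into the components of forest number \<open>j + 1\<close>; level 0 has a single block.\<close>

type_synonym state = "nat \<Rightarrow> (nat \<times> nat) set"

fun rl :: "state \<Rightarrow> nat \<Rightarrow> (nat \<times> nat) set" where
  "rl S 0 = UNIV"
| "rl S (Suc j) = cn (S j)"

text \<open>All levels are tested against the old state at once. In a \<open>good\<close> state the
  partitions get finer with the level, so the levels that receive \<open>e\<close> form an initial
  segment; where it ends, a forest accepts \<open>e\<close>.\<close>

definition ad :: "nat \<times> nat \<Rightarrow> state \<Rightarrow> state" where
  "ad e S = (\<lambda>j. if e \<in> rl S j then insert e (S j) else S j)"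

text \<open>Invariant of the reachable states. Its last clause is what makes the partitions
  \<open>rl\<close> finer from level to level.\<close>

definition good :: "nat \<Rightarrow> state \<Rightarrow> bool" where
  "good n S \<longleftrightarrow> S 0 \<subseteq> Kedges n \<and> (\<forall>j. S (Suc j) \<subseteq> S j \<and> S (Suc j) \<subseteq> cn (S j))"

lemma rl_refl [simp]: "(x, x) \<in> rl S j"
  by (cases j) auto

lemma rl_sym: "(x, y) \<in> rl S j \<Longrightarrow> (y, x) \<in> rl S j"
  by (cases j) (auto intro: cn_sym)

lemma rl_trans: "(x, y) \<in> rl S j \<Longrightarrow> (y, z) \<in> rl S j \<Longrightarrow> (x, z) \<in> rl S j"
  by (cases j) (auto intro: cn_trans)

lemma lev_subset: "lev c E j \<subseteq> E"
  by (induction j) auto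

lemma lev_Suc_cn: "lev c E (Suc j) \<subseteq> cn (lev c E j)"
proof
  fix e assume "e \<in> lev c E (Suc j)"
  then have "e \<in> cn {f \<in> lev c E j. c f < c e}" by simp
  also have "\<dots> \<subseteq> cn (lev c E j)" by (rule cn_mono) auto
  finally show "e \<in> cn (lev c E j)" .
qed

lemma good_lev: "E \<subseteq> Kedges n \<Longrightarrow> good n (lev c E)"
  using lev_Suc_cn by (auto simp: good_def)

lemma rl_Suc_subset:
  assumes "good n S" shows "rl S (Suc j) \<subseteq> rl S j"
proof (cases j)
  case (Suc i)
  have "S (Suc i) \<subseteq> cn (S i)" using assms by (simp add: good_def)
  then show ?thesis using Suc cn_subset by simp
qed simp

text \<open>The costliest edge is tested at every level against all that is present there and has no
  influence on the tests of the cheaper edges. So one arrival is one application of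
  \<open>ad\<close>.\<close>

lemma lev_insert:
  assumes "\<And>f. f \<in> E \<Longrightarrow> c f < c e"
  shows "lev c (insert e E) = ad e (lev c E)"
proof
  have eE: "e \<notin> E" using assms by blast
  fix j
  show "lev c (insert e E) j = ad e (lev c E) j"
  proof (induction j)
    case 0
    then show ?case by (simp add: ad_def)
  next
    case (Suc j)
    have eL: "e \<notin> lev c E i" for i using eE lev_subset by blast
    have lt: "f \<in> lev c E j \<Longrightarrow> c f < c e" for f using assms lev_subset by blast
    have other: "f \<in> lev c (insert e E) (Suc j) \<longleftrightarrow> f \<in> lev c E (Suc j)" if "f \<noteq> e" for f
    proof (cases "f \<in> lev c E j")
      case True
      then have "c f < c e" by (rule lt)
      then have "{g \<in> lev c (insert e E) j. c g < c f} = {g \<in> lev c E j. c g < c f}"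
        unfolding Suc by (auto simp: ad_def)
      then show ?thesis using that Suc by (auto simp: ad_def)
    next
      case False
      then show ?thesis using that Suc by (auto simp: ad_def)
    qed
    have self: "e \<in> lev c (insert e E) (Suc j) \<longleftrightarrow> e \<in> rl (lev c E) (Suc j)"
    proof -
      have "{g \<in> lev c (insert e E) j. c g < c e} = lev c E j"
        unfolding Suc using lt by (auto simp: ad_def)
      then have "e \<in> lev c (insert e E) (Suc j) \<longleftrightarrow> e \<in> rl (lev c E) j \<and> e \<in> cn (lev c E j)"
        using Suc eL by (auto simp: ad_def)
      \<comment> \<open>Rejection by one forest implies rejection by all earlier ones, so the two
        conditions collapse into one.\<close>
      moreover have "cn (lev c E j) \<subseteq> rl (lev c E) j"
      proof (cases j)
        case (Suc i)
        then show ?thesis using cn_subset[OF lev_Suc_cn] by simp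
      qed simp
      ultimately show ?thesis by auto
    qed
    show ?case
    proof (rule set_eqI)
      fix f
      show "f \<in> lev c (insert e E) (Suc j) \<longleftrightarrow> f \<in> ad e (lev c E) (Suc j)"
        using other self eL[of "Suc j"] by (cases "f = e") (auto simp: ad_def)
    qed
  qed
qed

text \<open>Only the order of the costs enters. This leaves finitely many possible states for each
  \<open>n\<close>, on which measurability and integrability rest.\<close>

lemma lev_cong:
  assumes "\<And>e f. e \<in> E \<Longrightarrow> f \<in> E \<Longrightarrow> c e < c f \<longleftrightarrow> d e < d f"
  shows "lev c E = lev d E"
proof
  fix j show "lev c E j = lev d E j"
  proof (induction j)
    case (Suc j)
    have "{f \<in> lev c E j. c f < c e} = {f \<in> lev d E j. d f < d e}" if "e \<in> lev d E j" for e
    proof -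
      have "c f < c e \<longleftrightarrow> d f < d e" if "f \<in> lev d E j" for f
        using assms subsetD[OF lev_subset] that \<open>e \<in> lev d E j\<close> by metis
      then show ?thesis using Suc by auto
    qed
    then show ?case using Suc by auto
  qed simp
qed

text \<open>The test of an edge looks only at cheaper ones, so stopping the process at time
  \<open>t\<close> agrees with cutting the final levels at cost \<open>t\<close>.\<close>

lemma lev_restrict: "lev c {e \<in> E. c e \<le> t} j = {e \<in> lev c E j. c e \<le> t}"
proof (induction j)
  case (Suc j)
  have *: "{f \<in> lev c {e \<in> E. c e \<le> t} j. c f < c e} = {f \<in> lev c E j. c f < c e}" if "c e \<le> t" for e
    unfolding Suc using that by auto
  show ?case
    unfolding lev.simps Suc using * unfolding Suc by auto
qed simp

lemma lev_empty: "lev c {} j = {}"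
  by (induction j) auto

section \<open>Blocks of the level partitions\<close>

definition blk :: "nat \<Rightarrow> state \<Rightarrow> nat \<Rightarrow> nat \<Rightarrow> nat set" where
  "blk n S j u = {w. w < n \<and> (u, w) \<in> rl S j}"

definition sz :: "nat \<Rightarrow> state \<Rightarrow> nat \<Rightarrow> nat \<Rightarrow> nat" where
  "sz n S j u = card (blk n S j u)"

lemma finite_blk [simp]: "finite (blk n S j u)"
  by (simp add: blk_def)

lemma blk_subset: "blk n S j u \<subseteq> {..<n}"
  by (auto simp: blk_def)

lemma blk_self: "u < n \<Longrightarrow> u \<in> blk n S j u"
  by (simp add: blk_def)

lemma blk_eq: "(u, v) \<in> rl S j \<Longrightarrow> blk n S j u = blk n S j v"
  by (auto simp: blk_def dest: rl_trans rl_trans[OF rl_sym])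

lemma sz_eq: "(u, v) \<in> rl S j \<Longrightarrow> sz n S j u = sz n S j v"
  unfolding sz_def using blk_eq by metis

lemma sz_blk: "w \<in> blk n S j u \<Longrightarrow> sz n S j w = sz n S j u"
  using sz_eq[of u w S j n] by (simp add: blk_def)

lemma blk_disjoint: "(u, v) \<notin> rl S j \<Longrightarrow> blk n S j u \<inter> blk n S j v = {}"
  by (auto simp: blk_def dest: rl_trans[OF _ rl_sym])

lemma sz_pos: "u < n \<Longrightarrow> sz n S j u \<ge> 1"
  unfolding sz_def using blk_self[of u n S j] finite_blk[of n S j u]
  by (metis One_nat_def Suc_leI card_gt_0_iff empty_iff)

lemma sz_le: "sz n S j u \<le> n"
  unfolding sz_def using card_mono[OF _ blk_subset] by fastforce

lemma sz_0 [simp]: "sz n S 0 u = n"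
  by (simp add: sz_def blk_def)

lemma blk_mono: "rl S i \<subseteq> rl S' j \<Longrightarrow> blk n S i u \<subseteq> blk n S' j u"
  by (auto simp: blk_def)

lemma sz_mono: "rl S i \<subseteq> rl S' j \<Longrightarrow> sz n S i u \<le> sz n S' j u"
  unfolding sz_def by (intro card_mono blk_mono) auto

text \<open>Mind the shift of the index: forest number \<open>j + 1\<close> is the one that accepts
  \<open>e\<close>.\<close>

definition acc :: "state \<Rightarrow> nat \<Rightarrow> nat \<times> nat \<Rightarrow> bool" where
  "acc S j e \<longleftrightarrow> e \<in> rl S j \<and> e \<notin> rl S (Suc j)"

lemma rl_ad_not_acc: "\<not> acc S j e \<Longrightarrow> rl (ad e S) (Suc j) = rl S (Suc j)"
  using cn_insert_absorb by (auto simp: acc_def ad_def)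

lemma rl_ad_mono: "rl S j \<subseteq> rl (ad e S) j"
  by (cases j) (auto simp: ad_def intro: subsetD[OF cn_mono])

lemma rl_ad_acc:
  assumes "acc S j (u, v)"
  shows "(x, y) \<in> rl (ad (u, v) S) (Suc j) \<longleftrightarrow> (x, y) \<in> rl S (Suc j) \<or>
      (x, u) \<in> rl S (Suc j) \<and> (v, y) \<in> rl S (Suc j) \<or>
      (x, v) \<in> rl S (Suc j) \<and> (u, y) \<in> rl S (Suc j)"
  using assms by (simp add: acc_def ad_def cn_insert)

lemma blk_ad_acc:
  assumes "acc S j (u, v)" and "w < n"
  shows "blk n (ad (u, v) S) (Suc j) w =
    (if w \<in> blk n S (Suc j) u \<union> blk n S (Suc j) v
     then blk n S (Suc j) u \<union> blk n S (Suc j) v else blk n S (Suc j) w)"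
proof -
  define r where "r x y \<longleftrightarrow> (x, y) \<in> rl S (Suc j)" for x y
  have tr: "r x y \<Longrightarrow> r y z \<Longrightarrow> r x z" and sy: "r x y \<Longrightarrow> r y x" and rf: "r x x" for x y z
    unfolding r_def by (erule rl_trans, assumption) (erule rl_sym, simp del: rl.simps)
  have new: "(x, y) \<in> rl (ad (u, v) S) (Suc j) \<longleftrightarrow> r x y \<or> r x u \<and> r v y \<or> r x v \<and> r u y" for x y
    unfolding r_def by (rule rl_ad_acc[OF assms(1)])
  have "r w y \<or> r w u \<and> r v y \<or> r w v \<and> r u y \<longleftrightarrow>
      (if r u w \<or> r v w then r u y \<or> r v y else r w y)" for y
  proof (cases "r u w \<or> r v w")
    case True
    then show ?thesis
      using tr[of u w y] tr[of v w y] tr[of w u y] tr[of w v y] sy[of u w] sy[of v w] by argo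
  next
    case False
    then have "\<not> r w u" "\<not> r w v" using sy by auto
    then show ?thesis using False by simp
  qed
  then have "blk n (ad (u, v) S) (Suc j) w = {y. y < n \<and> (if r u w \<or> r v w then r u y \<or> r v y else r w y)}"
    unfolding blk_def new by simp
  moreover have "blk n S (Suc j) x = {y. y < n \<and> r x y}" for x
    unfolding blk_def r_def by simp
  ultimately show ?thesis
    using assms(2) by auto
qed

text \<open>Only the vertices of the two merging blocks change their value, and a block of size
  \<open>a\<close> contributes \<open>a * g a\<close> to the sum.\<close>

lemma sum_sz_ad:
  fixes g :: "nat \<Rightarrow> real"
  assumes "u < n" "v < n"
  shows "(\<Sum>w<n. g (sz n (ad (u, v) S) (Suc j) w)) - (\<Sum>w<n. g (sz n S (Suc j) w)) =
    (if acc S j (u, v) then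
      (let a = sz n S (Suc j) u; b = sz n S (Suc j) v
       in real (a + b) * g (a + b) - real a * g a - real b * g b) else 0)"
proof (cases "acc S j (u, v)")
  case False
  then have "sz n (ad (u, v) S) (Suc j) w = sz n S (Suc j) w" for w
    by (simp add: sz_def blk_def rl_ad_not_acc del: rl.simps)
  then show ?thesis using False by simp
next
  case True
  define A where "A = blk n S (Suc j) u"
  define B where "B = blk n S (Suc j) v"
  have disj: "A \<inter> B = {}"
    unfolding A_def B_def using True by (intro blk_disjoint) (simp add: acc_def)
  have fin: "finite A" "finite B" by (auto simp: A_def B_def)
  have sub: "A \<union> B \<subseteq> {..<n}" unfolding A_def B_def using blk_subset by blast
  have new: "sz n (ad (u, v) S) (Suc j) w = (if w \<in> A \<union> B then card A + card B else sz n S (Suc j) w)"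
    if "w < n" for w
    using blk_ad_acc[OF True that] card_Un_disjoint[OF fin disj]
    unfolding sz_def A_def[symmetric] B_def[symmetric] by simp
  have "(\<Sum>w<n. g (sz n (ad (u, v) S) (Suc j) w)) - (\<Sum>w<n. g (sz n S (Suc j) w))
      = (\<Sum>w<n. g (sz n (ad (u, v) S) (Suc j) w) - g (sz n S (Suc j) w))"
    by (simp add: sum_subtractf)
  also have "\<dots> = (\<Sum>w\<in>A \<union> B. g (sz n (ad (u, v) S) (Suc j) w) - g (sz n S (Suc j) w))"
    using sub new by (intro sum.mono_neutral_right) auto
  also have "\<dots> = (\<Sum>w\<in>A. g (card A + card B) - g (sz n S (Suc j) w))
      + (\<Sum>w\<in>B. g (card A + card B) - g (sz n S (Suc j) w))"
    using fin disj sub new by (subst sum.union_disjoint) (auto intro!: arg_cong2[where f="(+)"] sum.cong)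
  also have "(\<Sum>w\<in>A. g (card A + card B) - g (sz n S (Suc j) w)) = (\<Sum>w\<in>A. g (card A + card B) - g (card A))"
    by (intro sum.cong refl arg_cong2[where f="(-)"] arg_cong[where f=g])
       (simp add: A_def sz_blk[of _ n S "Suc j" u] sz_def[of n S "Suc j" u])
  also have "(\<Sum>w\<in>B. g (card A + card B) - g (sz n S (Suc j) w)) = (\<Sum>w\<in>B. g (card A + card B) - g (card B))"
    by (intro sum.cong refl arg_cong2[where f="(-)"] arg_cong[where f=g])
       (simp add: B_def sz_blk[of _ n S "Suc j" v] sz_def[of n S "Suc j" v])
  finally show ?thesis
    using True unfolding Let_def sz_def[of n S "Suc j" u] sz_def[of n S "Suc j" v] A_def[symmetric] B_def[symmetric]
    by (simp add: algebra_simps)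
qed

declare rl.simps(2) [simp del]

section \<open>Infinitesimal generator of the arrival process\<close>

text \<open>\<open>F\<close> and \<open>p\<close> are the distribution function and the density near 0. Only costs of order \<open>1 / n\<close>
  matter, so the limit sees nothing but \<open>p 0 = 1\<close>.\<close>

definition cost_dist :: "real measure \<Rightarrow> bool" where
  "cost_dist D \<longleftrightarrow> prob_space D \<and> sets D = sets borel \<and> measure D {..0} = 0 \<and>
    (\<forall>x. measure D {x} = 0) \<and>
    (\<exists>F p. (\<forall>a b. 0 \<le> a \<longrightarrow> a \<le> b \<longrightarrow> b \<le> 1/2 \<longrightarrow> measure D {a<..b} = F b - F a) \<and>
      (\<forall>t\<in>{0..1/2}. (F has_real_derivative p t) (at t within {0..1/2}) \<and> 1 - t \<le> p t \<and> p t \<le> 1))"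

definition St :: "nat \<Rightarrow> (nat \<times> nat \<Rightarrow> real) \<Rightarrow> real \<Rightarrow> state" where
  "St n c t = lev c {e \<in> Kedges n. c e \<le> t}"

text \<open>Withholding \<open>e\<close> makes the state independent of the cost of \<open>e\<close>.\<close>

definition Sw :: "nat \<Rightarrow> nat \<times> nat \<Rightarrow> (nat \<times> nat \<Rightarrow> real) \<Rightarrow> real \<Rightarrow> state" where
  "Sw n e c t = lev c {f \<in> Kedges n - {e}. c f \<le> t}"

definition Ef :: "nat \<Rightarrow> real measure \<Rightarrow> (state \<Rightarrow> real) \<Rightarrow> real \<Rightarrow> real" where
  "Ef n D \<phi> x = (\<integral>c. \<phi> (St n c (x / n)) \<partial>cost_space n D)"

text \<open>The generator in the scaled time \<open>x = n * t\<close>, idealised in two ways: every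
  edge has rate exactly 1 in \<open>t\<close>, and edges that are already present may arrive again.
  \<open>Ef_generator\<close> bounds the cost of this.\<close>

definition Lg :: "nat \<Rightarrow> (state \<Rightarrow> real) \<Rightarrow> state \<Rightarrow> real" where
  "Lg n \<phi> S = (\<Sum>e\<in>Kedges n. \<phi> (ad e S) - \<phi> S) / n"

lemma finite_Kedges [simp]: "finite (Kedges n)"
  by (rule finite_subset[of _ "{..<n} \<times> {..<n}"]) (auto simp: Kedges_def)

lemma good_St [simp]: "good n (St n c t)"
  unfolding St_def by (rule good_lev) auto

lemma good_Sw [simp]: "good n (Sw n e c t)"
  unfolding Sw_def by (rule good_lev) auto

section \<open>Measurability of the state and independence of a single cost\<close>

lemma measurable_finite_set_valued:
  assumes "finite J" and "\<And>\<omega>. \<omega> \<in> space N \<Longrightarrow> B \<omega> \<subseteq> J"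
    and "\<And>j. j \<in> J \<Longrightarrow> {\<omega> \<in> space N. j \<in> B \<omega>} \<in> sets N"
  shows "B \<in> measurable N (count_space (Pow J))"
proof (subst measurable_count_space_eq2)
  show "finite (Pow J)" using assms(1) by simp
  show "B \<in> space N \<rightarrow> Pow J \<and> (\<forall>z\<in>Pow J. B -` {z} \<inter> space N \<in> sets N)"
  proof (intro conjI ballI funcsetI)
    fix z assume z: "z \<in> Pow J"
    have "B -` {z} \<inter> space N = {\<omega> \<in> space N. \<forall>j\<in>J. j \<in> B \<omega> \<longleftrightarrow> j \<in> z}"
      using assms(2) z by blast
    also have "\<dots> \<in> sets N"
    proof (intro sets.sets_Collect_finite_All assms(1))
      fix j assume j: "j \<in> J"
      show "{\<omega> \<in> space N. j \<in> B \<omega> \<longleftrightarrow> j \<in> z} \<in> sets N"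
        using assms(3)[OF j] sets.sets_Collect_neg[OF assms(3)[OF j]] by (cases "j \<in> z") auto
    qed
    finally show "B -` {z} \<inter> space N \<in> sets N" .
  qed (use assms(2) in auto)
qed

text \<open>By \<open>lev_cong\<close> the state is a function of the finite comparison table
  \<open>Z\<close> and of the set \<open>A\<close> of edges in play; \<open>SOME\<close> picks, for
  each table, one cost function that realises it.\<close>

lemma measurable_lev:
  fixes \<phi> :: "state \<Rightarrow> 'b"
  assumes I: "finite I"
    and X: "\<And>e. e \<in> I \<Longrightarrow> (\<lambda>\<omega>. X \<omega> e) \<in> borel_measurable N"
    and A: "\<And>\<omega>. \<omega> \<in> space N \<Longrightarrow> A \<omega> \<subseteq> I"
      "\<And>e. e \<in> I \<Longrightarrow> {\<omega> \<in> space N. e \<in> A \<omega>} \<in> sets N"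
  shows "(\<lambda>\<omega>. \<phi> (lev (X \<omega>) (A \<omega>))) \<in> measurable N (count_space UNIV)"
proof -
  define Z where "Z \<omega> = {z \<in> I \<times> I. X \<omega> (fst z) < X \<omega> (snd z)}" for \<omega>
  define \<Psi> where "\<Psi> z a = \<phi> (lev (SOME c. {y \<in> I \<times> I. c (fst y) < (c (snd y) :: real)} = z) a)" for z a
  have eq: "\<phi> (lev (X \<omega>) (A \<omega>)) = \<Psi> (Z \<omega>) (A \<omega>)" if "\<omega> \<in> space N" for \<omega>
  proof -
    define d where "d = (SOME c. {y \<in> I \<times> I. c (fst y) < (c (snd y) :: real)} = Z \<omega>)"
    have Zd: "{y \<in> I \<times> I. d (fst y) < d (snd y)} = Z \<omega>"
      unfolding d_def by (rule someI[of _ "X \<omega>"]) (simp add: Z_def)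
    have "X \<omega> e < X \<omega> f \<longleftrightarrow> d e < d f" if "e \<in> I" "f \<in> I" for e f
    proof -
      have "(e, f) \<in> {y \<in> I \<times> I. d (fst y) < d (snd y)} \<longleftrightarrow> (e, f) \<in> Z \<omega>"
        unfolding Zd ..
      with that show ?thesis by (simp add: Z_def)
    qed
    then have "lev (X \<omega>) (A \<omega>) = lev d (A \<omega>)"
      using A(1)[OF that] by (intro lev_cong) blast
    then show ?thesis unfolding \<Psi>_def d_def by simp
  qed
  have Zm: "Z \<in> measurable N (count_space (Pow (I \<times> I)))"
  proof (rule measurable_finite_set_valued)
    fix z assume "z \<in> I \<times> I"
    then have [measurable]: "(\<lambda>\<omega>. X \<omega> (fst z)) \<in> borel_measurable N" "(\<lambda>\<omega>. X \<omega> (snd z)) \<in> borel_measurable N"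
      using X by auto
    have "{\<omega> \<in> space N. X \<omega> (fst z) < X \<omega> (snd z)} \<in> sets N" by measurable
    then show "{\<omega> \<in> space N. z \<in> Z \<omega>} \<in> sets N" using \<open>z \<in> I \<times> I\<close> by (simp add: Z_def)
  qed (use I in \<open>auto simp: Z_def\<close>)
  have Am: "A \<in> measurable N (count_space (Pow I))"
    by (rule measurable_finite_set_valued) (use assms in auto)
  have "(\<lambda>\<omega>. \<Psi> (Z \<omega>) (A \<omega>)) \<in> measurable N (count_space UNIV)"
  proof (rule measurable_compose_countable'[OF _ Zm])
    fix z
    show "(\<lambda>\<omega>. \<Psi> z (A \<omega>)) \<in> measurable N (count_space UNIV)"
      by (rule measurable_compose_countable'[OF _ Am, where f="\<lambda>a \<omega>. \<Psi> z a"])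
         (use I in \<open>auto intro!: countable_finite\<close>)
  qed (use I in \<open>auto intro!: countable_finite\<close>)
  then show ?thesis using eq by (simp cong: measurable_cong)
qed

context
  fixes n :: nat and D :: "real measure"
  assumes D: "cost_dist D"
begin

lemma prob_D: "prob_space D" and sets_D: "sets D = sets borel"
  using D by (auto simp: cost_dist_def)

lemma prob_cost_space: "prob_space (cost_space n D)"
  unfolding cost_space_def using prob_D by (intro prob_space_PiM)

lemma measurable_cost [measurable]:
  "e \<in> Kedges n \<Longrightarrow> (\<lambda>c. c e) \<in> borel_measurable (cost_space n D)"
  unfolding cost_space_def using measurable_component_singleton[of e "Kedges n" "\<lambda>_. D"]
  by (simp cong: measurable_cong_sets add: sets_D)

lemma measurable_St': "(\<lambda>c. \<phi> (St n c t)) \<in> measurable (cost_space n D) (count_space UNIV)"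
  unfolding St_def by (rule measurable_lev[of "Kedges n"]) auto

lemma measurable_St: "(\<lambda>c. \<phi> (St n c t) :: real) \<in> borel_measurable (cost_space n D)"
  using measurable_St'[of "\<lambda>S. \<phi> S"] by (rule measurable_compose) simp

lemma measurable_Sw: "(\<lambda>c. \<phi> (Sw n e c t) :: real) \<in> borel_measurable (cost_space n D)"
  unfolding Sw_def
  by (rule measurable_compose[of _ _ "count_space UNIV"], rule measurable_lev[of "Kedges n"]) auto

lemma integrable_bounded:
  fixes f :: "_ \<Rightarrow> real"
  assumes "f \<in> borel_measurable (cost_space n D)" "\<And>c. \<bar>f c\<bar> \<le> B"
  shows "integrable (cost_space n D) f"
proof -
  interpret prob_space "cost_space n D" by (rule prob_cost_space)
  show ?thesis using assms by (intro integrable_const_bound[of _ B]) auto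
qed

text \<open>Fubini in the coordinate \<open>e\<close>. Independence from the cost of
  \<open>e\<close> is expressed pointwise, as invariance of \<open>\<psi>\<close> under changing
  that coordinate.\<close>

lemma expectation_indep:
  fixes g :: "real \<Rightarrow> real"
  assumes e: "e \<in> Kedges n"
    and g: "g \<in> borel_measurable borel" "\<And>y. \<bar>g y\<bar> \<le> B"
    and \<psi>: "\<psi> \<in> borel_measurable (cost_space n D)" "\<And>c. \<bar>\<psi> c\<bar> \<le> B'"
      "\<And>c y. \<psi> (c(e := y)) = \<psi> c"
  shows "(\<integral>c. g (c e) * \<psi> c \<partial>cost_space n D) = (\<integral>y. g y \<partial>D) * (\<integral>c. \<psi> c \<partial>cost_space n D)"
proof -
  interpret D: prob_space D by (rule prob_D)
  interpret product_sigma_finite "\<lambda>_::nat \<times> nat. D"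
    by unfold_locales
  define J where "J = Kedges n - {e}"
  have ins: "Kedges n = insert e J" and J: "finite J" "e \<notin> J" using e by (auto simp: J_def)
  have m: "(\<lambda>c. g (c e) * \<psi> c) \<in> borel_measurable (cost_space n D)"
    using measurable_compose[OF measurable_cost[OF e] g(1)] \<psi>(1) by measurable
  have "\<bar>g (c e) * \<psi> c\<bar> \<le> B * B'" for c
    using g(2)[of "c e"] \<psi>(2)[of c] by (auto simp: abs_mult intro!: mult_mono order_trans[OF abs_ge_zero])
  then have int: "integrable (cost_space n D) (\<lambda>c. g (c e) * \<psi> c)" by (rule integrable_bounded[OF m])
  have "(\<integral>c. g (c e) * \<psi> c \<partial>cost_space n D) = (\<integral>c. (\<integral>y. g y * \<psi> c \<partial>D) \<partial>PiM J (\<lambda>_. D))"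
    unfolding cost_space_def ins
    by (subst product_integral_insert[OF J int[unfolded cost_space_def ins]]) (simp add: \<psi>(3))
  also have "\<dots> = (\<integral>y. g y \<partial>D) * (\<integral>c. \<psi> c \<partial>PiM J (\<lambda>_. D))" by simp
  \<comment> \<open>The coordinate \<open>e\<close> is put back: integrating it out of a function
    that ignores it gives a factor 1.\<close>
  also have "(\<integral>c. \<psi> c \<partial>PiM J (\<lambda>_. D)) = (\<integral>c. \<psi> c \<partial>cost_space n D)"
    unfolding cost_space_def ins
    by (subst product_integral_insert[OF J integrable_bounded[OF \<psi>(1,2), unfolded cost_space_def ins]])
       (simp_all add: \<psi>(3) D.prob_space)
  finally show ?thesis .
qed

lemma expectation_indep_set:
  assumes e: "e \<in> Kedges n" and A: "A \<in> sets borel"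
    and \<psi>: "\<psi> \<in> borel_measurable (cost_space n D)" "\<And>c. \<bar>\<psi> c\<bar> \<le> B'"
      "\<And>c y. \<psi> (c(e := y)) = \<psi> c"
  shows "(\<integral>c. indicator A (c e) * \<psi> c \<partial>cost_space n D) = measure D A * (\<integral>c. \<psi> c \<partial>cost_space n D)"
  using expectation_indep[OF e _ _ \<psi>, of "indicator A" 1] A prob_D
  by (auto simp: sets_D indicator_def split: if_splits intro!: prob_space.finite_measure)
    (simp_all add: sets_D indicator_def[symmetric] sets_eq_imp_space_eq[OF sets_D])

lemma prob_cost:
  assumes e: "e \<in> Kedges n" and A: "A \<in> sets borel"
  shows "(\<integral>c. indicator A (c e) \<partial>cost_space n D) = measure D A"
  using expectation_indep_set[OF assms, of "\<lambda>_. 1" 1] prob_space.prob_space[OF prob_cost_space] by simp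

end

text \<open>If at most one edge arrives in the interval, the increment equals the sum exactly;
  otherwise a crude bound applies, paid for by the number of ordered pairs of arrivals. With a
  single arrival \<open>e\<close>, the state without \<open>e\<close> is the same at both end
  points. So \<open>t\<close> may be either of them, which yields the derivative from both
  sides.\<close>

lemma increment_at_most_one:
  fixes \<phi> :: "state \<Rightarrow> real" and B :: real
  assumes t: "t1 \<le> t2" "t = t1 \<or> t = t2" and B: "\<And>S. \<bar>\<phi> S\<bar> \<le> B"
  shows "\<bar>\<phi> (St n c t2) - \<phi> (St n c t1) -
      (\<Sum>e\<in>Kedges n. indicator {t1<..t2} (c e) * (\<phi> (ad e (Sw n e c t)) - \<phi> (Sw n e c t)))\<bar>
    \<le> (2 * B + card (Kedges n) * (2 * B)) *
      (\<Sum>e\<in>Kedges n. \<Sum>f\<in>Kedges n - {e}. indicator {t1<..t2} (c e) * indicator {t1<..t2} (c f))"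
proof -
  let ?L = "\<bar>\<phi> (St n c t2) - \<phi> (St n c t1) -
      (\<Sum>e\<in>Kedges n. indicator {t1<..t2} (c e) * (\<phi> (ad e (Sw n e c t)) - \<phi> (Sw n e c t)))\<bar>"
  let ?K = "2 * B + card (Kedges n) * (2 * B)"
  let ?R = "\<Sum>e\<in>Kedges n. \<Sum>f\<in>Kedges n - {e}. indicator {t1<..t2} (c e) * indicator {t1<..t2} (c f) :: real"
  define N where "N = {e \<in> Kedges n. c e \<in> {t1<..t2}}"
  define \<delta> where "\<delta> e = \<phi> (ad e (Sw n e c t)) - \<phi> (Sw n e c t)" for e
  have B0: "0 \<le> B" using B[of "\<lambda>_. {}"] by linarith
  have \<delta>B: "\<bar>\<delta> e\<bar> \<le> 2 * B" for e
    unfolding \<delta>_def using B[of "ad e (Sw n e c t)"] B[of "Sw n e c t"] by linarith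
  have finN: "finite N" by (simp add: N_def)
  have sumN: "(\<Sum>e\<in>Kedges n. indicator {t1<..t2} (c e) * \<delta> e) = (\<Sum>e\<in>N. \<delta> e)"
    unfolding N_def by (simp add: indicator_def if_distrib[of "\<lambda>x. x * _"] sum.If_cases Int_def cong: if_cong)
  have R0: "0 \<le> ?R" by (intro sum_nonneg) auto
  consider "N = {}" | e where "N = {e}" | e f where "e \<in> N" "f \<in> N" "e \<noteq> f" by blast
  then show ?thesis
  proof cases
    case 1
    have "c e \<le> t2 \<longleftrightarrow> c e \<le> t1" if "e \<in> Kedges n" for e
    proof -
      have "e \<notin> N" using 1 by simp
      then show ?thesis using that t(1) by (simp add: N_def) linarith
    qed
    then have "{e \<in> Kedges n. c e \<le> t2} = {e \<in> Kedges n. c e \<le> t1}"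
      by (rule Collect_cong[OF conj_cong[OF refl]])
    then have "?L = 0" using 1 sumN[unfolded \<delta>_def] by (simp add: St_def)
    then show ?thesis using R0 B0 by simp
  next
    case (2 e)
    then have e: "e \<in> Kedges n" "t1 < c e" "c e \<le> t2" by (auto simp: N_def)
    have other: "c f \<le> t1 \<or> t2 < c f" if "f \<in> Kedges n" "f \<noteq> e" for f
    proof -
      have "f \<notin> N" using 2 that(2) by simp
      then show ?thesis using that by (simp add: N_def) linarith
    qed
    have s1: "{f \<in> Kedges n - {e}. c f \<le> t} = {f \<in> Kedges n. c f \<le> t1}"
    proof (rule Collect_cong)
      fix f show "f \<in> Kedges n - {e} \<and> c f \<le> t \<longleftrightarrow> f \<in> Kedges n \<and> c f \<le> t1"
        using other[of f] e t by (cases "f = e") auto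
    qed
    have s2: "{f \<in> Kedges n. c f \<le> t2} = insert e {f \<in> Kedges n. c f \<le> t1}"
    proof (rule set_eqI)
      fix f show "f \<in> {f \<in> Kedges n. c f \<le> t2} \<longleftrightarrow> f \<in> insert e {f \<in> Kedges n. c f \<le> t1}"
        using other[of f] e t by (cases "f = e") auto
    qed
    have "St n c t2 = ad e (St n c t1)"
      unfolding St_def s2 using e by (intro lev_insert) auto
    moreover have "Sw n e c t = St n c t1" unfolding Sw_def St_def s1 ..
    ultimately have "?L = 0" using 2 sumN[unfolded \<delta>_def] by simp
    then show ?thesis using R0 B0 by simp
  next
    case (3 e f)
    have "\<bar>\<Sum>e\<in>N. \<delta> e\<bar> \<le> (\<Sum>e\<in>N. 2 * B)"
      using \<delta>B by (intro order_trans[OF sum_abs] sum_mono) auto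
    also have "\<dots> \<le> card (Kedges n) * (2 * B)"
      using B0 by (auto simp: N_def intro!: mult_right_mono card_mono)
    finally have "?L \<le> ?K"
      using B[of "St n c t2"] B[of "St n c t1"]
      unfolding \<delta>_def[symmetric] sumN abs_le_iff by linarith
    moreover have "1 \<le> ?R"
    proof -
      have "1 = (indicator {t1<..t2} (c e) * indicator {t1<..t2} (c f) :: real)"
        using 3 by (simp add: N_def)
      also have "\<dots> \<le> (\<Sum>f\<in>Kedges n - {e}. indicator {t1<..t2} (c e) * indicator {t1<..t2} (c f))"
        using 3 by (intro member_le_sum[where f="\<lambda>f. indicator {t1<..t2} (c e) * indicator {t1<..t2} (c f)"]) (auto simp: N_def)
      also have "\<dots> \<le> ?R"
        using 3 by (intro member_le_sum[where f="\<lambda>e. \<Sum>f\<in>Kedges n - {e}. indicator {t1<..t2} (c e) * indicator {t1<..t2} (c f)"])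
          (auto simp: N_def intro!: sum_nonneg)
      finally show ?thesis .
    qed
    moreover have "0 \<le> ?K" using B0 by simp
    ultimately have "?K * 1 \<le> ?K * ?R" by (intro mult_left_mono)
    then show ?thesis unfolding mult_1_right by (rule order_trans[OF \<open>?L \<le> ?K\<close>])
  qed
qed

section \<open>Time derivatives of expectations\<close>

lemma has_derivative_quadratic_error:
  fixes F G :: "real \<Rightarrow> real"
  assumes G: "(G has_real_derivative p) (at t within T)"
    and K: "\<And>s. s \<in> T \<Longrightarrow> \<bar>F s - F t - (G s - G t) * H\<bar> \<le> K * (s - t)\<^sup>2"
    and t: "t \<in> T"
  shows "(F has_real_derivative p * H) (at t within T)"
proof -
  define E where "E s = F s - F t - (G s - G t) * H" for s
  have "(E has_real_derivative 0) (at t within T)"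
    unfolding has_field_derivative_iff
  proof (rule Lim_null_comparison[where g="\<lambda>s. \<bar>K\<bar> * \<bar>s - t\<bar>"])
    show "\<forall>\<^sub>F s in at t within T. norm ((E s - E t) / (s - t)) \<le> \<bar>K\<bar> * \<bar>s - t\<bar>"
    proof (rule eventually_at_topological[THEN iffD2], intro exI[of _ UNIV] conjI ballI impI)
      fix s assume s: "s \<noteq> t" "s \<in> T"
      have "\<bar>E s\<bar> \<le> \<bar>K\<bar> * (s - t)\<^sup>2"
        using K[OF s(2)] by (smt (verit) E_def mult_right_mono zero_le_power2)
      then have "\<bar>E s\<bar> / \<bar>s - t\<bar> \<le> \<bar>K\<bar> * \<bar>s - t\<bar>"
        using s(1) by (simp add: divide_le_eq mult.assoc flip: power2_eq_square)
      then show "norm ((E s - E t) / (s - t)) \<le> \<bar>K\<bar> * \<bar>s - t\<bar>"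
        by (simp add: E_def)
    qed auto
    show "((\<lambda>s. \<bar>K\<bar> * \<bar>s - t\<bar>) \<longlongrightarrow> 0) (at t within T)"
      by (rule tendsto_eq_intros refl | simp)+
  qed
  then have "((\<lambda>s. E s + F t + (G s - G t) * H) has_real_derivative 0 + 0 + (p - 0) * H) (at t within T)"
    by (intro DERIV_add DERIV_const DERIV_cmult_right[OF DERIV_diff[OF G DERIV_const]])
  then show ?thesis by (simp add: E_def)
qed

context
  fixes n :: nat and D :: "real measure"
  assumes D: "cost_dist D"
begin

lemma measure_Ioc_le:
  assumes "0 \<le> a" "a \<le> b" "b \<le> 1/2"
  shows "measure D {a<..b} \<le> b - a"
proof -
  obtain F p where F: "\<And>a b. 0 \<le> a \<Longrightarrow> a \<le> b \<Longrightarrow> b \<le> 1/2 \<Longrightarrow> measure D {a<..b} = F b - F a"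
    and p: "\<And>t. t \<in> {0..1/2} \<Longrightarrow> (F has_real_derivative p t) (at t within {0..1/2}) \<and> 1 - t \<le> p t \<and> p t \<le> 1"
    using D unfolding cost_dist_def by blast
  show ?thesis
  proof (cases "a = b")
    case False
    have "\<exists>x\<in>{a<..<b}. F b - F a = p x * (b - a)"
      by (rule mvt_simple[where f'="\<lambda>x. (*) (p x)"])
        (use assms False p in \<open>auto simp flip: has_field_derivative_def intro: DERIV_subset[where s="{0..1/2}"]\<close>)
    then obtain x where x: "a < x" "x < b" "F b - F a = p x * (b - a)" by auto
    then have "p x * (b - a) \<le> 1 * (b - a)"
      using p[of x] assms by (intro mult_right_mono) auto
    then show ?thesis using F assms x by simp
  qed (use F assms in auto)
qed

text \<open>In a short interval, an arrival of \<open>e\<close> contributes its probability times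
  the mean effect on the state without \<open>e\<close>, by independence; two arrivals have
  probability of second order. The density enters as \<open>p\<close>, of which only the bounds are
  kept.\<close>

lemma Ef_derivative:
  fixes \<phi> :: "state \<Rightarrow> real" and B :: real
  assumes B: "\<And>S. \<bar>\<phi> S\<bar> \<le> B" and t: "t \<in> {0..1/2}"
  shows "\<exists>p. 1 - t \<le> p \<and> p \<le> 1 \<and>
    ((\<lambda>t. \<integral>c. \<phi> (St n c t) \<partial>cost_space n D) has_real_derivative
      p * (\<Sum>e\<in>Kedges n. \<integral>c. \<phi> (ad e (Sw n e c t)) - \<phi> (Sw n e c t) \<partial>cost_space n D))
    (at t within {0..1/2})"
proof -
  obtain F p where F: "\<And>a b. 0 \<le> a \<Longrightarrow> a \<le> b \<Longrightarrow> b \<le> 1/2 \<Longrightarrow> measure D {a<..b} = F b - F a"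
    and p: "\<And>t. t \<in> {0..1/2} \<Longrightarrow> (F has_real_derivative p t) (at t within {0..1/2}) \<and> 1 - t \<le> p t \<and> p t \<le> 1"
    using D unfolding cost_dist_def by blast
  define M where "M = cost_space n D"
  interpret M: prob_space M unfolding M_def by (rule prob_cost_space[OF D])
  define \<delta> where "\<delta> e c = \<phi> (ad e (Sw n e c t)) - \<phi> (Sw n e c t)" for e c
  define H where "H = (\<Sum>e\<in>Kedges n. \<integral>c. \<delta> e c \<partial>M)"
  define G where "G t = (\<integral>c. \<phi> (St n c t) \<partial>M)" for t
  define K where "K = 2 * B + card (Kedges n) * (2 * B)"
  define C where "C = K * (\<Sum>e\<in>Kedges n. \<Sum>f\<in>Kedges n - {e}. 1)"
  have B0: "0 \<le> B" using B[of "\<lambda>_. {}"] by linarith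
  then have K0: "0 \<le> K" by (simp add: K_def)
  have \<delta>B: "\<bar>\<delta> e c\<bar> \<le> 2 * B" for e c
    unfolding \<delta>_def using B[of "ad e (Sw n e c t)"] B[of "Sw n e c t"] by linarith
  have [measurable]: "(\<lambda>c. \<phi> (St n c t)) \<in> borel_measurable M" for t
    unfolding M_def by (rule measurable_St[OF D])
  have \<delta>m[measurable]: "\<delta> e \<in> borel_measurable M" for e
    unfolding M_def \<delta>_def
    by (intro borel_measurable_diff measurable_Sw[OF D] measurable_Sw[OF D, of "\<lambda>S. \<phi> (ad e S)"])
  have \<delta>indep: "\<delta> e (c(e := y)) = \<delta> e c" for e c y
  proof -
    have "{f \<in> Kedges n - {e}. (c(e := y)) f \<le> t} = {f \<in> Kedges n - {e}. c f \<le> t}" by auto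
    moreover have "lev (c(e := y)) {f \<in> Kedges n - {e}. c f \<le> t} = lev c {f \<in> Kedges n - {e}. c f \<le> t}"
      by (rule lev_cong) simp
    ultimately have "Sw n e (c(e := y)) t = Sw n e c t" by (simp add: Sw_def)
    then show ?thesis by (simp add: \<delta>_def)
  qed
  have meas_cost[measurable]: "e \<in> Kedges n \<Longrightarrow> (\<lambda>c. c e) \<in> borel_measurable M" for e
    unfolding M_def by (rule measurable_cost[OF D])
  have intb: "integrable M f" if "f \<in> borel_measurable M" "\<And>c. \<bar>f c\<bar> \<le> b" for f :: "_ \<Rightarrow> real" and b :: real
    using that unfolding M_def by (rule integrable_bounded[OF D])
  have main: "\<bar>G t2 - G t1 - (F t2 - F t1) * H\<bar> \<le> C * (t2 - t1)\<^sup>2"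
    if t12: "0 \<le> t1" "t1 \<le> t2" "t2 \<le> 1/2" "t = t1 \<or> t = t2" for t1 t2
  proof -
    define I where "I c e = (indicator {t1<..t2} (c e) :: real)" for c :: "nat \<times> nat \<Rightarrow> real" and e
    have d: "measure D {t1<..t2} = F t2 - F t1" using F t12 by simp
    have dle: "measure D {t1<..t2} \<le> t2 - t1" by (rule measure_Ioc_le) (use t12 in auto)
    have i1: "integrable M (\<lambda>c. I c e * \<delta> e c)" if "e \<in> Kedges n" for e
      using that by (intro intb[of _ "2 * B"]) (auto simp: I_def indicator_def \<delta>B B0)
    have i2: "integrable M (\<lambda>c. I c e * I c f)" if "e \<in> Kedges n" "f \<in> Kedges n" for e f
      using that by (intro intb[of _ 1]) (auto simp: I_def indicator_def)
    have i3: "integrable M (\<lambda>c. \<phi> (St n c t))" for t by (intro intb[of _ B]) (auto simp: B)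
    have e1: "(\<integral>c. I c e * \<delta> e c \<partial>M) = (F t2 - F t1) * (\<integral>c. \<delta> e c \<partial>M)" if "e \<in> Kedges n" for e
      unfolding M_def d[symmetric] I_def
      by (rule expectation_indep_set[OF D that _ \<delta>m[unfolded M_def] \<delta>B \<delta>indep]) simp
    have e2: "(\<integral>c. I c e * I c f \<partial>M) \<le> (t2 - t1)\<^sup>2" if "e \<in> Kedges n" "f \<in> Kedges n" "f \<noteq> e" for e f
    proof -
      have "(\<integral>c. I c e * I c f \<partial>M) = measure D {t1<..t2} * (\<integral>c. I c f \<partial>M)"
        unfolding M_def I_def
        by (rule expectation_indep_set[OF D that(1), where B'=1])
           (use that meas_cost[of f] in \<open>auto simp: M_def indicator_def\<close>)
      also have "(\<integral>c. I c f \<partial>M) = measure D {t1<..t2}"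
        unfolding M_def I_def by (rule prob_cost[OF D that(2)]) simp
      finally show ?thesis
        using mult_mono[OF dle dle] t12 by (simp add: power2_eq_square)
    qed
    have e3: "(\<integral>c. (\<Sum>e\<in>Kedges n. \<Sum>f\<in>Kedges n - {e}. I c e * I c f) \<partial>M)
        = (\<Sum>e\<in>Kedges n. \<Sum>f\<in>Kedges n - {e}. \<integral>c. I c e * I c f \<partial>M)"
    proof -
      have "(\<integral>c. (\<Sum>e\<in>Kedges n. \<Sum>f\<in>Kedges n - {e}. I c e * I c f) \<partial>M)
          = (\<Sum>e\<in>Kedges n. \<integral>c. (\<Sum>f\<in>Kedges n - {e}. I c e * I c f) \<partial>M)"
        by (rule Bochner_Integration.integral_sum, rule Bochner_Integration.integrable_sum, rule i2) auto
      also have "\<dots> = (\<Sum>e\<in>Kedges n. \<Sum>f\<in>Kedges n - {e}. \<integral>c. I c e * I c f \<partial>M)"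
        by (intro sum.cong refl Bochner_Integration.integral_sum i2) auto
      finally show ?thesis .
    qed
    have "G t2 - G t1 - (F t2 - F t1) * H
        = (\<integral>c. \<phi> (St n c t2) - \<phi> (St n c t1) - (\<Sum>e\<in>Kedges n. I c e * \<delta> e c) \<partial>M)"
      using i1 i3 by (simp add: G_def H_def e1 sum_distrib_left)
    also have "\<bar>\<dots>\<bar> \<le> (\<integral>c. \<bar>\<phi> (St n c t2) - \<phi> (St n c t1) - (\<Sum>e\<in>Kedges n. I c e * \<delta> e c)\<bar> \<partial>M)"
      by (rule integral_abs_bound)
    also have "\<dots> \<le> (\<integral>c. K * (\<Sum>e\<in>Kedges n. \<Sum>f\<in>Kedges n - {e}. I c e * I c f) \<partial>M)"
      unfolding K_def \<delta>_def I_def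
      by (intro integral_mono increment_at_most_one)
         (use i1 i2 i3 t12 B in \<open>auto simp: \<delta>_def[symmetric] I_def[symmetric] intro!: Bochner_Integration.integrable_sum\<close>)
    also have "\<dots> = K * (\<Sum>e\<in>Kedges n. \<Sum>f\<in>Kedges n - {e}. (\<integral>c. I c e * I c f \<partial>M))"
      by (simp only: integral_mult_right_zero e3)
    also have "\<dots> \<le> K * (\<Sum>e\<in>Kedges n. \<Sum>f\<in>Kedges n - {e}. (t2 - t1)\<^sup>2)"
      using e2 K0 by (intro mult_left_mono sum_mono) auto
    also have "\<dots> = C * (t2 - t1)\<^sup>2" by (simp add: C_def sum_distrib_right)
    finally show ?thesis .
  qed
  have "(G has_real_derivative p t * H) (at t within {0..1/2})"
  proof (rule has_derivative_quadratic_error)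
    show "(F has_real_derivative p t) (at t within {0..1/2})" using p t by blast
    fix s :: real assume s: "s \<in> {0..1/2}"
    show "\<bar>G s - G t - (F s - F t) * H\<bar> \<le> C * (s - t)\<^sup>2"
    proof (cases "t \<le> s")
      case True
      then show ?thesis using main[of t s] s t by simp
    next
      case False
      have "G s - G t - (F s - F t) * H = - (G t - G s - (F t - F s) * H)" by (simp add: algebra_simps)
      then show ?thesis using main[of s t] s t False by (simp add: power2_commute)
    qed
  qed (rule t)
  then show ?thesis using p[OF t] unfolding G_def H_def \<delta>_def M_def by blast
qed

end

lemma card_Kedges_le: "card (Kedges n) \<le> n * n"
proof -
  have "Kedges n \<subseteq> {..<n} \<times> {..<n}" by (auto simp: Kedges_def)
  then show ?thesis using card_mono[of "{..<n} \<times> {..<n}"] by fastforce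
qed

text \<open>Makes every functional of the state bounded for fixed \<open>n\<close>, so
  \<open>integrable_St\<close> can do without hypotheses.\<close>

lemma finite_states: "finite {lev c A |c A. A \<subseteq> Kedges n}"
proof (rule finite_subset)
  let ?Z = "\<lambda>c. {y \<in> Kedges n \<times> Kedges n. c (fst y) < (c (snd y) :: real)}"
  let ?g = "\<lambda>(z, A). lev (SOME c. ?Z c = z) A"
  show "finite (?g ` (Pow (Kedges n \<times> Kedges n) \<times> Pow (Kedges n)))" by simp
  show "{lev c A |c A. A \<subseteq> Kedges n} \<subseteq> ?g ` (Pow (Kedges n \<times> Kedges n) \<times> Pow (Kedges n))"
  proof (rule subsetI, elim CollectE exE conjE)
    fix S c A assume S: "S = lev c A" and A: "A \<subseteq> Kedges n"
    have Z: "?Z (SOME d. ?Z d = ?Z c) = ?Z c" by (rule someI[of _ c]) simp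
    have "lev c A = lev (SOME d. ?Z d = ?Z c) A"
    proof (rule lev_cong)
      fix e f assume "e \<in> A" "f \<in> A"
      then have "(e, f) \<in> ?Z (SOME d. ?Z d = ?Z c) \<longleftrightarrow> (SOME d. ?Z d = ?Z c) e < (SOME d. ?Z d = ?Z c) f"
        "(e, f) \<in> ?Z c \<longleftrightarrow> c e < c f" using A by auto
      then show "c e < c f \<longleftrightarrow> (SOME d. ?Z d = ?Z c) e < (SOME d. ?Z d = ?Z c) f"
        unfolding Z by simp
    qed
    then show "S \<in> ?g ` (Pow (Kedges n \<times> Kedges n) \<times> Pow (Kedges n))"
      using S A by (intro image_eqI[of _ _ "(?Z c, A)"]) auto
  qed
qed

context
  fixes n :: nat and D :: "real measure"
  assumes D: "cost_dist D"
begin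

lemma integrable_St: "integrable (cost_space n D) (\<lambda>c. \<phi> (St n c t) :: real)"
proof -
  let ?R = "{lev c A |c A. A \<subseteq> Kedges n}"
  have "\<bar>\<phi> (St n c t)\<bar> \<le> Max ((\<lambda>S. \<bar>\<phi> S\<bar>) ` ?R)" for c
    using finite_states[of n] by (intro Max_ge finite_imageI imageI) (auto simp: St_def)
  then show ?thesis by (intro integrable_bounded[OF D] measurable_St[OF D])
qed

lemma Ef_mono: "(\<And>c. \<phi> (St n c (x / n)) \<le> \<psi> (St n c (x / n))) \<Longrightarrow> Ef n D \<phi> x \<le> Ef n D \<psi> x"
  unfolding Ef_def by (intro integral_mono integrable_St)

lemma Ef_add: "Ef n D (\<lambda>S. \<phi> S + \<psi> S) x = Ef n D \<phi> x + Ef n D \<psi> x"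
  unfolding Ef_def by (intro Bochner_Integration.integral_add integrable_St)

lemma Ef_diff: "Ef n D (\<lambda>S. \<phi> S - \<psi> S) x = Ef n D \<phi> x - Ef n D \<psi> x"
  unfolding Ef_def by (intro Bochner_Integration.integral_diff integrable_St)

lemma Ef_sum: "Ef n D (\<lambda>S. \<Sum>i\<in>A. \<phi> i S) x = (\<Sum>i\<in>A. Ef n D (\<phi> i) x)"
  unfolding Ef_def by (rule Bochner_Integration.integral_sum) (rule integrable_St)

lemma Ef_cmult: "Ef n D (\<lambda>S. a * \<phi> S) x = a * Ef n D \<phi> x"
  unfolding Ef_def by simp

lemma Ef_const: "Ef n D (\<lambda>S. a) x = a"
  unfolding Ef_def using prob_space.prob_space[OF prob_cost_space[OF D]] by simp

lemma prob_le:
  assumes "e \<in> Kedges n" "0 \<le> t" "t \<le> 1/2"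
  shows "(\<integral>c. indicator {..t} (c e) \<partial>cost_space n D) \<le> t"
proof -
  interpret prob_space D by (rule prob_D[OF D])
  have "measure D {..t} = measure D {..0} + measure D {0<..t}"
    using assms by (subst finite_measure_Union[symmetric])
      (auto simp: sets_D[OF D] ivl_disj_un intro!: arg_cong[where f="measure D"])
  also have "\<dots> \<le> t"
    using measure_Ioc_le[OF D, of 0 t] assms D by (simp add: cost_dist_def)
  finally show ?thesis using prob_cost[OF D assms(1), of "{..t}"] by simp
qed

lemma Ef_derivative_scaled:
  fixes \<phi> :: "state \<Rightarrow> real" and B :: real
  assumes B: "\<And>S. \<bar>\<phi> S\<bar> \<le> B" and n: "n \<ge> 1" and x: "x \<in> {0..n/2}"
  shows "\<exists>p. 1 - x / n \<le> p \<and> p \<le> 1 \<and>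
    (Ef n D \<phi> has_real_derivative p * (\<Sum>e\<in>Kedges n. \<integral>c. \<phi> (ad e (Sw n e c (x / n))) - \<phi> (Sw n e c (x / n)) \<partial>cost_space n D) / n)
    (at x within {0..n/2})"
proof -
  have im: "(\<lambda>x. x / real n) ` {0..real n/2} = {0..1/2}"
  proof
    show "(\<lambda>x. x / real n) ` {0..real n/2} \<subseteq> {0..1/2}" using n by (auto simp: field_simps)
    show "{0..1/2} \<subseteq> (\<lambda>x. x / real n) ` {0..real n/2}"
    proof
      fix y :: real assume "y \<in> {0..1/2}"
      then show "y \<in> (\<lambda>x. x / real n) ` {0..real n/2}"
        using n by (intro image_eqI[of _ _ "y * real n"]) (auto simp: field_simps)
    qed
  qed
  have "x / n \<in> {0..1/2}" using im x by blast
  note Ef_derivative[where n=n and \<phi>=\<phi>, OF D B this]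
  then obtain p where p: "1 - x / n \<le> p" "p \<le> 1" and
    d: "((\<lambda>t. \<integral>c. \<phi> (St n c t) \<partial>cost_space n D) has_real_derivative
      p * (\<Sum>e\<in>Kedges n. \<integral>c. \<phi> (ad e (Sw n e c (x / n))) - \<phi> (Sw n e c (x / n)) \<partial>cost_space n D))
    (at (x / n) within {0..1/2})" (is "(?G has_real_derivative p * ?H) _")
    by (elim exE conjE) (rule that)
  have "((\<lambda>x. x / real n) has_real_derivative 1 / real n) (at x within {0..n/2})"
    by (rule DERIV_cdivide DERIV_ident)+
  from DERIV_image_chain[OF d[folded im] this] have "(?G \<circ> (\<lambda>x. x / real n) has_real_derivative (p * ?H) * (1 / real n)) (at x within {0..n/2})" .
  then have "(Ef n D \<phi> has_real_derivative p * ?H / n) (at x within {0..n/2})"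
    unfolding Ef_def comp_def by simp
  with p show ?thesis by blast
qed

text \<open>For each edge, replacing the state without \<open>e\<close> by the true state costs at
  most \<open>2 * B' * t\<close>, since the two differ only if \<open>e\<close> is already present;
  replacing \<open>p\<close> by 1 costs at most \<open>B' * t\<close>. Summed over at most
  \<open>n * n\<close> edges and divided by \<open>n\<close>, this is \<open>3 * B' * x\<close>. For
  functionals with jumps of order \<open>1 / n\<close> the error is of order
  \<open>x / n\<close>.\<close>

lemma Ef_generator:
  fixes \<phi> :: "state \<Rightarrow> real" and B B' :: real
  assumes B: "\<And>S. \<bar>\<phi> S\<bar> \<le> B" and n: "n \<ge> 1" and x: "x \<in> {0..n/2}"
    and B': "\<And>S e. good n S \<Longrightarrow> e \<in> Kedges n \<Longrightarrow> \<bar>\<phi> (ad e S) - \<phi> S\<bar> \<le> B'" "0 \<le> B'"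
  shows "\<exists>h. (Ef n D \<phi> has_real_derivative h) (at x within {0..n/2}) \<and>
    \<bar>h - Ef n D (Lg n \<phi>) x\<bar> \<le> 3 * B' * x"
proof -
  define M where "M = cost_space n D"
  interpret M: prob_space M unfolding M_def by (rule prob_cost_space[OF D])
  define t where "t = x / n"
  have t: "0 \<le> t" "t \<le> 1/2" using x n by (auto simp: t_def field_simps)
  define \<delta> where "\<delta> e c = \<phi> (ad e (Sw n e c t)) - \<phi> (Sw n e c t)" for e c
  define \<epsilon> where "\<epsilon> e c = \<phi> (ad e (St n c t)) - \<phi> (St n c t)" for e c
  obtain p where p: "1 - t \<le> p" "p \<le> 1" and
    d: "(Ef n D \<phi> has_real_derivative p * (\<Sum>e\<in>Kedges n. \<integral>c. \<delta> e c \<partial>M) / n) (at x within {0..n/2})"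
    using Ef_derivative_scaled[where \<phi>=\<phi>, OF B n x, folded t_def M_def, folded \<delta>_def]
    by (elim exE conjE) (rule that)
  have \<delta>B: "\<bar>\<delta> e c\<bar> \<le> B'" and \<epsilon>B: "\<bar>\<epsilon> e c\<bar> \<le> B'" if "e \<in> Kedges n" for e c
    unfolding \<delta>_def \<epsilon>_def using that by (auto intro!: B')
  have int\<delta>: "integrable M (\<delta> e)" if "e \<in> Kedges n" for e
    unfolding M_def using \<delta>B[OF that] measurable_Sw[OF D, of "\<lambda>S. \<phi> (ad e S) - \<phi> S" n e t]
    by (intro integrable_bounded[OF D]) (auto simp: \<delta>_def[abs_def])
  have int\<epsilon>: "integrable M (\<epsilon> e)" for e
    unfolding M_def \<epsilon>_def by (rule integrable_St[of "\<lambda>S. \<phi> (ad e S) - \<phi> S"])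
  have Lgt: "Ef n D (Lg n \<phi>) x = (\<Sum>e\<in>Kedges n. \<integral>c. \<epsilon> e c \<partial>M) / n"
    unfolding Ef_def Lg_def t_def[symmetric] M_def[symmetric] \<epsilon>_def[symmetric]
    using int\<epsilon> by (simp add: Bochner_Integration.integral_sum)
  have tm: "\<bar>p * (\<integral>c. \<delta> e c \<partial>M) - (\<integral>c. \<epsilon> e c \<partial>M)\<bar> \<le> 3 * B' * t" if e: "e \<in> Kedges n" for e
  proof -
    have "\<bar>(\<integral>c. \<delta> e c \<partial>M)\<bar> \<le> (\<integral>c. \<bar>\<delta> e c\<bar> \<partial>M)" by (rule integral_abs_bound)
    also have "\<dots> \<le> (\<integral>c. B' \<partial>M)"
      by (intro integral_mono integrable_abs int\<delta> e \<delta>B) auto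
    finally have a: "\<bar>(\<integral>c. \<delta> e c \<partial>M)\<bar> \<le> B'" by (simp add: M.prob_space)
    have "(\<integral>c. \<delta> e c \<partial>M) - (\<integral>c. \<epsilon> e c \<partial>M) = (\<integral>c. \<delta> e c - \<epsilon> e c \<partial>M)"
      using int\<delta>[OF e] int\<epsilon> by simp
    also have "\<bar>\<dots>\<bar> \<le> (\<integral>c. \<bar>\<delta> e c - \<epsilon> e c\<bar> \<partial>M)" by (rule integral_abs_bound)
    also have "\<dots> \<le> (\<integral>c. 2 * B' * indicator {..t} (c e) \<partial>M)"
    proof (intro integral_mono)
      fix c
      show "\<bar>\<delta> e c - \<epsilon> e c\<bar> \<le> 2 * B' * indicator {..t} (c e)"
      proof (cases "c e \<le> t")
        case True
        then show ?thesis using \<delta>B[OF e, of c] \<epsilon>B[OF e, of c] by simp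
      next
        case False
        then have "{f \<in> Kedges n - {e}. c f \<le> t} = {f \<in> Kedges n. c f \<le> t}" by auto
        then have "Sw n e c t = St n c t" by (simp add: Sw_def St_def)
        then show ?thesis using False by (simp add: \<delta>_def \<epsilon>_def)
      qed
    next
      show "integrable M (\<lambda>c. 2 * B' * indicator {..t} (c e))"
        unfolding M_def using B'(2) measurable_cost[OF D e]
        by (intro integrable_bounded[OF D, of _ n "2 * B'"]) (auto simp: indicator_def)
    qed (use int\<delta>[OF e] int\<epsilon> in auto)
    also have "\<dots> = 2 * B' * (\<integral>c. indicator {..t} (c e) \<partial>M)" by simp
    also have "\<dots> \<le> 2 * B' * t"
      unfolding M_def using B'(2) t by (intro mult_left_mono prob_le e) auto
    finally have b: "\<bar>(\<integral>c. \<delta> e c \<partial>M) - (\<integral>c. \<epsilon> e c \<partial>M)\<bar> \<le> 2 * B' * t" .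
    have "\<bar>(1 - p) * (\<integral>c. \<delta> e c \<partial>M)\<bar> \<le> t * B'"
      unfolding abs_mult using p t a by (intro mult_mono) auto
    then show ?thesis using b by (simp add: algebra_simps abs_le_iff)
  qed
  have "\<bar>p * (\<Sum>e\<in>Kedges n. \<integral>c. \<delta> e c \<partial>M) / n - Ef n D (Lg n \<phi>) x\<bar>
      = \<bar>\<Sum>e\<in>Kedges n. p * (\<integral>c. \<delta> e c \<partial>M) - (\<integral>c. \<epsilon> e c \<partial>M)\<bar> / n"
    unfolding Lgt by (simp add: sum_distrib_left sum_subtractf flip: diff_divide_distrib)
  also have "\<dots> \<le> (\<Sum>e\<in>Kedges n. 3 * B' * t) / n"
    using tm by (intro divide_right_mono order_trans[OF sum_abs] sum_mono) auto
  also have "\<dots> = real (card (Kedges n)) * (3 * B' * t) / n" by simp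
  also have "\<dots> \<le> real (n * n) * (3 * B' * t) / n"
    using B'(2) t card_Kedges_le[of n] by (intro divide_right_mono mult_right_mono) (auto simp del: of_nat_mult)
  also have "\<dots> = 3 * B' * x" using n by (simp add: t_def)
  finally show ?thesis using d by blast
qed

text \<open>A one-sided version with no additive error, for times of order \<open>n\<close>. For an
  edge that has not arrived, the state without it is the true state; the remaining edges can only
  lower \<open>\<phi>\<close> and are dropped. The factor 2 comes from \<open>p \<ge> 1/2\<close>.
  The lower bound \<open>W\<close> may depend on the costs themselves, so it can be restricted to an
  event that is not visible in the state.\<close>

lemma Ef_generator_decreasing:
  fixes \<phi> :: "state \<Rightarrow> real" and B :: real
  assumes B: "\<And>S. \<bar>\<phi> S\<bar> \<le> B" and n: "n \<ge> 1" and x: "x \<in> {0..n/2}"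
    and dec: "\<And>S e. good n S \<Longrightarrow> e \<in> Kedges n \<Longrightarrow> \<phi> (ad e S) \<le> \<phi> S"
    and W: "integrable (cost_space n D) W"
      "\<And>c. W c \<le> (\<Sum>e | e \<in> Kedges n \<and> x / n < c e. \<phi> (St n c (x / n)) - \<phi> (ad e (St n c (x / n))))"
  shows "\<exists>h. (Ef n D \<phi> has_real_derivative h) (at x within {0..n/2}) \<and>
    (\<integral>c. W c \<partial>cost_space n D) / n \<le> - 2 * h"
proof -
  define M where "M = cost_space n D"
  interpret M: prob_space M unfolding M_def by (rule prob_cost_space[OF D])
  define t where "t = x / n"
  have t: "0 \<le> t" "t \<le> 1/2" using x n by (auto simp: t_def field_simps)
  define \<delta> where "\<delta> e c = \<phi> (ad e (Sw n e c t)) - \<phi> (Sw n e c t)" for e c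
  define \<epsilon> where "\<epsilon> e c = \<phi> (ad e (St n c t)) - \<phi> (St n c t)" for e c
  obtain p where p: "1 - t \<le> p" "p \<le> 1" and
    d: "(Ef n D \<phi> has_real_derivative p * (\<Sum>e\<in>Kedges n. \<integral>c. \<delta> e c \<partial>M) / n) (at x within {0..n/2})"
    using Ef_derivative_scaled[where \<phi>=\<phi>, OF B n x, folded t_def M_def, folded \<delta>_def]
    by (elim exE conjE) (rule that)
  have int\<delta>: "integrable M (\<delta> e)" for e
  proof -
    have "\<bar>\<delta> e c\<bar> \<le> 2 * B" for c
      unfolding \<delta>_def using B[of "ad e (Sw n e c t)"] B[of "Sw n e c t"] by linarith
    then show ?thesis
      unfolding M_def using measurable_Sw[OF D, of "\<lambda>S. \<phi> (ad e S) - \<phi> S" n e t]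
      by (intro integrable_bounded[OF D]) (auto simp: \<delta>_def[abs_def])
  qed
  have "(\<integral>c. W c \<partial>M) \<le> (\<integral>c. (\<Sum>e\<in>Kedges n. - \<delta> e c) \<partial>M)"
  proof (rule integral_mono)
    show "integrable M W" using W(1) by (simp add: M_def)
    show "integrable M (\<lambda>c. \<Sum>e\<in>Kedges n. - \<delta> e c)" using int\<delta> by auto
    fix c
    have "W c \<le> (\<Sum>e | e \<in> Kedges n \<and> t < c e. - \<epsilon> e c)"
      using W(2)[of c] by (simp add: t_def \<epsilon>_def)
    also have "\<dots> = (\<Sum>e | e \<in> Kedges n \<and> t < c e. - \<delta> e c)"
    proof (rule sum.cong)
      fix e assume "e \<in> {e. e \<in> Kedges n \<and> t < c e}"
      then have "{f \<in> Kedges n - {e}. c f \<le> t} = {f \<in> Kedges n. c f \<le> t}" by auto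
      then have "Sw n e c t = St n c t" by (simp add: Sw_def St_def)
      then show "- \<epsilon> e c = - \<delta> e c" by (simp add: \<delta>_def \<epsilon>_def)
    qed simp
    also have "\<dots> \<le> (\<Sum>e\<in>Kedges n. - \<delta> e c)"
      using dec by (intro sum_mono2) (auto simp: \<delta>_def)
    finally show "W c \<le> (\<Sum>e\<in>Kedges n. - \<delta> e c)" .
  qed
  also have "\<dots> = - (\<Sum>e\<in>Kedges n. \<integral>c. \<delta> e c \<partial>M)"
    using int\<delta> by (simp add: Bochner_Integration.integral_sum sum_negf)
  finally have 1: "(\<integral>c. W c \<partial>M) \<le> - (\<Sum>e\<in>Kedges n. \<integral>c. \<delta> e c \<partial>M)" .
  have "(\<integral>c. \<delta> e c \<partial>M) \<le> 0" if "e \<in> Kedges n" for e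
  proof -
    have "0 \<le> (\<integral>c. - \<delta> e c \<partial>M)"
      using dec that by (intro Bochner_Integration.integral_nonneg) (auto simp: \<delta>_def)
    then show ?thesis by simp
  qed
  then have 0: "(\<Sum>e\<in>Kedges n. \<integral>c. \<delta> e c \<partial>M) \<le> 0" by (rule sum_nonpos)
  have "1 \<le> 2 * p" using p t by linarith
  with 0 have "2 * p * (\<Sum>e\<in>Kedges n. \<integral>c. \<delta> e c \<partial>M) \<le> 1 * (\<Sum>e\<in>Kedges n. \<integral>c. \<delta> e c \<partial>M)"
    by (intro mult_right_mono_neg) auto
  with 1 have "(\<integral>c. W c \<partial>M) \<le> - 2 * (p * (\<Sum>e\<in>Kedges n. \<integral>c. \<delta> e c \<partial>M))" by simp
  then have "(\<integral>c. W c \<partial>M) / n \<le> - 2 * (p * (\<Sum>e\<in>Kedges n. \<integral>c. \<delta> e c \<partial>M)) / n"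
    by (rule divide_right_mono) simp
  then have "(\<integral>c. W c \<partial>M) / n \<le> - 2 * (p * (\<Sum>e\<in>Kedges n. \<integral>c. \<delta> e c \<partial>M) / n)" by simp
  then show ?thesis by (intro exI[of _ "p * (\<Sum>e\<in>Kedges n. \<integral>c. \<delta> e c \<partial>M) / n"] conjI d) (simp add: M_def)
qed

end

section \<open>Block statistics and their drift\<close>

definition avg :: "nat \<Rightarrow> (nat \<Rightarrow> real) \<Rightarrow> real" where
  "avg n f = (\<Sum>u<n. f u) / n"

definition avg2 :: "nat \<Rightarrow> (nat \<Rightarrow> nat \<Rightarrow> real) \<Rightarrow> real" where
  "avg2 n f = avg n (\<lambda>u. avg n (f u))"

lemma avg_mono: "(\<And>u. u < n \<Longrightarrow> f u \<le> g u) \<Longrightarrow> avg n f \<le> avg n g"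
  unfolding avg_def by (intro divide_right_mono sum_mono) auto

lemma avg_cong: "(\<And>u. u < n \<Longrightarrow> f u = g u) \<Longrightarrow> avg n f = avg n g"
  unfolding avg_def by simp

lemma avg_add: "avg n (\<lambda>u. f u + g u) = avg n f + avg n g"
  by (simp add: avg_def sum.distrib add_divide_distrib)

lemma avg_diff: "avg n (\<lambda>u. f u - g u) = avg n f - avg n g"
  by (simp add: avg_def sum_subtractf diff_divide_distrib)

lemma avg_cmult: "avg n (\<lambda>u. a * f u) = a * avg n f"
  by (simp add: avg_def sum_distrib_left)

lemma avg_mult_right: "avg n (\<lambda>u. f u * a) = avg n f * a"
  by (simp add: avg_def sum_distrib_right)

lemma avg_sum: "avg n (\<lambda>u. \<Sum>i\<in>A. f i u) = (\<Sum>i\<in>A. avg n (f i))"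
  unfolding avg_def by (subst sum.swap) (simp add: sum_divide_distrib)

lemma avg_const [simp]: "n \<ge> 1 \<Longrightarrow> avg n (\<lambda>_. a) = a"
  by (simp add: avg_def)

lemma avg_abs: "\<bar>avg n f\<bar> \<le> avg n (\<lambda>u. \<bar>f u\<bar>)"
  unfolding avg_def by (simp add: divide_right_mono)

lemma avg_nonneg: "(\<And>u. u < n \<Longrightarrow> 0 \<le> f u) \<Longrightarrow> 0 \<le> avg n f"
  unfolding avg_def by (intro divide_nonneg_nonneg sum_nonneg) auto

lemma avg_le_1: "(\<And>u. u < n \<Longrightarrow> f u \<le> 1) \<Longrightarrow> avg n f \<le> 1"
  using sum_bounded_above[of "{..<n}" f 1] by (cases n) (auto simp: avg_def divide_le_eq)

lemma avg2_mono: "(\<And>u v. u < n \<Longrightarrow> v < n \<Longrightarrow> f u v \<le> g u v) \<Longrightarrow> avg2 n f \<le> avg2 n g"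
  unfolding avg2_def by (intro avg_mono)

lemma avg2_cong: "(\<And>u v. u < n \<Longrightarrow> v < n \<Longrightarrow> f u v = g u v) \<Longrightarrow> avg2 n f = avg2 n g"
  unfolding avg2_def by (intro avg_cong)

lemma avg2_add: "avg2 n (\<lambda>u v. f u v + g u v) = avg2 n f + avg2 n g"
  by (simp add: avg2_def avg_add)

lemma avg2_diff: "avg2 n (\<lambda>u v. f u v - g u v) = avg2 n f - avg2 n g"
  by (simp add: avg2_def avg_diff)

lemma avg2_cmult: "avg2 n (\<lambda>u v. a * f u v) = a * avg2 n f"
  by (simp add: avg2_def avg_cmult)

lemma avg2_abs: "\<bar>avg2 n f\<bar> \<le> avg2 n (\<lambda>u v. \<bar>f u v\<bar>)"
  unfolding avg2_def by (rule order_trans[OF avg_abs]) (intro avg_mono avg_abs)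

lemma avg2_nonneg: "(\<And>u v. u < n \<Longrightarrow> v < n \<Longrightarrow> 0 \<le> f u v) \<Longrightarrow> 0 \<le> avg2 n f"
  unfolding avg2_def by (intro avg_nonneg)

lemma avg2_prod: "avg2 n (\<lambda>u v. f u * g v) = avg n f * avg n g"
  by (simp add: avg2_def avg_cmult avg_mult_right)

lemma sum_Kedges:
  fixes G :: "nat \<Rightarrow> nat \<Rightarrow> real"
  assumes sym: "\<And>u v. G u v = G v u" and diag: "\<And>u. G u u = 0"
  shows "(\<Sum>(u, v)\<in>Kedges n. G u v) = real n * real n * avg2 n G / 2"
proof -
  let ?K' = "(\<lambda>(u, v). (v, u)) ` Kedges n" and ?D = "(\<lambda>u. (u, u)) ` {..<n}"
  have split: "{..<n} \<times> {..<n} = Kedges n \<union> (?K' \<union> ?D)"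
    by (auto simp: Kedges_def image_iff)
  have "(\<Sum>(u, v)\<in>{..<n} \<times> {..<n}. G u v)
      = (\<Sum>(u, v)\<in>Kedges n. G u v) + ((\<Sum>(u, v)\<in>?K'. G u v) + (\<Sum>(u, v)\<in>?D. G u v))"
  proof -
    have "Kedges n \<inter> (?K' \<union> ?D) = {}" "?K' \<inter> ?D = {}" by (auto simp: Kedges_def)
    moreover have "finite (Kedges n)" "finite ?K'" "finite ?D" by simp_all
    ultimately show ?thesis unfolding split by (simp only: sum.union_disjoint finite_Un simp_thms)
  qed
  also have "(\<Sum>(u, v)\<in>?K'. G u v) = (\<Sum>(u, v)\<in>Kedges n. G u v)"
    by (subst sum.reindex) (auto simp: inj_on_def sym intro!: sum.cong)
  also have "(\<Sum>(u, v)\<in>?D. G u v) = 0"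
    by (subst sum.reindex) (auto simp: inj_on_def diag)
  finally show ?thesis
    by (cases "n = 0") (simp_all add: avg2_def avg_def sum.cartesian_product sum_divide_distrib[symmetric])
qed

section \<open>Statistics of block sizes under the generator\<close>

definition rls :: "state \<Rightarrow> nat \<Rightarrow> nat \<Rightarrow> nat \<Rightarrow> real" where
  "rls S j u v = of_bool ((u, v) \<in> rl S j)"

text \<open>The change of the sum of \<open>g (size of the block)\<close> over all vertices when
  blocks of sizes \<open>a\<close> and \<open>b\<close> merge.\<close>

definition gain :: "(nat \<Rightarrow> real) \<Rightarrow> nat \<Rightarrow> nat \<Rightarrow> real" where
  "gain g a b = real (a + b) * g (a + b) - real a * g a - real b * g b"

definition stat :: "nat \<Rightarrow> (nat \<Rightarrow> real) \<Rightarrow> nat \<Rightarrow> state \<Rightarrow> real" where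
  "stat n g k S = avg n (\<lambda>u. g (sz n S k u))"

lemma acc_sym: "acc S j (u, v) = acc S j (v, u)"
  unfolding acc_def using rl_sym by blast

lemma acc_diag: "\<not> acc S j (u, u)"
  by (simp add: acc_def)

lemma stat_ad:
  assumes "(u, v) \<in> Kedges n"
  shows "stat n g (Suc j) (ad (u, v) S) - stat n g (Suc j) S =
    of_bool (acc S j (u, v)) * gain g (sz n S (Suc j) u) (sz n S (Suc j) v) / n"
proof -
  have uv: "u < n" "v < n" using assms by (auto simp: Kedges_def)
  show ?thesis
    unfolding stat_def avg_def diff_divide_distrib[symmetric] sum_sz_ad[OF uv] gain_def
    by (simp add: Let_def)
qed

lemma stat_ad_0: "stat n g 0 S = stat n g 0 S'"
  by (simp add: stat_def)

text \<open>About \<open>n * n / 2\<close> edges, the factor \<open>1 / n\<close> in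
  \<open>Lg\<close> and jumps of order \<open>1 / n\<close> combine to half an average over ordered
  pairs, with no explicit \<open>n\<close> left.\<close>

lemma Lg_stat:
  "Lg n (stat n g (Suc j)) S =
    avg2 n (\<lambda>u v. of_bool (acc S j (u, v)) * gain g (sz n S (Suc j) u) (sz n S (Suc j) v)) / 2"
proof -
  let ?G = "\<lambda>u v. of_bool (acc S j (u, v)) * gain g (sz n S (Suc j) u) (sz n S (Suc j) v)"
  have "(\<Sum>e\<in>Kedges n. stat n g (Suc j) (ad e S) - stat n g (Suc j) S) = (\<Sum>(u, v)\<in>Kedges n. ?G u v / n)"
    by (intro sum.cong refl) (auto simp: stat_ad)
  also have "\<dots> = (\<Sum>(u, v)\<in>Kedges n. ?G u v) / n"
    by (simp only: sum_divide_distrib case_prod_unfold)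
  also have "(\<Sum>(u, v)\<in>Kedges n. ?G u v) = real n * real n * avg2 n ?G / 2"
    by (rule sum_Kedges) (auto simp: acc_sym[of S j] gain_def algebra_simps acc_diag)
  finally have *: "(\<Sum>e\<in>Kedges n. stat n g (Suc j) (ad e S) - stat n g (Suc j) S) = real n * real n * avg2 n ?G / 2 / n" .
  show ?thesis
    unfolding Lg_def * by (cases "n = 0") (auto simp: avg2_def avg_def)
qed

lemma acc_rls:
  assumes "good n S"
  shows "of_bool (acc S j (u, v)) = rls S j u v - rls S (Suc j) u v"
  using rl_Suc_subset[OF assms, of j] by (auto simp: acc_def rls_def)

lemma avg_rls: "avg n (rls S j u) = sz n S j u / n"
proof -
  have "(\<Sum>v<n. rls S j u v) = real (card {v \<in> {..<n}. (u, v) \<in> rl S j})"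
    unfolding rls_def by (simp add: of_bool_def sum.If_cases Int_def)
  also have "{v \<in> {..<n}. (u, v) \<in> rl S j} = blk n S j u" by (auto simp: blk_def)
  finally show ?thesis by (simp add: avg_def sz_def)
qed

definition cf :: "nat \<Rightarrow> nat \<Rightarrow> nat \<Rightarrow> state \<Rightarrow> real" where
  "cf n k l = stat n (\<lambda>a. of_bool (a = l)) k"

definition bigf :: "nat \<Rightarrow> nat \<Rightarrow> nat \<Rightarrow> state \<Rightarrow> real" where
  "bigf n k L = stat n (\<lambda>a. of_bool (L \<le> a)) k"

text \<open>The population that coagulates at level \<open>j + 1\<close>: vertices outside the large
  blocks of level \<open>j\<close> are cut off from almost all edges that could reach them
  there.\<close>

definition df :: "nat \<Rightarrow> nat \<Rightarrow> nat \<Rightarrow> nat \<Rightarrow> state \<Rightarrow> real" where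
  "df n j L i S = avg n (\<lambda>u. of_bool (L \<le> sz n S j u) * of_bool (sz n S (Suc j) u = i))"

text \<open>The exceptional vertices. Apart from them, a vertex in a small block of level
  \<open>j\<close> is a singleton at level \<open>j + 1\<close>, and this expresses
  \<open>df\<close> through \<open>cf\<close> and \<open>bigf\<close>.\<close>

definition thf :: "nat \<Rightarrow> nat \<Rightarrow> nat \<Rightarrow> state \<Rightarrow> real" where
  "thf n j L S = avg n (\<lambda>u. of_bool (sz n S j u < L \<and> 2 \<le> sz n S (Suc j) u))"

text \<open>Smallness of \<open>eta\<close> expresses the uniqueness of the giant block.\<close>

definition eta :: "nat \<Rightarrow> nat \<Rightarrow> nat \<Rightarrow> state \<Rightarrow> real" where
  "eta n j L S = avg2 n (\<lambda>u v. of_bool (L \<le> sz n S j u) * of_bool (L \<le> sz n S j v) * (1 - rls S j u v))"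

lemma stat_bounded: "(\<And>a. 0 \<le> g a \<and> g a \<le> 1) \<Longrightarrow> 0 \<le> stat n g k S \<and> stat n g k S \<le> 1"
  unfolding stat_def by (auto intro!: avg_nonneg avg_le_1)

lemma cf_bounds: "0 \<le> cf n k l S" "cf n k l S \<le> 1"
  unfolding cf_def using stat_bounded[of "\<lambda>a. of_bool (a = l)" n k S] by auto

lemma bigf_bounds: "0 \<le> bigf n k l S" "bigf n k l S \<le> 1"
  unfolding bigf_def using stat_bounded[of "\<lambda>a. of_bool (l \<le> a)" n k S] by auto

lemma thf_bounds: "0 \<le> thf n k l S" "thf n k l S \<le> 1"
  unfolding thf_def by (auto intro!: avg_nonneg avg_le_1)

lemma df_bounds: "0 \<le> df n k L l S" "df n k L l S \<le> 1"
  unfolding df_def by (auto intro!: avg_nonneg avg_le_1)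

section \<open>Drift of the proportions of small blocks\<close>

lemma gain_indicator:
  "gain (\<lambda>a. of_bool (a = l)) a b = real l * (of_bool (a + b = l) - of_bool (a = l) - of_bool (b = l))"
  by (auto simp: gain_def)

lemma gain_indicator_bound: "\<bar>gain (\<lambda>a. of_bool (a = l)) a b\<bar> \<le> 2 * real l"
  unfolding gain_indicator abs_mult by (auto simp: mult.commute)

text \<open>Closes the system: the mass of the large blocks is determined by the sizes below
  \<open>L\<close>, so no statistics of large sizes enter the drift.\<close>

lemma bigf_cf:
  assumes "n \<ge> 1"
  shows "bigf n j L S = 1 - (\<Sum>l<L. cf n j l S)"
proof -
  have "of_bool (L \<le> a) = (1 :: real) - (\<Sum>l<L. of_bool (a = l))" for a
    by (simp add: of_bool_def)
  then show ?thesis using assms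
    by (simp only: bigf_def cf_def stat_def avg_diff avg_sum avg_const)
qed

lemma df_cf:
  assumes "n \<ge> 1"
  shows "\<bar>df n j L i S - (cf n (Suc j) i S - of_bool (i = 1) * (1 - bigf n j L S))\<bar> \<le> thf n j L S"
proof -
  have "df n j L i S - (cf n (Suc j) i S - of_bool (i = 1) * (1 - bigf n j L S))
    = avg n (\<lambda>u. of_bool (L \<le> sz n S j u) * of_bool (sz n S (Suc j) u = i)
        - (of_bool (sz n S (Suc j) u = i) - of_bool (i = 1) * (1 - of_bool (L \<le> sz n S j u))))"
    using assms by (simp only: df_def cf_def bigf_def stat_def avg_diff avg_cmult avg_const)
  also have "\<bar>\<dots>\<bar> \<le> thf n j L S"
    unfolding thf_def
  proof (rule order_trans[OF avg_abs], rule avg_mono)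
    fix u assume "u < n"
    then show "\<bar>of_bool (L \<le> sz n S j u) * of_bool (sz n S (Suc j) u = i)
        - (of_bool (sz n S (Suc j) u = i) - of_bool (i = 1) * (1 - of_bool (L \<le> sz n S j u)))\<bar>
      \<le> (of_bool (sz n S j u < L \<and> 2 \<le> sz n S (Suc j) u) :: real)"
      using sz_pos[of u n S "Suc j"] by (auto simp: of_bool_def)
  qed
  finally show ?thesis .
qed

text \<open>The product of indicators errs in two ways. Two large blocks may be different, which
  \<open>eta\<close> counts; or two vertices may share a small block, where each vertex has fewer
  than \<open>L\<close> partners, itself included.\<close>

lemma rls_approx:
  "avg2 n (\<lambda>u v. \<bar>rls S j u v - of_bool (L \<le> sz n S j u) * of_bool (L \<le> sz n S j v)\<bar>)
    \<le> eta n j L S + L / n"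
proof -
  have "\<bar>rls S j u v - of_bool (L \<le> sz n S j u) * of_bool (L \<le> sz n S j v)\<bar>
    \<le> of_bool (L \<le> sz n S j u) * of_bool (L \<le> sz n S j v) * (1 - rls S j u v)
      + of_bool (sz n S j u < L) * rls S j u v" for u v
    using sz_eq[of u v S j n] by (auto simp: rls_def of_bool_def)
  then have "avg2 n (\<lambda>u v. \<bar>rls S j u v - of_bool (L \<le> sz n S j u) * of_bool (L \<le> sz n S j v)\<bar>)
    \<le> eta n j L S + avg2 n (\<lambda>u v. of_bool (sz n S j u < L) * rls S j u v)"
    unfolding eta_def avg2_add[symmetric] by (rule avg2_mono)
  also have "avg2 n (\<lambda>u v. of_bool (sz n S j u < L) * rls S j u v) \<le> L / n"
  proof (cases "n = 0")
    case False
    have "avg2 n (\<lambda>u v. of_bool (sz n S j u < L) * rls S j u v) = avg n (\<lambda>u. of_bool (sz n S j u < L) * (sz n S j u / n))"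
      by (simp only: avg2_def avg_cmult avg_rls)
    also have "\<dots> \<le> avg n (\<lambda>u. L / n)"
      by (intro avg_mono) (auto simp: of_bool_def divide_right_mono)
    finally show ?thesis using False by simp
  qed (simp add: avg2_def avg_def)
  finally show ?thesis by simp
qed

text \<open>A Smoluchowski coagulation equation for level \<open>j + 1\<close>, run inside the large
  blocks of level \<open>j\<close>: sizes \<open>i\<close> and \<open>l - i\<close> merge into size
  \<open>l\<close>, and a block of size \<open>l\<close> is lost when it merges with any block of
  that population. Besides the error of \<open>rls_approx\<close>, the term \<open>l / n\<close>
  accounts for edges inside one block of level \<open>j + 1\<close>, which merge nothing.\<close>

lemma drift_cf:
  assumes S: "good n S" and n: "n \<ge> 1"
  shows "\<bar>Lg n (cf n (Suc j) l) S -
      l / 2 * ((\<Sum>i\<in>{1..<l}. df n j L i S * df n j L (l - i) S) - 2 * df n j L l S * bigf n j L S)\<bar>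
    \<le> l * (eta n j L S + (L + l) / n)"
proof -
  define a where "a = sz n S (Suc j)"
  define b where "b u = (of_bool (L \<le> sz n S j u) :: real)" for u
  define G where "G u v = gain (\<lambda>a. of_bool (a = l)) (a u) (a v)" for u v
  have a1: "1 \<le> a u" if "u < n" for u using sz_pos[OF that] by (simp add: a_def)
  have d: "df n j L i S = avg n (\<lambda>u. b u * of_bool (a u = i))" for i
    by (simp add: df_def a_def b_def)
  have bigf: "bigf n j L S = avg n b" by (simp add: bigf_def stat_def b_def[abs_def])
  have GB: "\<bar>G u v\<bar> \<le> 2 * real l" for u v unfolding G_def by (rule gain_indicator_bound)
  have main: "avg2 n (\<lambda>u v. b u * b v * G u v)
      = l * ((\<Sum>i\<in>{1..<l}. df n j L i S * df n j L (l - i) S) - 2 * df n j L l S * bigf n j L S)"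
  proof -
    have "b u * b v * G u v = l * ((\<Sum>i\<in>{1..<l}. (b u * of_bool (a u = i)) * (b v * of_bool (a v = l - i)))
        - ((b u * of_bool (a u = l)) * b v + b u * (b v * of_bool (a v = l))))" if "u < n" "v < n" for u v
    proof -
      have "of_bool (a u + a v = l) = (\<Sum>i\<in>{1..<l}. of_bool (a u = i) * of_bool (a v = l - i) :: real)"
      proof (cases "a u + a v = l")
        case True
        have "(\<Sum>i\<in>{1..<l}. of_bool (a u = i) * of_bool (a v = l - i) :: real)
            = (\<Sum>i\<in>{1..<l}. of_bool (i = a u))"
          using True by (intro sum.cong) auto
        also have "\<dots> = 1" using True a1[OF that(1)] a1[OF that(2)] by (simp add: of_bool_def)
        finally show ?thesis using True by simp
      next
        case False
        then show ?thesis by (auto intro!: sum.neutral[symmetric])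
      qed
      then have "b u * b v * of_bool (a u + a v = l)
          = (\<Sum>i\<in>{1..<l}. (b u * of_bool (a u = i)) * (b v * of_bool (a v = l - i)))"
        by (simp only: sum_distrib_left mult_ac)
      then show ?thesis
        unfolding G_def gain_indicator by (simp only: flip: \<open>b u * b v * of_bool (a u + a v = l) = _\<close>) (simp only: algebra_simps)
    qed
    then have "avg2 n (\<lambda>u v. b u * b v * G u v)
      = avg2 n (\<lambda>u v. l * ((\<Sum>i\<in>{1..<l}. (b u * of_bool (a u = i)) * (b v * of_bool (a v = l - i)))
        - ((b u * of_bool (a u = l)) * b v + b u * (b v * of_bool (a v = l)))))"
      by (rule avg2_cong)
    also have "\<dots> = l * (avg2 n (\<lambda>u v. \<Sum>i\<in>{1..<l}. (b u * of_bool (a u = i)) * (b v * of_bool (a v = l - i)))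
        - (avg n (\<lambda>u. b u * of_bool (a u = l)) * avg n b + avg n b * avg n (\<lambda>v. b v * of_bool (a v = l))))"
      by (simp only: avg2_cmult avg2_diff avg2_add avg2_prod)
    also have "avg2 n (\<lambda>u v. \<Sum>i\<in>{1..<l}. (b u * of_bool (a u = i)) * (b v * of_bool (a v = l - i)))
        = (\<Sum>i\<in>{1..<l}. df n j L i S * df n j L (l - i) S)"
      unfolding avg2_def avg_sum d avg_cmult avg_mult_right ..
    finally show ?thesis by (simp add: d bigf)
  qed
  have "\<bar>avg2 n (\<lambda>u v. of_bool (acc S j (u, v)) * G u v) - avg2 n (\<lambda>u v. b u * b v * G u v)\<bar>
      \<le> avg2 n (\<lambda>u v. \<bar>of_bool (acc S j (u, v)) * G u v - b u * b v * G u v\<bar>)"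
    unfolding avg2_diff[symmetric] by (rule avg2_abs)
  also have "\<dots> \<le> avg2 n (\<lambda>u v. 2 * real l * \<bar>rls S j u v - b u * b v\<bar>
      + 2 * real l * (of_bool (a u \<le> l) * rls S (Suc j) u v))"
  proof (rule avg2_mono)
    fix u v assume "u < n" "v < n"
    have "\<bar>of_bool (acc S j (u, v)) * G u v - b u * b v * G u v\<bar>
        = \<bar>(rls S j u v - b u * b v) * G u v - rls S (Suc j) u v * G u v\<bar>"
      by (simp add: acc_rls[OF S] algebra_simps)
    also have "\<dots> \<le> \<bar>(rls S j u v - b u * b v) * G u v\<bar> + \<bar>rls S (Suc j) u v * G u v\<bar>" by linarith
    also have "\<bar>(rls S j u v - b u * b v) * G u v\<bar> \<le> \<bar>rls S j u v - b u * b v\<bar> * (2 * real l)"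
      unfolding abs_mult by (intro mult_left_mono GB) simp
    \<comment> \<open>Within one block both sizes are equal, so a nonzero gain forces them to be at
      most \<open>l\<close>; such a block offers at most \<open>l\<close> partners.\<close>
    also have "\<bar>rls S (Suc j) u v * G u v\<bar> \<le> of_bool (a u \<le> l) * rls S (Suc j) u v * (2 * real l)"
    proof (cases "(u, v) \<in> rl S (Suc j) \<and> G u v \<noteq> 0")
      case True
      then have "a u = a v" unfolding a_def using sz_eq by blast
      then have "a u \<le> l" using True unfolding G_def gain_indicator by (auto split: if_splits simp: of_bool_def)
      then show ?thesis using GB[of u v] True by (simp add: rls_def)
    qed (auto simp: rls_def)
    finally show "\<bar>of_bool (acc S j (u, v)) * G u v - b u * b v * G u v\<bar> \<le>
      2 * real l * \<bar>rls S j u v - b u * b v\<bar> + 2 * real l * (of_bool (a u \<le> l) * rls S (Suc j) u v)"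
      by (simp add: mult_ac)
  qed
  also have "\<dots> = 2 * real l * avg2 n (\<lambda>u v. \<bar>rls S j u v - b u * b v\<bar>)
      + 2 * real l * avg n (\<lambda>u. of_bool (a u \<le> l) * (a u / n))"
  proof -
    have "avg2 n (\<lambda>u v. of_bool (a u \<le> l) * rls S (Suc j) u v) = avg n (\<lambda>u. of_bool (a u \<le> l) * (a u / n))"
      by (simp only: avg2_def avg_cmult avg_rls a_def)
    then show ?thesis by (simp only: avg2_add avg2_cmult)
  qed
  also have "\<dots> \<le> 2 * real l * (eta n j L S + L / n) + 2 * real l * (l / n)"
  proof (intro add_mono mult_left_mono)
    show "avg2 n (\<lambda>u v. \<bar>rls S j u v - b u * b v\<bar>) \<le> eta n j L S + L / n"
      unfolding b_def by (rule rls_approx)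
    have "avg n (\<lambda>u. of_bool (a u \<le> l) * (a u / n)) \<le> avg n (\<lambda>u. l / n)"
      by (intro avg_mono) (auto simp: of_bool_def divide_right_mono)
    then show "avg n (\<lambda>u. of_bool (a u \<le> l) * (a u / n)) \<le> l / n" using n by simp
  qed auto
  also have "\<dots> = 2 * (l * (eta n j L S + (L + l) / n))" by (simp add: algebra_simps add_divide_distrib)
  finally have bnd: "\<bar>avg2 n (\<lambda>u v. of_bool (acc S j (u, v)) * G u v) - avg2 n (\<lambda>u v. b u * b v * G u v)\<bar>
      \<le> 2 * (real l * (eta n j L S + (real L + real l) / real n))" by simp
  have 1: "Lg n (cf n (Suc j) l) S = avg2 n (\<lambda>u v. of_bool (acc S j (u, v)) * G u v) / 2"
    by (simp only: cf_def Lg_stat G_def a_def)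
  have 2: "l / 2 * ((\<Sum>i\<in>{1..<l}. df n j L i S * df n j L (l - i) S) - 2 * df n j L l S * bigf n j L S)
      = avg2 n (\<lambda>u v. b u * b v * G u v) / 2"
    unfolding main by simp
  have 3: "\<bar>x / 2 - y / 2\<bar> \<le> z" if "\<bar>x - y\<bar> \<le> 2 * z" for x y z :: real
    using that by (simp add: abs_le_iff)
  show ?thesis unfolding 1 2 by (rule 3[OF bnd])
qed

section \<open>Sizes of jumps and the second-order term\<close>

lemma stat_ad_bound:
  assumes e: "e \<in> Kedges n" and g: "\<And>a b. 1 \<le> a \<Longrightarrow> 1 \<le> b \<Longrightarrow> \<bar>gain g a b\<bar> \<le> B" and B: "0 \<le> B"
  shows "\<bar>stat n g k (ad e S) - stat n g k S\<bar> \<le> B / n"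
proof (cases k)
  case 0
  then show ?thesis using B by (simp add: stat_ad_0[of n g "ad e S" S])
next
  case (Suc j)
  obtain u v where uv: "e = (u, v)" by (cases e)
  then have "u < n" "v < n" using e by (auto simp: Kedges_def)
  then have "\<bar>gain g (sz n S (Suc j) u) (sz n S (Suc j) v)\<bar> \<le> B"
    by (intro g sz_pos)
  then have "\<bar>of_bool (acc S j (u, v)) * gain g (sz n S (Suc j) u) (sz n S (Suc j) v)\<bar> \<le> B"
    using B by (auto simp: of_bool_def)
  then show ?thesis
    using e unfolding uv Suc by (simp only: stat_ad abs_divide abs_of_nat divide_right_mono of_nat_0_le_iff)
qed

lemma cf_ad_bound: "e \<in> Kedges n \<Longrightarrow> \<bar>cf n k l (ad e S) - cf n k l S\<bar> \<le> 2 * real l / n"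
  unfolding cf_def by (rule stat_ad_bound) (auto intro: gain_indicator_bound)

lemma cf_sq_ad_bound:
  assumes "e \<in> Kedges n"
  shows "\<bar>(cf n k l (ad e S))\<^sup>2 - (cf n k l S)\<^sup>2\<bar> \<le> 4 * real l / n"
proof -
  have "\<bar>(cf n k l (ad e S))\<^sup>2 - (cf n k l S)\<^sup>2\<bar>
      = \<bar>cf n k l (ad e S) + cf n k l S\<bar> * \<bar>cf n k l (ad e S) - cf n k l S\<bar>"
    by (simp add: abs_mult[symmetric] power2_eq_square algebra_simps)
  also have "\<dots> \<le> 2 * (2 * real l / n)"
    using cf_bounds[of n k l S] cf_bounds[of n k l "ad e S"] cf_ad_bound[OF assms]
    by (intro mult_mono) auto
  finally show ?thesis by simp
qed

text \<open>The last term sums the squared jumps: at most \<open>n * n\<close> of them, each at most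
  \<open>(2 * l / n)\<^sup>2\<close>, divided by \<open>n\<close>. Its order \<open>1 / n\<close> is
  the source of the concentration.\<close>

lemma Lg_cf_sq:
  assumes n: "n \<ge> 1"
  shows "Lg n (\<lambda>S. (cf n k l S)\<^sup>2) S \<le> 2 * cf n k l S * Lg n (cf n k l) S + 4 * (real l)\<^sup>2 / n"
proof -
  let ?d = "\<lambda>e. cf n k l (ad e S) - cf n k l S"
  have "(\<Sum>e\<in>Kedges n. (cf n k l (ad e S))\<^sup>2 - (cf n k l S)\<^sup>2)
      = (\<Sum>e\<in>Kedges n. 2 * cf n k l S * ?d e + (?d e)\<^sup>2)"
    by (intro sum.cong) (auto simp: power2_eq_square algebra_simps)
  also have "\<dots> = 2 * cf n k l S * (\<Sum>e\<in>Kedges n. ?d e) + (\<Sum>e\<in>Kedges n. (?d e)\<^sup>2)"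
    by (simp add: sum.distrib sum_distrib_left)
  also have "(\<Sum>e\<in>Kedges n. (?d e)\<^sup>2) \<le> (\<Sum>e\<in>Kedges n. (2 * real l / n)\<^sup>2)"
    using cf_ad_bound by (intro sum_mono abs_le_square_iff[THEN iffD1]) auto
  also have "\<dots> \<le> real (n * n) * (2 * real l / n)\<^sup>2"
    using card_Kedges_le[of n] by (simp del: of_nat_mult add: mult_right_mono)
  also have "\<dots> = 4 * (real l)\<^sup>2" using n by (simp add: power2_eq_square)
  finally show ?thesis
    unfolding Lg_def using divide_right_mono[of _ _ "real n"] by (fastforce simp: add_divide_distrib)
qed

text \<open>Up to the factor \<open>n\<close>, the sum of \<open>min (\<bar>C\<bar> / L) 1\<close> over all blocks \<open>C\<close>. It drops by 1 when two
  blocks of size at least \<open>L\<close> merge, and initially it is only \<open>1 / L\<close>.\<close>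

definition capf :: "nat \<Rightarrow> nat \<Rightarrow> nat \<Rightarrow> state \<Rightarrow> real" where
  "capf n L = stat n (\<lambda>a. min (1 / L) (1 / a))"

text \<open>After multiplication by \<open>a\<close> the function is \<open>min (a / L) 1\<close>,
  which is monotone, subadditive and at most 1; on sizes at least \<open>L\<close> it is constantly
  1.\<close>

lemma gain_cap:
  assumes "1 \<le> L" "1 \<le> a" "1 \<le> b"
  shows "gain (\<lambda>a. min (1 / real L) (1 / real a)) a b \<le> 0"
    "- 1 \<le> gain (\<lambda>a. min (1 / real L) (1 / real a)) a b"
    "L \<le> a \<Longrightarrow> L \<le> b \<Longrightarrow> gain (\<lambda>a. min (1 / real L) (1 / real a)) a b = - 1"
proof -
  have m: "real a * min (1 / real L) (1 / real a) = min (real a / L) 1" if "1 \<le> a" for a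
    using that by (simp add: min_mult_distrib_left)
  have g: "gain (\<lambda>a. min (1 / real L) (1 / real a)) a b = min (a / L + b / L) 1 - min (a / L) 1 - min (b / L) 1"
    using m[of a] m[of b] m[of "a + b"] assms by (simp add: gain_def add_divide_distrib)
  have "0 \<le> a / L" "0 \<le> b / L" by auto
  then show "gain (\<lambda>a. min (1 / real L) (1 / real a)) a b \<le> 0"
    "- 1 \<le> gain (\<lambda>a. min (1 / real L) (1 / real a)) a b"
    unfolding g by linarith+
  show "gain (\<lambda>a. min (1 / real L) (1 / real a)) a b = - 1" if "L \<le> a" "L \<le> b"
  proof -
    have "1 \<le> a / L" "1 \<le> b / L" using that assms by auto
    then show ?thesis unfolding g by linarith
  qed
qed

lemma capf_bounds:
  assumes "L \<ge> 1"
  shows "0 \<le> capf n L k S" "capf n L k S \<le> 1 / L"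
proof -
  show "0 \<le> capf n L k S" unfolding capf_def stat_def by (intro avg_nonneg) auto
  have "capf n L k S \<le> avg n (\<lambda>_. 1 / L)" unfolding capf_def stat_def by (intro avg_mono) auto
  also have "\<dots> \<le> 1 / L" by (cases "n = 0") (auto simp: avg_def)
  finally show "capf n L k S \<le> 1 / L" .
qed

lemma capf_ad_bound:
  assumes "L \<ge> 1" "e \<in> Kedges n"
  shows "\<bar>capf n L k (ad e S) - capf n L k S\<bar> \<le> 1 / n"
  unfolding capf_def
proof (rule stat_ad_bound[OF assms(2)])
  fix a b :: nat assume "1 \<le> a" "1 \<le> b"
  then show "\<bar>gain (\<lambda>a. min (1 / real L) (1 / real a)) a b\<bar> \<le> 1"
    using gain_cap[OF assms(1), of a b] by (simp add: abs_le_iff)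
qed simp

lemma eta_0: "eta n 0 L S = 0"
  by (simp add: eta_def rls_def avg2_def avg_def)

text \<open>Two vertices in different large blocks of level \<open>j + 1\<close> are either
  separated at level \<open>j\<close> already, or the edge between them would be accepted by forest
  \<open>j + 1\<close> and lower the capped block count by 1. The factor 2 undoes the half in
  \<open>Lg_stat\<close>.\<close>

lemma eta_Suc:
  assumes S: "good n S" and L: "L \<ge> 1"
  shows "eta n (Suc j) L S \<le> eta n j L S - 2 * Lg n (capf n L (Suc j)) S"
proof -
  let ?g = "\<lambda>u v. of_bool (acc S j (u, v)) * gain (\<lambda>a. min (1 / real L) (1 / real a)) (sz n S (Suc j) u) (sz n S (Suc j) v)"
  have "eta n (Suc j) L S \<le> avg2 n (\<lambda>u v. of_bool (L \<le> sz n S j u) * of_bool (L \<le> sz n S j v) * (1 - rls S j u v) - ?g u v)"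
    unfolding eta_def
  proof (rule avg2_mono)
    fix u v assume uv: "u < n" "v < n"
    have sub: "rl S (Suc j) \<subseteq> rl S j" by (rule rl_Suc_subset[OF S])
    have le: "sz n S (Suc j) u \<le> sz n S j u" "sz n S (Suc j) v \<le> sz n S j v"
      by (intro sz_mono sub)+
    note g = gain_cap[OF L sz_pos[OF uv(1), of S "Suc j"] sz_pos[OF uv(2), of S "Suc j"]]
    consider "(u, v) \<in> rl S (Suc j)" | "acc S j (u, v)" | "(u, v) \<notin> rl S (Suc j)" "(u, v) \<notin> rl S j"
      by (auto simp: acc_def)
    then show "of_bool (L \<le> sz n S (Suc j) u) * of_bool (L \<le> sz n S (Suc j) v) * (1 - rls S (Suc j) u v)
        \<le> of_bool (L \<le> sz n S j u) * of_bool (L \<le> sz n S j v) * (1 - rls S j u v) - ?g u v"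
    proof cases
      case 1
      then have "(u, v) \<in> rl S j" using sub by blast
      then show ?thesis using 1 by (simp add: rls_def acc_def)
    next
      case 2
      then show ?thesis using g by (auto simp: rls_def acc_def of_bool_def)
    next
      case 3
      then show ?thesis using le by (auto simp: rls_def acc_def of_bool_def)
    qed
  qed
  also have "\<dots> = eta n j L S - avg2 n ?g" unfolding eta_def avg2_diff ..
  finally show ?thesis by (simp add: capf_def Lg_stat)
qed

text \<open>The recursion starts at level 0, whose single block gives \<open>eta = 0\<close>.
  Integrated over time, the right-hand side is twice the total decrease of \<open>j\<close>
  functionals bounded by \<open>1 / L\<close>, so \<open>eta\<close> is small on average over
  time.\<close>

lemma eta_le:
  assumes S: "good n S" and L: "L \<ge> 1"
  shows "eta n j L S \<le> - 2 * (\<Sum>i\<in>{1..j}. Lg n (capf n L i) S)"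
proof (induction j)
  case (Suc j)
  then show ?case using eta_Suc[OF S L, of j] by simp
qed (simp add: eta_0)

section \<open>Small blocks that are not isolated one level up\<close>

lemma sz_ad_changed:
  assumes "w < n" "sz n (ad (u, v) S) j w \<noteq> sz n S j w"
  shows "w \<in> blk n S j u \<union> blk n S j v \<and> (\<exists>i. j = Suc i \<and> acc S i (u, v))"
proof (cases j)
  case (Suc i)
  have a: "acc S i (u, v)"
  proof (rule ccontr)
    assume "\<not> acc S i (u, v)"
    then show False using assms(2) by (simp add: Suc sz_def blk_def rl_ad_not_acc)
  qed
  then show ?thesis
    using blk_ad_acc[OF a assms(1)] assms(2) by (auto simp: Suc sz_def split: if_splits)
qed (use assms in simp)

text \<open>The vertices whose status changes lie in the small blocks \<open>W\<close> of level
  \<open>j\<close> at the two ends, at most \<open>2 * L\<close> of them. A vertex can become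
  exceptional only by a merger at level \<open>j + 1\<close>; such an edge lies within one block of
  level \<open>j\<close>, and that block must be small.\<close>

lemma thf_ad:
  assumes S: "good n S" and e: "(u, v) \<in> Kedges n"
  shows "\<bar>thf n j L (ad (u, v) S) - thf n j L S\<bar> \<le> 2 * real L / real n"
    "thf n j L (ad (u, v) S) - thf n j L S \<le> 2 * real L / real n * of_bool ((u, v) \<in> rl S j \<and> sz n S j u < L)"
proof -
  define T where "T = ad (u, v) S"
  define f where "f S w = (of_bool (sz n S j w < L \<and> 2 \<le> sz n S (Suc j) w) :: real)" for S w
  define W where "W = {w \<in> blk n S j u \<union> blk n S j v. sz n S j w < L}"
  have grow: "sz n S i w \<le> sz n T i w" for i w
    unfolding T_def by (intro sz_mono rl_ad_mono)
  have inW: "w \<in> W" if "w < n" "f T w \<noteq> f S w" for w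
  proof (cases "sz n T j w = sz n S j w")
    case True
    with that have "sz n T (Suc j) w \<noteq> sz n S (Suc j) w" "sz n S j w < L"
      by (auto simp: f_def of_bool_def split: if_splits)
    then have "w \<in> blk n S (Suc j) u \<union> blk n S (Suc j) v"
      using sz_ad_changed[OF that(1), of u v S "Suc j"] unfolding T_def by blast
    also have "\<dots> \<subseteq> blk n S j u \<union> blk n S j v"
      by (intro Un_mono blk_mono rl_Suc_subset[OF S])
    finally show ?thesis using \<open>sz n S j w < L\<close> by (simp add: W_def)
  next
    case False
    then have "w \<in> blk n S j u \<union> blk n S j v"
      using sz_ad_changed[OF that(1), of u v S j] unfolding T_def by blast
    moreover have "sz n S j w < L"
      using that(2) grow[of j w] by (auto simp: f_def of_bool_def split: if_splits)
    ultimately show ?thesis by (simp add: W_def)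
  qed
  have cardblk: "card {w \<in> blk n S j x. sz n S j w < L} \<le> L" for x
  proof (cases "sz n S j x < L")
    case True
    have "card {w \<in> blk n S j x. sz n S j w < L} \<le> card (blk n S j x)" by (intro card_mono) auto
    then show ?thesis using True by (simp add: sz_def)
  next
    case False
    then have e: "{w \<in> blk n S j x. sz n S j w < L} = {}" using sz_blk by fastforce
    show ?thesis unfolding e by simp
  qed
  have "W = {w \<in> blk n S j u. sz n S j w < L} \<union> {w \<in> blk n S j v. sz n S j w < L}"
    by (auto simp: W_def)
  then have "card W \<le> card {w \<in> blk n S j u. sz n S j w < L} + card {w \<in> blk n S j v. sz n S j w < L}"
    by (simp add: card_Un_le)
  then have cardW: "card W \<le> 2 * L" using cardblk[of u] cardblk[of v] by linarith
  have W: "finite W" "W \<subseteq> {..<n}" by (auto simp: W_def blk_def)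
  have diff: "thf n j L T - thf n j L S = (\<Sum>w\<in>W. f T w - f S w) / n"
  proof -
    have "thf n j L T - thf n j L S = (\<Sum>w<n. f T w - f S w) / n"
      unfolding thf_def avg_def f_def by (simp only: sum_subtractf diff_divide_distrib)
    also have "(\<Sum>w<n. f T w - f S w) = (\<Sum>w\<in>W. f T w - f S w)"
      using W inW by (intro sum.mono_neutral_right) auto
    finally show ?thesis .
  qed
  have f1: "\<bar>f T w - f S w\<bar> \<le> 1" for w by (auto simp: f_def of_bool_def)
  have "\<bar>\<Sum>w\<in>W. f T w - f S w\<bar> \<le> (\<Sum>w\<in>W. 1)"
    by (rule order_trans[OF sum_abs sum_mono[OF f1]])
  also have "\<dots> \<le> 2 * real L" using cardW by simp
  finally have b: "\<bar>\<Sum>w\<in>W. f T w - f S w\<bar> \<le> 2 * real L" .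
  then show 1: "\<bar>thf n j L (ad (u, v) S) - thf n j L S\<bar> \<le> 2 * real L / real n"
    unfolding T_def[symmetric] diff by (simp add: divide_right_mono)
  show "thf n j L (ad (u, v) S) - thf n j L S \<le> 2 * real L / real n * of_bool ((u, v) \<in> rl S j \<and> sz n S j u < L)"
  proof (cases "(u, v) \<in> rl S j \<and> sz n S j u < L")
    case True
    then show ?thesis using 1 by simp
  next
    case False
    have "f T w - f S w \<le> 0" if "w \<in> W" for w
    proof (rule ccontr)
      assume "\<not> f T w - f S w \<le> 0"
      then have "f T w = 1" "f S w = 0" by (auto simp: f_def of_bool_def split: if_splits)
      then have c: "sz n T j w < L" "2 \<le> sz n T (Suc j) w" "\<not> (sz n S j w < L \<and> 2 \<le> sz n S (Suc j) w)"
        by (auto simp: f_def split: if_splits)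
      have wL: "sz n S j w < L" using grow[of j w] c(1) by linarith
      then have ch: "sz n T (Suc j) w \<noteq> sz n S (Suc j) w" using c by auto
      have "w < n" using that W by auto
      from sz_ad_changed[OF this ch[unfolded T_def]]
      have w: "w \<in> blk n S (Suc j) u \<union> blk n S (Suc j) v" and a: "acc S j (u, v)" by auto
      have uv: "(u, v) \<in> rl S j" using a by (simp add: acc_def)
      have "w \<in> blk n S j u \<union> blk n S j v"
        using w blk_mono[OF rl_Suc_subset[OF S], of n j] by blast
      then have "sz n S j w = sz n S j u"
        using sz_blk[of w n S j u] sz_blk[of w n S j v] sz_eq[OF uv, of n] by auto
      then show False using False uv wL by simp
    qed
    then have "(\<Sum>w\<in>W. f T w - f S w) \<le> 0" by (rule sum_nonpos)
    then show ?thesis using False unfolding T_def[symmetric] diff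
      by (auto simp: divide_nonpos_nonneg)
  qed
qed

lemma Lg_thf:
  assumes S: "good n S" and n: "n \<ge> 1"
  shows "Lg n (thf n j L) S \<le> 2 * (real L)\<^sup>2 / n"
proof -
  let ?p = "\<lambda>u v. of_bool (sz n S j u < L) * rls S j u v"
  have "(\<Sum>e\<in>Kedges n. thf n j L (ad e S) - thf n j L S) \<le> (\<Sum>(u, v)\<in>Kedges n. 2 * real L / real n * ?p u v)"
    using thf_ad(2)[OF S] by (intro sum_mono) (fastforce simp: rls_def of_bool_conj mult.commute)
  also have "\<dots> \<le> (\<Sum>(u, v)\<in>{..<n} \<times> {..<n}. 2 * real L / real n * ?p u v)"
    by (intro sum_mono2) (auto simp: Kedges_def rls_def)
  also have "\<dots> = 2 * real L / real n * (real n * (\<Sum>u<n. of_bool (sz n S j u < L) * avg n (rls S j u)))"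
  proof -
    have r: "(\<Sum>v<n. rls S j u v) = real n * avg n (rls S j u)" for u
      using n by (simp add: avg_def)
    have "(\<Sum>(u, v)\<in>{..<n} \<times> {..<n}. 2 * real L / real n * ?p u v) = (\<Sum>u<n. \<Sum>v<n. 2 * real L / real n * ?p u v)"
      by (simp only: sum.cartesian_product)
    also have "\<dots> = (\<Sum>u<n. 2 * real L / real n * (of_bool (sz n S j u < L) * (real n * avg n (rls S j u))))"
      by (simp only: sum_distrib_left[symmetric] r)
    also have "\<dots> = 2 * real L / real n * (real n * (\<Sum>u<n. of_bool (sz n S j u < L) * avg n (rls S j u)))"
      by (simp only: sum_distrib_left mult_ac)
    finally show ?thesis .
  qed
  also have "\<dots> \<le> 2 * real L / real n * (real n * (\<Sum>u<n. L / n))"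
    unfolding avg_rls by (intro mult_left_mono sum_mono) (auto simp: of_bool_def divide_right_mono)
  also have "\<dots> = 2 * (real L)\<^sup>2" using n by (simp add: power2_eq_square)
  finally show ?thesis unfolding Lg_def by (rule divide_right_mono) simp
qed

text \<open>Summing \<open>1 / size\<close> over the vertices counts each block once, so this is the
  number of blocks divided by \<open>n\<close>.\<close>

definition kap :: "nat \<Rightarrow> nat \<Rightarrow> state \<Rightarrow> real" where
  "kap n k = stat n (\<lambda>a. 1 / real a) k"

lemma kap_bounds: "0 \<le> kap n k S" "kap n k S \<le> 1"
  unfolding kap_def stat_def by (auto intro!: avg_nonneg avg_le_1 simp: divide_le_eq)

lemma gain_inverse: "1 \<le> a \<Longrightarrow> 1 \<le> b \<Longrightarrow> gain (\<lambda>a. 1 / real a) a b = - 1"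
  by (simp add: gain_def)

lemma kap_ad:
  assumes "e \<in> Kedges n"
  shows "kap n (Suc j) (ad e S) = kap n (Suc j) S - of_bool (acc S j e) / n"
proof -
  obtain u v where e: "e = (u, v)" "u < n" "v < n" using assms by (cases e) (auto simp: Kedges_def)
  have "gain (\<lambda>a. 1 / real a) (sz n S (Suc j) u) (sz n S (Suc j) v) = - 1"
    using e by (intro gain_inverse sz_pos)
  then show ?thesis
    using stat_ad[of u v n "\<lambda>a. 1 / real a" j S] assms unfolding kap_def e(1) by simp
qed

text \<open>There are at most \<open>n / L\<close> blocks of size at least \<open>L\<close>, so the
  count of components can be read off the small sizes.\<close>

lemma kap_cf:
  assumes "n \<ge> 1" "L \<ge> 1"
  shows "\<bar>kap n k S - (\<Sum>l\<in>{1..<L}. cf n k l S / l)\<bar> \<le> 1 / L"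
proof -
  have "kap n k S - (\<Sum>l\<in>{1..<L}. cf n k l S / l)
      = avg n (\<lambda>u. 1 / real (sz n S k u) - (\<Sum>l\<in>{1..<L}. 1 / real l * of_bool (sz n S k u = l)))"
    by (simp only: kap_def cf_def stat_def avg_diff avg_sum avg_cmult) simp
  also have "\<bar>\<dots>\<bar> \<le> avg n (\<lambda>u. 1 / L)"
  proof (rule order_trans[OF avg_abs], rule avg_mono)
    fix u assume "u < n"
    have a: "1 \<le> sz n S k u" by (rule sz_pos) fact
    have "(\<Sum>l\<in>{1..<L}. 1 / real l * of_bool (sz n S k u = l)) = (if sz n S k u < L then 1 / real (sz n S k u) else 0)"
    proof -
      have "(\<Sum>l\<in>{1..<L}. 1 / real l * of_bool (sz n S k u = l)) = (\<Sum>l\<in>{1..<L}. if sz n S k u = l then 1 / real l else 0)"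
        by (intro sum.cong) auto
      then show ?thesis using a by (simp only: sum.delta' finite_atLeastLessThan) auto
    qed
    then show "\<bar>1 / real (sz n S k u) - (\<Sum>l\<in>{1..<L}. 1 / real l * of_bool (sz n S k u = l))\<bar> \<le> 1 / L"
      using a assms(2) by (auto simp: frac_le)
  qed
  also have "\<dots> = 1 / L" using assms by simp
  finally show ?thesis .
qed

section \<open>Two independent copies\<close>

lemma derivative_bound_within:
  fixes f :: "real \<Rightarrow> real"
  assumes "a \<le> b"
    and d: "\<And>x. x \<in> {a..b} \<Longrightarrow> \<exists>h. (f has_real_derivative h) (at x within {a..b}) \<and> h \<le> C"
  shows "f b - f a \<le> C * (b - a)"
proof (cases "a = b")
  case False
  obtain h where h: "\<And>x. x \<in> {a..b} \<Longrightarrow> (f has_real_derivative h x) (at x within {a..b}) \<and> h x \<le> C"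
    using d by metis
  have "\<exists>x\<in>{a<..<b}. f b - f a = h x * (b - a)"
    by (rule mvt_simple[where f'="\<lambda>x. (*) (h x)"])
      (use assms(1) False h in \<open>auto simp flip: has_field_derivative_def\<close>)
  then obtain x where "a < x" "x < b" "f b - f a = h x * (b - a)" by auto
  then show ?thesis using h[of x] by (auto intro!: mult_right_mono)
qed simp

lemma gronwall:
  fixes Y :: "real \<Rightarrow> real"
  assumes K: "0 \<le> K" "0 \<le> \<epsilon>" and x: "x \<in> {0..X}" and Y0: "0 \<le> Y 0"
    and d: "\<And>x. x \<in> {0..X} \<Longrightarrow> \<exists>h. (Y has_real_derivative h) (at x within {0..X}) \<and> h \<le> K * Y x + \<epsilon>"
  shows "Y x \<le> (Y 0 + \<epsilon> * X) * exp (K * X)"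
proof -
  define Z where "Z x = Y x * exp (- (K * x)) - \<epsilon> * x" for x
  have "Z x - Z 0 \<le> 0 * (x - 0)"
  proof (rule derivative_bound_within)
    fix y assume y: "y \<in> {0..x}"
    then have yX: "y \<in> {0..X}" using x by auto
    from d[OF this] obtain h where h: "(Y has_real_derivative h) (at y within {0..X})" "h \<le> K * Y y + \<epsilon>" by blast
    have h': "(Y has_real_derivative h) (at y within {0..x})"
      by (rule DERIV_subset[OF h(1)]) (use x in auto)
    have "(Z has_real_derivative h * exp (- (K * y)) + exp (- (K * y)) * - K * Y y - \<epsilon>) (at y within {0..x})"
      unfolding Z_def
      by (rule derivative_eq_intros h' refl | simp)+
    moreover have "h * exp (- (K * y)) + exp (- (K * y)) * - K * Y y - \<epsilon> \<le> 0"
    proof -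
      have "(h - K * Y y) * exp (- (K * y)) \<le> \<epsilon> * exp (- (K * y))"
        using h(2) by (intro mult_right_mono) auto
      also have "\<dots> \<le> \<epsilon> * 1" using K y by (intro mult_left_mono) auto
      finally show ?thesis by (simp add: algebra_simps)
    qed
    ultimately show "\<exists>h. (Z has_real_derivative h) (at y within {0..x}) \<and> h \<le> 0" by blast
  qed (use x in auto)
  then have "Y x * exp (- (K * x)) \<le> Y 0 + \<epsilon> * x" by (simp add: Z_def)
  then have "Y x * exp (- (K * x)) * exp (K * x) \<le> (Y 0 + \<epsilon> * x) * exp (K * x)"
    by (rule mult_right_mono) simp
  then have "Y x \<le> (Y 0 + \<epsilon> * x) * exp (K * x)" by (simp add: mult.assoc flip: exp_add)
  also have "\<dots> \<le> (Y 0 + \<epsilon> * X) * exp (K * X)"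
    using K x Y0 by (intro mult_mono add_left_mono mult_left_mono) (auto intro: mult_left_mono)
  finally show ?thesis .
qed

text \<open>Almost surely no cost is at most 0, so the process starts with all levels empty.\<close>

lemma Ef_0:
  assumes D: "cost_dist D"
  shows "Ef n D \<phi> 0 = \<phi> (\<lambda>_. {})"
proof -
  let ?R = "{lev c A |c A. A \<subseteq> Kedges n}"
  define B where "B = Max ((\<lambda>S. \<bar>\<phi> S - \<phi> (\<lambda>_. {})\<bar>) ` ?R)"
  have inR: "St n c 0 \<in> ?R" for c by (auto simp: St_def)
  have B: "\<bar>\<phi> (St n c 0) - \<phi> (\<lambda>_. {})\<bar> \<le> B" for c
    unfolding B_def using finite_states[of n] inR by (intro Max_ge finite_imageI imageI)
  then have B0: "0 \<le> B" by (rule order_trans[OF abs_ge_zero])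
  define q where "q e c = (indicator {..0} (c e) :: real)" for e :: "nat \<times> nat" and c :: "nat \<times> nat \<Rightarrow> real"
  have ptw: "\<bar>\<phi> (St n c 0) - \<phi> (\<lambda>_. {})\<bar> \<le> (\<Sum>e\<in>Kedges n. B * q e c)" for c
  proof (cases "\<exists>e\<in>Kedges n. c e \<le> 0")
    case True
    then obtain e where e: "e \<in> Kedges n" "c e \<le> 0" by blast
    have "B * q e c \<le> (\<Sum>e\<in>Kedges n. B * q e c)"
      by (rule member_le_sum[OF e(1)]) (use B0 in \<open>auto simp: q_def\<close>)
    then show ?thesis using B[of c] e by (simp add: q_def)
  next
    case False
    then have e: "{e \<in> Kedges n. c e \<le> 0} = {}" by auto
    have "St n c 0 = (\<lambda>_. {})" unfolding St_def e by (simp add: lev_empty fun_eq_iff)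
    then show ?thesis using B0 by (auto intro!: sum_nonneg simp: q_def)
  qed
  have int: "integrable (cost_space n D) (\<lambda>c. B * q e c)" if "e \<in> Kedges n" for e
    using that B0 measurable_cost[OF D that]
    by (intro integrable_bounded[OF D, of _ n B]) (auto simp: q_def indicator_def)
  have "\<bar>Ef n D (\<lambda>S. \<phi> S - \<phi> (\<lambda>_. {})) 0\<bar> \<le> (\<integral>c. \<bar>\<phi> (St n c 0) - \<phi> (\<lambda>_. {})\<bar> \<partial>cost_space n D)"
    unfolding Ef_def by (simp add: integral_abs_bound)
  also have "\<dots> \<le> (\<integral>c. (\<Sum>e\<in>Kedges n. B * q e c) \<partial>cost_space n D)"
    using ptw int integrable_St[OF D, of n "\<lambda>S. \<bar>\<phi> S - \<phi> (\<lambda>_. {})\<bar>"]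
    by (intro integral_mono) (auto intro!: Bochner_Integration.integrable_sum)
  also have "\<dots> = (\<Sum>e\<in>Kedges n. B * (\<integral>c. q e c \<partial>cost_space n D))"
    using int by (subst Bochner_Integration.integral_sum) (auto simp: int)
  also have "\<dots> \<le> (\<Sum>e\<in>Kedges n. B * 0)"
    using B0 prob_le[OF D, of _ n 0, folded q_def] by (intro sum_mono mult_left_mono) auto
  finally show ?thesis
    using Ef_diff[OF D, of n \<phi> "\<lambda>_. \<phi> (\<lambda>_. {})" 0] Ef_const[OF D, of n "\<phi> (\<lambda>_. {})" 0] by simp
qed

text \<open>Expectation over two independent copies at the same scaled time, written as an iterated
  expectation instead of on a product space.\<close>

definition EE :: "nat \<Rightarrow> real measure \<Rightarrow> nat \<Rightarrow> real measure \<Rightarrow> (state \<Rightarrow> state \<Rightarrow> real) \<Rightarrow> real \<Rightarrow> real" where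
  "EE n D m D' h x = Ef n D (\<lambda>S. Ef m D' (\<lambda>T. h S T) x) x"

definition DD :: "nat \<Rightarrow> real measure \<Rightarrow> nat \<Rightarrow> real measure \<Rightarrow> nat \<Rightarrow> nat \<Rightarrow> real \<Rightarrow> real" where
  "DD n D m D' k l x = EE n D m D' (\<lambda>S T. (cf n k l S - cf m k l T)\<^sup>2) x"

context
  fixes n m :: nat and D D' :: "real measure"
  assumes D: "cost_dist D" and D': "cost_dist D'"
begin

lemma EE_mono: "(\<And>S T. good n S \<Longrightarrow> good m T \<Longrightarrow> h S T \<le> k S T) \<Longrightarrow> EE n D m D' h x \<le> EE n D m D' k x"
  unfolding EE_def by (intro Ef_mono[OF D] Ef_mono[OF D']) auto

lemma EE_add: "EE n D m D' (\<lambda>S T. h S T + k S T) x = EE n D m D' h x + EE n D m D' k x"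
  unfolding EE_def by (simp only: Ef_add[OF D'] Ef_add[OF D])

lemma EE_diff: "EE n D m D' (\<lambda>S T. h S T - k S T) x = EE n D m D' h x - EE n D m D' k x"
  unfolding EE_def by (simp only: Ef_diff[OF D'] Ef_diff[OF D])

lemma EE_sum: "EE n D m D' (\<lambda>S T. \<Sum>i\<in>A. h i S T) x = (\<Sum>i\<in>A. EE n D m D' (h i) x)"
  unfolding EE_def by (simp only: Ef_sum[OF D'] Ef_sum[OF D])

lemma EE_cmult: "EE n D m D' (\<lambda>S T. a * h S T) x = a * EE n D m D' h x"
  unfolding EE_def by (simp only: Ef_cmult[OF D'] Ef_cmult[OF D])

lemma EE_const: "EE n D m D' (\<lambda>S T. a) x = a"
  unfolding EE_def by (simp only: Ef_const[OF D'] Ef_const[OF D])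

lemma EE_fst: "EE n D m D' (\<lambda>S T. \<phi> S) x = Ef n D \<phi> x"
  unfolding EE_def by (simp only: Ef_const[OF D'])

lemma EE_snd: "EE n D m D' (\<lambda>S T. \<psi> T) x = Ef m D' \<psi> x"
  unfolding EE_def by (simp only: Ef_const[OF D])

lemma EE_prod: "EE n D m D' (\<lambda>S T. \<phi> S * \<psi> T) x = Ef n D \<phi> x * Ef m D' \<psi> x"
  unfolding EE_def
  by (simp only: Ef_cmult[OF D'] mult.commute[of _ "Ef m D' \<psi> x"] Ef_cmult[OF D])

text \<open>Only moments of single copies remain, so the derivative in time needs no generator for
  the pair of copies.\<close>

lemma EE_square:
  "EE n D m D' (\<lambda>S T. (\<phi> S - \<psi> T)\<^sup>2) x =
    Ef n D (\<lambda>S. (\<phi> S)\<^sup>2) x + Ef m D' (\<lambda>S. (\<psi> S)\<^sup>2) x - 2 * Ef n D \<phi> x * Ef m D' \<psi> x"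
proof -
  have "EE n D m D' (\<lambda>S T. (\<phi> S - \<psi> T)\<^sup>2) x = EE n D m D' (\<lambda>S T. (\<phi> S)\<^sup>2 + (\<psi> T)\<^sup>2 - 2 * (\<phi> S * \<psi> T)) x"
    by (simp add: power2_diff mult.assoc)
  then show ?thesis by (simp only: EE_diff EE_add EE_cmult EE_fst EE_snd EE_prod mult.assoc)
qed

text \<open>For each copy, \<open>4 * (real l)\<^sup>2\<close> comes from the squared jumps. The
  part \<open>24 * real l * X\<close> collects the generator error \<open>12 * real l * X\<close> of
  the second moment and twice the error \<open>6 * real l * X\<close> of the mean, which is
  multiplied by the mean of the other copy, a number in \<open>{0..1}\<close>.\<close>

lemma DD_derivative:
  assumes n: "n \<ge> 1" "m \<ge> 1" and X: "X \<le> n / 2" "X \<le> m / 2" and x: "x \<in> {0..X}"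
  shows "\<exists>h. (DD n D m D' k l has_real_derivative h) (at x within {0..X}) \<and>
    h \<le> EE n D m D' (\<lambda>S T. 2 * (cf n k l S - cf m k l T) * (Lg n (cf n k l) S - Lg m (cf m k l) T)) x
      + (4 * (real l)\<^sup>2 + 24 * real l * X) * (1 / n + 1 / m)"
proof -
  have one: "\<exists>h h2. (Ef n D (cf n k l) has_real_derivative h) (at x within {0..X}) \<and>
      (Ef n D (\<lambda>S. (cf n k l S)\<^sup>2) has_real_derivative h2) (at x within {0..X}) \<and>
      \<bar>h - Ef n D (Lg n (cf n k l)) x\<bar> \<le> 6 * real l * X / n \<and>
      h2 \<le> 2 * Ef n D (\<lambda>S. cf n k l S * Lg n (cf n k l) S) x + 4 * (real l)\<^sup>2 / n + 12 * real l * X / n"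
    if D: "cost_dist D" and n: "n \<ge> 1" and X: "X \<le> n / 2" for n D
  proof -
    have x': "x \<in> {0..real n / 2}" and sub: "{0..X} \<subseteq> {0..real n / 2}" using x X by auto
    have c1: "\<bar>cf n k l S\<bar> \<le> 1" and c2: "\<bar>(cf n k l S)\<^sup>2\<bar> \<le> 1" for S
      using cf_bounds[of n k l S] by (auto simp: power_le_one)
    obtain h where h: "(Ef n D (cf n k l) has_real_derivative h) (at x within {0..n/2})"
      "\<bar>h - Ef n D (Lg n (cf n k l)) x\<bar> \<le> 3 * (2 * real l / n) * x"
      using Ef_generator[OF D c1 n x' cf_ad_bound] by auto
    obtain h2 where h2: "(Ef n D (\<lambda>S. (cf n k l S)\<^sup>2) has_real_derivative h2) (at x within {0..n/2})"
      "\<bar>h2 - Ef n D (Lg n (\<lambda>S. (cf n k l S)\<^sup>2)) x\<bar> \<le> 3 * (4 * real l / n) * x"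
      using Ef_generator[OF D c2 n x' cf_sq_ad_bound] by auto
    have "Ef n D (Lg n (\<lambda>S. (cf n k l S)\<^sup>2)) x \<le> Ef n D (\<lambda>S. 2 * (cf n k l S * Lg n (cf n k l) S) + 4 * (real l)\<^sup>2 / n) x"
      using Lg_cf_sq[OF n] by (intro Ef_mono[OF D]) (simp add: mult.assoc)
    also have "\<dots> = 2 * Ef n D (\<lambda>S. cf n k l S * Lg n (cf n k l) S) x + 4 * (real l)\<^sup>2 / n"
      by (simp only: Ef_add[OF D] Ef_cmult[OF D] Ef_const[OF D])
    moreover have "3 * (4 * real l / n) * x \<le> 12 * real l * X / n" "3 * (2 * real l / n) * x \<le> 6 * real l * X / n"
      using x by (auto intro!: divide_right_mono mult_left_mono)
    ultimately show ?thesis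
      using h h2 DERIV_subset[OF h(1) sub] DERIV_subset[OF h2(1) sub] by (intro exI[of _ h] exI[of _ h2]) linarith
  qed
  let ?f = "Ef n D (cf n k l)" and ?g = "Ef m D' (cf m k l)"
  let ?s = "Ef n D (\<lambda>S. (cf n k l S)\<^sup>2)" and ?t = "Ef m D' (\<lambda>S. (cf m k l S)\<^sup>2)"
  obtain h h2 where h: "(?f has_real_derivative h) (at x within {0..X})"
    "(?s has_real_derivative h2) (at x within {0..X})"
    "\<bar>h - Ef n D (Lg n (cf n k l)) x\<bar> \<le> 6 * real l * X / n"
    "h2 \<le> 2 * Ef n D (\<lambda>S. cf n k l S * Lg n (cf n k l) S) x + 4 * (real l)\<^sup>2 / n + 12 * real l * X / n"
    using one[OF D n(1) X(1)] by blast
  obtain g g2 where g: "(?g has_real_derivative g) (at x within {0..X})"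
    "(?t has_real_derivative g2) (at x within {0..X})"
    "\<bar>g - Ef m D' (Lg m (cf m k l)) x\<bar> \<le> 6 * real l * X / m"
    "g2 \<le> 2 * Ef m D' (\<lambda>S. cf m k l S * Lg m (cf m k l) S) x + 4 * (real l)\<^sup>2 / m + 12 * real l * X / m"
    using one[OF D' n(2) X(2)] by blast
  have DDeq: "DD n D m D' k l = (\<lambda>x. ?s x + ?t x - 2 * (?f x * ?g x))"
    by (rule ext) (simp add: DD_def EE_square mult.assoc)
  have d: "(DD n D m D' k l has_real_derivative h2 + g2 - 2 * (h * ?g x + g * ?f x)) (at x within {0..X})"
    unfolding DDeq by (intro DERIV_diff DERIV_add DERIV_cmult DERIV_mult h g)
  have rng: "0 \<le> ?f x" "?f x \<le> 1" "0 \<le> ?g x" "?g x \<le> 1"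
    using Ef_mono[OF D, of "\<lambda>_. 0" n x "cf n k l"] Ef_mono[OF D, of "cf n k l" n x "\<lambda>_. 1"]
      Ef_mono[OF D', of "\<lambda>_. 0" m x "cf m k l"] Ef_mono[OF D', of "cf m k l" m x "\<lambda>_. 1"] cf_bounds
    by (simp_all add: Ef_const[OF D] Ef_const[OF D'])
  have p1: "- (h * ?g x) \<le> - (Ef n D (Lg n (cf n k l)) x * ?g x) + 6 * real l * X / n"
  proof -
    have "(Ef n D (Lg n (cf n k l)) x - h) * ?g x \<le> \<bar>h - Ef n D (Lg n (cf n k l)) x\<bar> * 1"
      using rng by (intro mult_mono) auto
    then show ?thesis using h(3) by (simp add: algebra_simps)
  qed
  have p2: "- (g * ?f x) \<le> - (Ef m D' (Lg m (cf m k l)) x * ?f x) + 6 * real l * X / m"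
  proof -
    have "(Ef m D' (Lg m (cf m k l)) x - g) * ?f x \<le> \<bar>g - Ef m D' (Lg m (cf m k l)) x\<bar> * 1"
      using rng by (intro mult_mono) auto
    then show ?thesis using g(3) by (simp add: algebra_simps)
  qed
  have "EE n D m D' (\<lambda>S T. 2 * (cf n k l S - cf m k l T) * (Lg n (cf n k l) S - Lg m (cf m k l) T)) x
    = EE n D m D' (\<lambda>S T. 2 * ((cf n k l S * Lg n (cf n k l) S + cf m k l T * Lg m (cf m k l) T)
        - (Lg n (cf n k l) S * cf m k l T + cf n k l S * Lg m (cf m k l) T))) x"
    by (simp add: algebra_simps)
  also have "\<dots> = 2 * ((Ef n D (\<lambda>S. cf n k l S * Lg n (cf n k l) S) x + Ef m D' (\<lambda>S. cf m k l S * Lg m (cf m k l) S) x)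
      - (Ef n D (Lg n (cf n k l)) x * ?g x + ?f x * Ef m D' (Lg m (cf m k l)) x))"
    by (simp only: EE_cmult EE_diff EE_add EE_prod EE_fst[of "\<lambda>S. cf n k l S * Lg n (cf n k l) S"]
      EE_snd[of "\<lambda>S. cf m k l S * Lg m (cf m k l) S"])
  finally have e: "EE n D m D' (\<lambda>S T. 2 * (cf n k l S - cf m k l T) * (Lg n (cf n k l) S - Lg m (cf m k l) T)) x = \<dots>" .
  have ar: "h2 + g2 - 2 * (p + q) \<le> 2 * (a + b - (c + d)) + (A + B + 2 * C) + (A' + B' + 2 * C')"
    if "h2 \<le> 2 * a + A + B" "g2 \<le> 2 * b + A' + B'" "- p \<le> - c + C" "- q \<le> - d + C'"
    for a b c d p q A B C A' B' C' :: real
  proof -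
    have "- 2 * p \<le> - 2 * c + 2 * C" "- 2 * q \<le> - 2 * d + 2 * C'" using that by auto
    then show ?thesis using that(1,2) by (simp add: algebra_simps)
  qed
  have "h2 + g2 - 2 * (h * ?g x + g * ?f x) \<le>
    EE n D m D' (\<lambda>S T. 2 * (cf n k l S - cf m k l T) * (Lg n (cf n k l) S - Lg m (cf m k l) T)) x
      + (4 * (real l)\<^sup>2 / n + 12 * real l * X / n + 2 * (6 * real l * X / n)) + (4 * (real l)\<^sup>2 / m + 12 * real l * X / m + 2 * (6 * real l * X / m))"
    unfolding e mult.commute[of "?f x"] by (rule ar[OF h(4) g(4) p1 p2])
  also have "\<dots> = EE n D m D' (\<lambda>S T. 2 * (cf n k l S - cf m k l T) * (Lg n (cf n k l) S - Lg m (cf m k l) T)) x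
      + (4 * (real l)\<^sup>2 + 24 * real l * X) * (1 / n + 1 / m)"
    using n by (simp add: field_simps)
  finally show ?thesis using d by blast
qed

end

text \<open>All blocks above level 0 are singletons at the start, so the quantity starts at 0; its
  growth rate is of order \<open>1 / n\<close> because pairs inside small blocks are rare.\<close>

lemma Ef_thf:
  assumes D: "cost_dist D" and n: "n \<ge> 1" and X: "X \<le> n / 2" and x: "x \<in> {0..X}"
  shows "Ef n D (thf n j L) x \<le> (2 * (real L)\<^sup>2 + 6 * real L * X) * X / n"
proof -
  let ?C = "(2 * (real L)\<^sup>2 + 6 * real L * X) / n"
  have "Ef n D (thf n j L) x - Ef n D (thf n j L) 0 \<le> ?C * (x - 0)"
  proof (rule derivative_bound_within)
    fix y assume y: "y \<in> {0..x}"
    then have y': "y \<in> {0..real n / 2}" and sub: "{0..x} \<subseteq> {0..real n / 2}" using x X by auto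
    have b: "\<bar>thf n j L (ad e S) - thf n j L S\<bar> \<le> 2 * real L / real n"
      if "good n S" "e \<in> Kedges n" for S e
      using thf_ad(1)[OF that(1), of "fst e" "snd e" j L] that(2) by simp
    have 1: "\<bar>thf n j L S\<bar> \<le> 1" for S using thf_bounds[of n j L S] by simp
    obtain h where h: "(Ef n D (thf n j L) has_real_derivative h) (at y within {0..n/2})"
      "\<bar>h - Ef n D (Lg n (thf n j L)) y\<bar> \<le> 3 * (2 * real L / n) * y"
      using Ef_generator[OF D 1 n y' b] by auto
    have "Ef n D (Lg n (thf n j L)) y \<le> Ef n D (\<lambda>_. 2 * (real L)\<^sup>2 / n) y"
      using Lg_thf[OF _ n] by (intro Ef_mono[OF D]) simp
    also have "\<dots> = 2 * (real L)\<^sup>2 / n" by (rule Ef_const[OF D])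
    moreover have "3 * (2 * real L / n) * y \<le> 6 * real L * X / n"
      using x y by (auto intro!: divide_right_mono mult_left_mono)
    ultimately have "h \<le> ?C" using h(2) by (simp add: add_divide_distrib)
    then show "\<exists>h. (Ef n D (thf n j L) has_real_derivative h) (at y within {0..x}) \<and> h \<le> ?C"
      using DERIV_subset[OF h(1) sub] by blast
  qed (use x in auto)
  moreover have "Ef n D (thf n j L) 0 = 0"
  proof -
    have "sz n (\<lambda>_. {}) (Suc j) u \<le> 1" for u
    proof -
      have "cn {} = Id" by (simp add: cn_def adj_def)
      then have "blk n (\<lambda>_. {}) (Suc j) u \<subseteq> {u}" by (auto simp: blk_def rl.simps)
      then show ?thesis unfolding sz_def using card_mono[of "{u}"] by fastforce
    qed
    then have "thf n j L (\<lambda>_. {}) = avg n (\<lambda>_. 0)"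
      unfolding thf_def by (intro avg_cong) (simp add: not_le le_imp_less_Suc numeral_2_eq_2)
    then show ?thesis using n by (simp add: Ef_0[OF D])
  qed
  moreover have "?C * x \<le> ?C * X" using x by (intro mult_left_mono) auto
  ultimately show ?thesis by simp
qed

section \<open>Comparison of the drifts of two copies\<close>

lemma abs_prod_diff_le:
  fixes a b a' b' :: real
  assumes "0 \<le> b" "b \<le> 1" "0 \<le> a'" "a' \<le> 1"
  shows "\<bar>a * b - a' * b'\<bar> \<le> \<bar>a - a'\<bar> + \<bar>b - b'\<bar>"
proof -
  have "a * b - a' * b' = (a - a') * b + a' * (b - b')" by (simp add: algebra_simps)
  also have "\<bar>\<dots>\<bar> \<le> \<bar>a - a'\<bar> * b + a' * \<bar>b - b'\<bar>"
    using assms by (intro order_trans[OF abs_triangle_ineq]) (simp add: abs_mult)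
  also have "\<dots> \<le> \<bar>a - a'\<bar> * 1 + 1 * \<bar>b - b'\<bar>"
    using assms by (intro add_mono mult_left_mono mult_right_mono) auto
  finally show ?thesis by simp
qed

text \<open>Collects, for both copies, the deviations of the true drift from one and the same
  polynomial in the proportions of small blocks.\<close>

definition cerr :: "nat \<Rightarrow> nat \<Rightarrow> nat \<Rightarrow> nat \<Rightarrow> nat \<Rightarrow> state \<Rightarrow> state \<Rightarrow> real" where
  "cerr n m j L M S T = M * (thf n j L S + thf m j L T) + (eta n j L S + eta m j L T)
    + (real L + real M) * (1 / n + 1 / m)"

lemma eta_nonneg: "0 \<le> eta n j L S"
  unfolding eta_def by (intro avg2_nonneg) (auto simp: rls_def)

lemma cerr_nonneg: "0 \<le> cerr n m j L M S T"
  unfolding cerr_def using eta_nonneg[of n j L S] eta_nonneg[of m j L T] thf_bounds(1)[of n j L S] thf_bounds(1)[of m j L T]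
  by (intro add_nonneg_nonneg mult_nonneg_nonneg) auto

text \<open>The limiting right-hand side \<open>P\<close> is a quadratic polynomial in quantities
  between 0 and 1, hence Lipschitz. The level below enters through \<open>bigf\<close>, and it does
  so twice: in the loss term, and at size 1 through the vertices outside the large blocks. This is
  the factor 2 in front of the second sum.\<close>

lemma drift_lipschitz:
  assumes S: "good n S" and T: "good m T" and n: "n \<ge> 1" "m \<ge> 1" and l: "l < M"
  shows "\<bar>Lg n (cf n (Suc j) l) S - Lg m (cf m (Suc j) l) T\<bar> \<le>
    M * ((\<Sum>i<M. \<bar>cf n (Suc j) i S - cf m (Suc j) i T\<bar>) + 2 * (\<Sum>i<L. \<bar>cf n j i S - cf m j i T\<bar>)
      + cerr n m j L M S T)"
proof -
  define d where "d i = df n j L i S" for i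
  define d' where "d' i = df m j L i T" for i
  define \<beta> where "\<beta> = bigf n j L S"
  define \<beta>' where "\<beta>' = bigf m j L T"
  define P where "P d \<beta> = real l / 2 * ((\<Sum>i\<in>{1..<l}. d i * d (l - i)) - 2 * d l * \<beta>)" for d :: "nat \<Rightarrow> real" and \<beta>
  define A where "A = (\<Sum>i<M. \<bar>cf n (Suc j) i S - cf m (Suc j) i T\<bar>)"
  define B where "B = (\<Sum>i<L. \<bar>cf n j i S - cf m j i T\<bar>)"
  define e where "e i = \<bar>d i - d' i\<bar>" for i
  have d01: "0 \<le> d i" "d i \<le> 1" "0 \<le> d' i" "d' i \<le> 1" for i unfolding d_def d'_def by (rule df_bounds)+
  have \<beta>01: "0 \<le> \<beta>" "\<beta> \<le> 1" "0 \<le> \<beta>'" "\<beta>' \<le> 1" unfolding \<beta>_def \<beta>'_def by (rule bigf_bounds)+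
  have "\<beta> - \<beta>' = - (\<Sum>i<L. cf n j i S - cf m j i T)"
    unfolding \<beta>_def \<beta>'_def bigf_cf[OF n(1)] bigf_cf[OF n(2)] by (simp add: sum_subtractf)
  then have \<beta>B: "\<bar>\<beta> - \<beta>'\<bar> \<le> B" unfolding B_def by (simp add: sum_abs)
  let ?\<theta> = "thf n j L S + thf m j L T"
  have \<theta>0: "0 \<le> ?\<theta>" using thf_bounds by (simp add: add_nonneg_nonneg)
  have ei: "e i \<le> \<bar>cf n (Suc j) i S - cf m (Suc j) i T\<bar> + of_bool (i = 1) * B + ?\<theta>" for i
  proof (cases "i = 1")
    case True
    then show ?thesis
      using df_cf[OF n(1), of j L i S] df_cf[OF n(2), of j L i T] \<beta>B
      unfolding e_def d_def[symmetric] d'_def[symmetric] \<beta>_def[symmetric] \<beta>'_def[symmetric] by simp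
  next
    case False
    then show ?thesis
      using df_cf[OF n(1), of j L i S] df_cf[OF n(2), of j L i T]
      unfolding e_def d_def[symmetric] d'_def[symmetric] \<beta>_def[symmetric] \<beta>'_def[symmetric] by simp
  qed
  have sume: "(\<Sum>i\<in>{1..l}. e i) \<le> A + B + M * ?\<theta>"
  proof -
    have "(\<Sum>i\<in>{1..l}. e i) \<le> (\<Sum>i\<in>{1..l}. \<bar>cf n (Suc j) i S - cf m (Suc j) i T\<bar> + of_bool (i = 1) * B + ?\<theta>)"
      by (rule sum_mono) (rule ei)
    also have "\<dots> = (\<Sum>i\<in>{1..l}. \<bar>cf n (Suc j) i S - cf m (Suc j) i T\<bar>) + (\<Sum>i\<in>{1..l}. of_bool (i = 1)) * B + l * ?\<theta>"
      by (simp only: sum.distrib sum_distrib_right sum_constant) (simp add: algebra_simps)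
    also have "(\<Sum>i\<in>{1..l}. \<bar>cf n (Suc j) i S - cf m (Suc j) i T\<bar>) \<le> A"
      unfolding A_def using l by (intro sum_mono2) auto
    also have "(\<Sum>i\<in>{1..l}. of_bool (i = 1)) * B \<le> 1 * B"
    proof (rule mult_right_mono)
      have "(\<Sum>i\<in>{1..l}. of_bool (i = 1) :: real) = (\<Sum>i\<in>{1..l}. if i = 1 then 1 else 0)" by (intro sum.cong) auto
      also have "\<dots> \<le> 1" by (subst sum.delta) auto
      finally show "(\<Sum>i\<in>{1..l}. of_bool (i = 1) :: real) \<le> 1" .
    qed (simp add: B_def sum_nonneg)
    also have "l * ?\<theta> \<le> M * ?\<theta>" using l \<theta>0 by (intro mult_right_mono) auto
    finally show ?thesis by simp
  qed
  have "\<bar>P d \<beta> - P d' \<beta>'\<bar> = real l / 2 * \<bar>(\<Sum>i\<in>{1..<l}. d i * d (l - i) - d' i * d' (l - i)) - 2 * (d l * \<beta> - d' l * \<beta>')\<bar>"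
    unfolding P_def right_diff_distrib[symmetric] abs_mult by (simp add: sum_subtractf algebra_simps)
  also have "\<dots> \<le> real l / 2 * ((\<Sum>i\<in>{1..<l}. e i + e (l - i)) + 2 * (e l + \<bar>\<beta> - \<beta>'\<bar>))"
  proof (rule mult_left_mono)
    have p1: "\<bar>\<Sum>i\<in>{1..<l}. d i * d (l - i) - d' i * d' (l - i)\<bar> \<le> (\<Sum>i\<in>{1..<l}. e i + e (l - i))"
      unfolding e_def by (rule order_trans[OF sum_abs]) (intro sum_mono abs_prod_diff_le d01)
    have p2: "\<bar>d l * \<beta> - d' l * \<beta>'\<bar> \<le> e l + \<bar>\<beta> - \<beta>'\<bar>"
      unfolding e_def by (intro abs_prod_diff_le d01 \<beta>01)
    have p3: "\<bar>p - 2 * q\<bar> \<le> P + 2 * Q" if "\<bar>p\<bar> \<le> P" "\<bar>q\<bar> \<le> Q" for p q P Q :: real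
      using that by linarith
    show "\<bar>(\<Sum>i\<in>{1..<l}. d i * d (l - i) - d' i * d' (l - i)) - 2 * (d l * \<beta> - d' l * \<beta>')\<bar>
      \<le> (\<Sum>i\<in>{1..<l}. e i + e (l - i)) + 2 * (e l + \<bar>\<beta> - \<beta>'\<bar>)" by (rule p3[OF p1 p2])
  qed simp
  also have "(\<Sum>i\<in>{1..<l}. e i + e (l - i)) = 2 * (\<Sum>i\<in>{1..<l}. e i)"
  proof -
    have "(\<Sum>i\<in>{1..<l}. e (l - i)) = (\<Sum>i\<in>{1..<l}. e i)"
      by (rule sum.reindex_bij_witness[of _ "\<lambda>i. l - i" "\<lambda>i. l - i"]) auto
    then show ?thesis by (simp add: sum.distrib)
  qed
  also have "real l / 2 * (2 * (\<Sum>i\<in>{1..<l}. e i) + 2 * (e l + \<bar>\<beta> - \<beta>'\<bar>)) = real l * (((\<Sum>i\<in>{1..<l}. e i) + e l) + \<bar>\<beta> - \<beta>'\<bar>)"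
    by (simp add: algebra_simps)
  also have "\<dots> \<le> real M * ((A + B + M * ?\<theta>) + B)"
  proof (rule mult_mono)
    \<comment> \<open>For \<open>l = 0\<close> the term \<open>e 0\<close> falls outside the range
      \<open>{1..l}\<close>; it vanishes because no vertex has a block of size 0.\<close>
    have "(\<Sum>i\<in>{1..<l}. e i) + e l \<le> (\<Sum>i\<in>{1..l}. e i) \<or> l = 0"
    proof (cases l)
      case (Suc k)
      have "(\<Sum>i\<in>{1..l}. e i) = (\<Sum>i\<in>{1..k}. e i) + e l" unfolding Suc by simp
      moreover have "{1..<l} = {1..k}" unfolding Suc by auto
      ultimately show ?thesis by simp
    qed simp
    moreover have "e 0 = 0"
    proof -
      have z: "of_bool (sz n S (Suc j) u = 0) = (0 :: real)" if "u < n" for n S u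
        using sz_pos[OF that, of S "Suc j"] by simp
      have "df n j L 0 S = 0" if "n \<ge> 1" for n S
      proof -
        have "df n j L 0 S = avg n (\<lambda>_. 0)"
          unfolding df_def by (rule avg_cong) (simp add: z)
        then show ?thesis using that by simp
      qed
      from this[OF n(1)] this[OF n(2)] show ?thesis by (simp add: e_def d_def d'_def)
    qed
    ultimately have "(\<Sum>i\<in>{1..<l}. e i) + e l \<le> (\<Sum>i\<in>{1..l}. e i)" by auto
    then show "(\<Sum>i\<in>{1..<l}. e i) + e l + \<bar>\<beta> - \<beta>'\<bar> \<le> (A + B + M * ?\<theta>) + B" using sume \<beta>B by linarith
  qed (use l in \<open>auto simp: e_def sum_nonneg\<close>)
  finally have PP: "\<bar>P d \<beta> - P d' \<beta>'\<bar> \<le> real M * (A + 2 * B + M * ?\<theta>)" by (simp add: algebra_simps)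
  have 1: "\<bar>Lg n (cf n (Suc j) l) S - P d \<beta>\<bar> \<le> M * (eta n j L S + (real L + real M) * (1 / n))"
  proof -
    have "\<bar>Lg n (cf n (Suc j) l) S - P d \<beta>\<bar> \<le> l * (eta n j L S + (real L + real l) / n)"
      using drift_cf[OF S n(1), of j l L] unfolding P_def d_def \<beta>_def by simp
    also have "\<dots> \<le> M * (eta n j L S + (real L + real M) * (1 / n))"
      using l eta_nonneg[of n j L S] by (intro mult_mono add_mono) (auto simp: divide_right_mono)
    finally show ?thesis .
  qed
  have 2: "\<bar>Lg m (cf m (Suc j) l) T - P d' \<beta>'\<bar> \<le> M * (eta m j L T + (real L + real M) * (1 / m))"
  proof -
    have "\<bar>Lg m (cf m (Suc j) l) T - P d' \<beta>'\<bar> \<le> l * (eta m j L T + (real L + real l) / m)"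
      using drift_cf[OF T n(2), of j l L] unfolding P_def d'_def \<beta>'_def by simp
    also have "\<dots> \<le> M * (eta m j L T + (real L + real M) * (1 / m))"
      using l eta_nonneg[of m j L T] by (intro mult_mono add_mono) (auto simp: divide_right_mono)
    finally show ?thesis .
  qed
  have "\<bar>Lg n (cf n (Suc j) l) S - Lg m (cf m (Suc j) l) T\<bar> \<le>
    real M * (A + 2 * B + M * ?\<theta>) + M * (eta n j L S + (real L + real M) * (1 / n))
     + M * (eta m j L T + (real L + real M) * (1 / m))"
    using PP 1 2 by linarith
  also have "\<dots> = M * (A + 2 * B + cerr n m j L M S T)"
    unfolding cerr_def by (simp add: algebra_simps)
  finally show ?thesis unfolding A_def B_def .
qed

text \<open>The mixed term \<open>2 * A * B\<close> is split into squares, and Cauchy-Schwarz passes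
  from sums of absolute differences to sums of squares at the price of the numbers \<open>M\<close>
  and \<open>L\<close> of summands. The error is multiplied by \<open>A \<le> M\<close>.\<close>

lemma drift_product:
  assumes S: "good n S" and T: "good m T" and n: "n \<ge> 1" "m \<ge> 1"
  shows "(\<Sum>l<M. 2 * (cf n (Suc j) l S - cf m (Suc j) l T) * (Lg n (cf n (Suc j) l) S - Lg m (cf m (Suc j) l) T))
    \<le> 4 * (real M)\<^sup>2 * (\<Sum>l<M. (cf n (Suc j) l S - cf m (Suc j) l T)\<^sup>2)
      + 2 * real M * real L * (\<Sum>i<L. (cf n j i S - cf m j i T)\<^sup>2) + 2 * (real M)\<^sup>2 * cerr n m j L M S T"
proof -
  define a where "a l = \<bar>cf n (Suc j) l S - cf m (Suc j) l T\<bar>" for l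
  define b where "b i = \<bar>cf n j i S - cf m j i T\<bar>" for i
  define A where "A = (\<Sum>l<M. a l)"
  define B where "B = (\<Sum>i<L. b i)"
  define E where "E = cerr n m j L M S T"
  have E0: "0 \<le> E" unfolding E_def by (rule cerr_nonneg)
  have a1: "a l \<le> 1" for l
    unfolding a_def using cf_bounds[of n "Suc j" l S] cf_bounds[of m "Suc j" l T] by linarith
  have A0: "0 \<le> A" "A \<le> M"
    using sum_bounded_above[of "{..<M}" a 1] a1 by (auto simp: A_def sum_nonneg a_def)
  have "(\<Sum>l<M. 2 * (cf n (Suc j) l S - cf m (Suc j) l T) * (Lg n (cf n (Suc j) l) S - Lg m (cf m (Suc j) l) T))
      \<le> (\<Sum>l<M. 2 * a l * (M * (A + 2 * B + E)))"
  proof (rule sum_mono)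
    fix l assume "l \<in> {..<M}"
    then have "\<bar>Lg n (cf n (Suc j) l) S - Lg m (cf m (Suc j) l) T\<bar> \<le> M * (A + 2 * B + E)"
      using drift_lipschitz[OF S T n, of l M j L] unfolding A_def B_def E_def a_def b_def by simp
    then have "a l * \<bar>Lg n (cf n (Suc j) l) S - Lg m (cf m (Suc j) l) T\<bar> \<le> a l * (M * (A + 2 * B + E))"
      by (intro mult_left_mono) (auto simp: a_def)
    moreover have "(cf n (Suc j) l S - cf m (Suc j) l T) * (Lg n (cf n (Suc j) l) S - Lg m (cf m (Suc j) l) T)
      \<le> a l * \<bar>Lg n (cf n (Suc j) l) S - Lg m (cf m (Suc j) l) T\<bar>"
      unfolding a_def abs_mult[symmetric] by (rule abs_ge_self)
    ultimately have "(cf n (Suc j) l S - cf m (Suc j) l T) * (Lg n (cf n (Suc j) l) S - Lg m (cf m (Suc j) l) T)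
      \<le> a l * (M * (A + 2 * B + E))" by linarith
    from mult_left_mono[OF this zero_le_numeral[of "num.Bit0 num.One"]]
    show "2 * (cf n (Suc j) l S - cf m (Suc j) l T) * (Lg n (cf n (Suc j) l) S - Lg m (cf m (Suc j) l) T)
      \<le> 2 * a l * (M * (A + 2 * B + E))" by (simp only: mult.assoc)
  qed
  also have "\<dots> = 2 * M * (A * A) + 2 * M * (2 * A * B) + 2 * M * (A * E)"
  proof -
    have "(\<Sum>l<M. 2 * a l * (M * (A + 2 * B + E))) = 2 * A * (M * (A + 2 * B + E))"
      unfolding A_def by (simp only: sum_distrib_right sum_distrib_left)
    then show ?thesis by (simp add: algebra_simps)
  qed
  also have "\<dots> \<le> 2 * M * (A * A) + 2 * M * (A\<^sup>2 + B\<^sup>2) + 2 * M * (M * E)"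
  proof (intro add_mono mult_left_mono)
    show "2 * A * B \<le> A\<^sup>2 + B\<^sup>2" using sum_squares_bound[of A B] by simp
  qed (use A0 E0 in \<open>auto intro: mult_right_mono\<close>)
  also have "\<dots> = 4 * M * A\<^sup>2 + 2 * M * B\<^sup>2 + 2 * (real M)\<^sup>2 * E" by (simp add: power2_eq_square algebra_simps)
  also have "\<dots> \<le> 4 * M * ((\<Sum>l<M. (a l)\<^sup>2) * M) + 2 * M * ((\<Sum>i<L. (b i)\<^sup>2) * L) + 2 * (real M)\<^sup>2 * E"
    using sum_squared_le_sum_of_squares[of a "{..<M}"] sum_squared_le_sum_of_squares[of b "{..<L}"]
    by (intro add_mono mult_left_mono) (auto simp: A_def B_def)
  finally show ?thesis unfolding a_def b_def E_def by (simp add: power2_eq_square algebra_simps)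
qed

text \<open>The three contributions are the initial value of the \<open>capf\<close> in the Gronwall
  functional, the input from the level below, and the errors due to finite \<open>n\<close> and
  \<open>m\<close>. The first does not vanish as \<open>n\<close> grows; it is made small through
  \<open>L\<close>.\<close>

lemma DD_step:
  assumes D: "cost_dist D" "cost_dist D'" and n: "n \<ge> 1" "m \<ge> 1" and X: "X \<le> n / 2" "X \<le> m / 2"
    and L: "L \<ge> 1" and x: "x \<in> {0..X}"
    and \<Delta>: "\<And>x i. x \<in> {0..X} \<Longrightarrow> i < L \<Longrightarrow> DD n D m D' j i x \<le> \<Delta>" "0 \<le> \<Delta>"
    and C: "C = (\<Sum>l<M. 4 * (real l)\<^sup>2 + 24 * real l * X)
      + 2 * (real M)\<^sup>2 * (M * ((2 * (real L)\<^sup>2 + 6 * real L * X) * X) + (real L + real M) + 6 * j * X)"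
    and l: "l < M"
  shows "DD n D m D' (Suc j) l x \<le>
    (8 * (real M)\<^sup>2 * j / L + (2 * real M * (real L)\<^sup>2 * \<Delta> + C * (1 / n + 1 / m)) * X) * exp (4 * (real M)\<^sup>2 * X)"
proof -
  define K where "K = 4 * (real M)\<^sup>2"
  define \<epsilon> where "\<epsilon> = 2 * real M * (real L)\<^sup>2 * \<Delta> + C * (1 / n + 1 / m)"
  define F where "F i = Ef n D (capf n L i)" for i
  define F' where "F' i = Ef m D' (capf m L i)" for i
  \<comment> \<open>In \<open>drift_product\<close>, \<open>eta\<close> enters with the coefficient
    \<open>2 * (real M)\<^sup>2\<close>, and it is at most minus twice the drift of the
    \<open>capf\<close>. With the weight \<open>K = 4 * (real M)\<^sup>2\<close> the derivative of
    the second sum cancels this contribution; the same number is the Gronwall constant of the first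
    sum.\<close>
  define Y where "Y x = (\<Sum>l<M. DD n D m D' (Suc j) l x) + K * (\<Sum>i\<in>{1..j}. F i x + F' i x)" for x
  have X0: "0 \<le> X" using x by simp
  have K0: "0 \<le> K" by (simp add: K_def)
  have C0: "0 \<le> C" unfolding C using X0 by (auto intro!: add_nonneg_nonneg sum_nonneg mult_nonneg_nonneg)
  then have \<epsilon>0: "0 \<le> \<epsilon>" unfolding \<epsilon>_def using \<Delta>(2) by (auto intro!: add_nonneg_nonneg mult_nonneg_nonneg)
  have F01: "0 \<le> F i x" "F i x \<le> 1 / L" "0 \<le> F' i x" "F' i x \<le> 1 / L" for i x
    using Ef_mono[OF D(1), of "\<lambda>_. 0" n x "capf n L i"] Ef_mono[OF D(1), of "capf n L i" n x "\<lambda>_. 1 / L"]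
      Ef_mono[OF D(2), of "\<lambda>_. 0" m x "capf m L i"] Ef_mono[OF D(2), of "capf m L i" m x "\<lambda>_. 1 / L"]
      capf_bounds[OF L]
    by (simp_all add: Ef_const[OF D(1)] Ef_const[OF D(2)] F_def F'_def)
  have DD0: "0 \<le> DD n D m D' k i x" for k i x
    using EE_mono[OF D, of n m "\<lambda>_ _. 0" "\<lambda>S T. (cf n k i S - cf m k i T)\<^sup>2" x]
    by (simp add: EE_const[OF D] DD_def)
  have Fder: "\<exists>h. (Ef n D (capf n L i) has_real_derivative h) (at y within {0..X}) \<and> - 2 * Ef n D (Lg n (capf n L i)) y \<le> - 2 * h + 6 * X / n"
    if D: "cost_dist D" and n: "n \<ge> 1" and X: "X \<le> n / 2" and y: "y \<in> {0..X}" for n D i y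
  proof -
    have y': "y \<in> {0..real n / 2}" and sub: "{0..X} \<subseteq> {0..real n / 2}" using y X by auto
    have 1: "\<bar>capf n L i S\<bar> \<le> 1 / L" for S using capf_bounds[OF L, of n i S] by simp
    have "0 \<le> 1 / real n" by simp
    from Ef_generator[OF D 1 n y' capf_ad_bound[OF L] this]
    obtain h where h: "(Ef n D (capf n L i) has_real_derivative h) (at y within {0..n/2})"
      "\<bar>h - Ef n D (Lg n (capf n L i)) y\<bar> \<le> 3 * (1 / n) * y" by blast
    have "3 * (1 / n) * y \<le> 3 * X / n" using y by (simp add: divide_right_mono)
    with h(2) have "- 2 * Ef n D (Lg n (capf n L i)) y \<le> - 2 * h + 6 * X / n" by linarith
    then show ?thesis using DERIV_subset[OF h(1) sub] by blast
  qed
  have "Y x \<le> (Y 0 + \<epsilon> * X) * exp (K * X)"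
  proof (rule gronwall[OF K0 \<epsilon>0 x])
    show "0 \<le> Y 0" unfolding Y_def using DD0 F01 K0 by (auto intro!: add_nonneg_nonneg sum_nonneg mult_nonneg_nonneg)
    fix y assume y: "y \<in> {0..X}"
    have "\<forall>l\<in>{..<M}. \<exists>h. (DD n D m D' (Suc j) l has_real_derivative h) (at y within {0..X}) \<and>
      h \<le> EE n D m D' (\<lambda>S T. 2 * (cf n (Suc j) l S - cf m (Suc j) l T) * (Lg n (cf n (Suc j) l) S - Lg m (cf m (Suc j) l) T)) y
      + (4 * (real l)\<^sup>2 + 24 * real l * X) * (1 / n + 1 / m)"
      using DD_derivative[OF D n X y] by blast
    then obtain h where h: "\<And>l. l < M \<Longrightarrow> (DD n D m D' (Suc j) l has_real_derivative h l) (at y within {0..X})"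
      "\<And>l. l < M \<Longrightarrow> h l \<le> EE n D m D' (\<lambda>S T. 2 * (cf n (Suc j) l S - cf m (Suc j) l T) * (Lg n (cf n (Suc j) l) S - Lg m (cf m (Suc j) l) T)) y
      + (4 * (real l)\<^sup>2 + 24 * real l * X) * (1 / n + 1 / m)"
      unfolding bchoice_iff by auto
    obtain g where g: "\<And>i. (F i has_real_derivative g i) (at y within {0..X})"
      "\<And>i. - 2 * Ef n D (Lg n (capf n L i)) y \<le> - 2 * g i + 6 * X / n"
      using Fder[OF D(1) n(1) X(1) y] unfolding F_def by metis
    obtain g' where g': "\<And>i. (F' i has_real_derivative g' i) (at y within {0..X})"
      "\<And>i. - 2 * Ef m D' (Lg m (capf m L i)) y \<le> - 2 * g' i + 6 * X / m"
      using Fder[OF D(2) n(2) X(2) y] unfolding F'_def by metis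
    let ?h = "(\<Sum>l<M. h l) + K * (\<Sum>i\<in>{1..j}. g i + g' i)"
    have der: "(Y has_real_derivative ?h) (at y within {0..X})"
      unfolding Y_def by (intro DERIV_add DERIV_cmult DERIV_sum h g g') auto
    let ?A = "\<lambda>S T. \<Sum>l<M. (cf n (Suc j) l S - cf m (Suc j) l T)\<^sup>2"
    let ?B = "\<lambda>S T. \<Sum>i<L. (cf n j i S - cf m j i T)\<^sup>2"
    have "(\<Sum>l<M. EE n D m D' (\<lambda>S T. 2 * (cf n (Suc j) l S - cf m (Suc j) l T) * (Lg n (cf n (Suc j) l) S - Lg m (cf m (Suc j) l) T)) y)
       \<le> EE n D m D' (\<lambda>S T. K * ?A S T + 2 * real M * real L * ?B S T + 2 * (real M)\<^sup>2 * cerr n m j L M S T) y"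
      unfolding EE_sum[OF D, symmetric] K_def by (intro EE_mono[OF D] drift_product n)
    also have "\<dots> = K * (\<Sum>l<M. DD n D m D' (Suc j) l y) + 2 * real M * real L * (\<Sum>i<L. DD n D m D' j i y)
        + 2 * (real M)\<^sup>2 * EE n D m D' (cerr n m j L M) y"
      unfolding DD_def by (simp only: EE_add[OF D] EE_cmult[OF D] EE_sum[OF D])
    also have "(\<Sum>i<L. DD n D m D' j i y) \<le> L * \<Delta>"
      using sum_bounded_above[of "{..<L}" "\<lambda>i. DD n D m D' j i y" \<Delta>] \<Delta>(1)[OF y] by simp
    also have "EE n D m D' (cerr n m j L M) y \<le>
       (M * ((2 * (real L)\<^sup>2 + 6 * real L * X) * X) + (real L + real M) + 6 * j * X) * (1 / n + 1 / m) - 2 * (\<Sum>i\<in>{1..j}. g i + g' i)"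
    proof -
      have eta1: "Ef n D (eta n j L) y \<le> - 2 * (\<Sum>i\<in>{1..j}. g i) + j * (6 * X / n)"
      proof -
        have "Ef n D (eta n j L) y \<le> Ef n D (\<lambda>S. - 2 * (\<Sum>i\<in>{1..j}. Lg n (capf n L i) S)) y"
          by (intro Ef_mono[OF D(1)] eta_le L) simp
        also have "\<dots> = (\<Sum>i\<in>{1..j}. - 2 * Ef n D (Lg n (capf n L i)) y)"
          by (simp only: Ef_cmult[OF D(1)] Ef_sum[OF D(1)] sum_distrib_left)
        also have "\<dots> \<le> (\<Sum>i\<in>{1..j}. - 2 * g i + 6 * X / n)" by (intro sum_mono g)
        also have "\<dots> = - 2 * (\<Sum>i\<in>{1..j}. g i) + j * (6 * X / n)"
          by (simp add: sum.distrib sum_subtractf sum_distrib_left sum_negf)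
        finally show ?thesis .
      qed
      have eta2: "Ef m D' (eta m j L) y \<le> - 2 * (\<Sum>i\<in>{1..j}. g' i) + j * (6 * X / m)"
      proof -
        have "Ef m D' (eta m j L) y \<le> Ef m D' (\<lambda>S. - 2 * (\<Sum>i\<in>{1..j}. Lg m (capf m L i) S)) y"
          by (intro Ef_mono[OF D(2)] eta_le L) simp
        also have "\<dots> = (\<Sum>i\<in>{1..j}. - 2 * Ef m D' (Lg m (capf m L i)) y)"
          by (simp only: Ef_cmult[OF D(2)] Ef_sum[OF D(2)] sum_distrib_left)
        also have "\<dots> \<le> (\<Sum>i\<in>{1..j}. - 2 * g' i + 6 * X / m)" by (intro sum_mono g')
        also have "\<dots> = - 2 * (\<Sum>i\<in>{1..j}. g' i) + j * (6 * X / m)"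
          by (simp add: sum.distrib sum_subtractf sum_distrib_left sum_negf)
        finally show ?thesis .
      qed
      let ?q = "(2 * (real L)\<^sup>2 + 6 * real L * X) * X"
      have "EE n D m D' (cerr n m j L M) y =
          M * (Ef n D (thf n j L) y + Ef m D' (thf m j L) y) + (Ef n D (eta n j L) y + Ef m D' (eta m j L) y)
          + (real L + real M) * (1 / n + 1 / m)"
        unfolding cerr_def
        by (simp only: EE_add[OF D] EE_cmult[OF D] EE_fst[OF D] EE_snd[OF D] EE_const[OF D] Ef_const[OF D(1)] Ef_const[OF D(2)])
      also have "\<dots> \<le> M * (?q / n + ?q / m) + ((- 2 * (\<Sum>i\<in>{1..j}. g i) + j * (6 * X / n)) + (- 2 * (\<Sum>i\<in>{1..j}. g' i) + j * (6 * X / m)))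
          + (real L + real M) * (1 / n + 1 / m)"
        by (intro add_mono mult_left_mono eta1 eta2 Ef_thf[OF D(1) n(1) X(1) y] Ef_thf[OF D(2) n(2) X(2) y]) auto
      also have "\<dots> = (M * ?q + (real L + real M) + 6 * j * X) * (1 / n + 1 / m) - 2 * (\<Sum>i\<in>{1..j}. g i + g' i)"
        by (simp add: sum.distrib algebra_simps add_divide_distrib)
      finally show ?thesis .
    qed
    finally have 1: "(\<Sum>l<M. EE n D m D' (\<lambda>S T. 2 * (cf n (Suc j) l S - cf m (Suc j) l T) * (Lg n (cf n (Suc j) l) S - Lg m (cf m (Suc j) l) T)) y)
       \<le> K * (\<Sum>l<M. DD n D m D' (Suc j) l y) + 2 * real M * real L * (L * \<Delta>)
        + 2 * (real M)\<^sup>2 * ((M * ((2 * (real L)\<^sup>2 + 6 * real L * X) * X) + (real L + real M) + 6 * j * X) * (1 / n + 1 / m) - 2 * (\<Sum>i\<in>{1..j}. g i + g' i))"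
      by (simp add: mult_left_mono)
    have "(\<Sum>l<M. h l) \<le> (\<Sum>l<M. EE n D m D' (\<lambda>S T. 2 * (cf n (Suc j) l S - cf m (Suc j) l T) * (Lg n (cf n (Suc j) l) S - Lg m (cf m (Suc j) l) T)) y)
       + (\<Sum>l<M. 4 * (real l)\<^sup>2 + 24 * real l * X) * (1 / n + 1 / m)"
      unfolding sum_distrib_right sum.distrib[symmetric] by (intro sum_mono h) simp
    with 1 have "?h \<le> K * (\<Sum>l<M. DD n D m D' (Suc j) l y) + \<epsilon>"
      unfolding \<epsilon>_def C K_def by (simp add: algebra_simps power2_eq_square)
    also have "\<dots> \<le> K * Y y + \<epsilon>"
      unfolding Y_def using K0 F01 by (intro add_right_mono mult_left_mono) (auto intro!: mult_nonneg_nonneg sum_nonneg)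
    finally show "\<exists>h. (Y has_real_derivative h) (at y within {0..X}) \<and> h \<le> K * Y y + \<epsilon>"
      using der by blast
  qed
  moreover have "DD n D m D' (Suc j) l x \<le> Y x"
  proof -
    have "DD n D m D' (Suc j) l x \<le> (\<Sum>l<M. DD n D m D' (Suc j) l x)"
      by (rule member_le_sum) (use l DD0 in auto)
    also have "\<dots> \<le> Y x" unfolding Y_def using K0 F01 by (auto intro!: mult_nonneg_nonneg sum_nonneg)
    finally show ?thesis .
  qed
  moreover have "Y 0 \<le> 8 * (real M)\<^sup>2 * j / L"
  proof -
    have "sz n (\<lambda>_. {}) (Suc j) u = 1" if "u < n" for n u
    proof -
      have "cn {} = Id" by (simp add: cn_def adj_def)
      then have "blk n (\<lambda>_. {}) (Suc j) u = {u}" using that by (auto simp: blk_def rl.simps)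
      then show ?thesis by (simp add: sz_def)
    qed
    then have "cf n (Suc j) l (\<lambda>_. {}) = avg n (\<lambda>_. of_bool (1 = l))" for n l
      unfolding cf_def stat_def by (intro avg_cong) simp
    then have "cf n (Suc j) l (\<lambda>_. {}) = cf m (Suc j) l (\<lambda>_. {})" for l using n by simp
    then have "DD n D m D' (Suc j) l 0 = 0" for l
      by (simp add: DD_def EE_def Ef_0[OF D(1)] Ef_0[OF D(2)])
    then have "Y 0 = K * (\<Sum>i\<in>{1..j}. F i 0 + F' i 0)" by (simp add: Y_def)
    also have "\<dots> \<le> K * (\<Sum>i\<in>{1..j}. 1 / L + 1 / L)"
      using K0 by (intro mult_left_mono sum_mono add_mono F01)
    finally show ?thesis by (simp add: K_def)
  qed
  ultimately have "DD n D m D' (Suc j) l x \<le> (Y 0 + \<epsilon> * X) * exp (K * X)" "(Y 0 + \<epsilon> * X) * exp (K * X) \<le> (8 * (real M)\<^sup>2 * j / L + \<epsilon> * X) * exp (K * X)"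
    by auto
  then show ?thesis unfolding \<epsilon>_def K_def by linarith
qed

text \<open>Induction over the level with size, horizon and accuracy left free, since level
  \<open>k + 1\<close> at size \<open>l\<close> calls for level \<open>k\<close> at all sizes below
  a larger \<open>L\<close>. At level 0 the only block has size \<open>n\<close>, so fixed sizes
  have proportion 0 once \<open>n\<close> is larger.\<close>

lemma DD_tendsto_0:
  assumes "0 < \<epsilon>"
  shows "\<exists>N. \<forall>n\<ge>N. \<forall>m\<ge>N. \<forall>D D'. cost_dist D \<longrightarrow> cost_dist D' \<longrightarrow> (\<forall>x\<in>{0..X}. DD n D m D' k l x \<le> \<epsilon>)"
  using assms
proof (induction k arbitrary: l X \<epsilon>)
  case 0
  show ?case
  proof (intro exI allI impI ballI)
    fix n m D D' x assume n: "n \<ge> Suc l" and m: "m \<ge> Suc l" and D: "cost_dist D" "cost_dist D'"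
    have "cf n 0 l S = 0" if "n \<ge> Suc l" for n S
      using that by (simp add: cf_def stat_def)
    then have "DD n D m D' 0 l x = EE n D m D' (\<lambda>_ _. 0) x" using n m by (simp add: DD_def)
    then show "DD n D m D' 0 l x \<le> \<epsilon>" using 0 by (simp add: EE_const[OF D])
  qed
next
  case (Suc k)
  show ?case
  proof (cases "0 \<le> X")
    case True
    define M where "M = Suc l"
    define E where "E = exp (4 * (real M)\<^sup>2 * X)"
    have E: "1 \<le> E" using True by (simp add: E_def)
    \<comment> \<open>Each of the three terms of \<open>DD_step\<close> gets a share
      \<open>\<epsilon> / 3\<close>. \<open>L\<close> must come first, with
      \<open>24 = 3 * 8\<close>; then \<open>\<Delta>\<close>, whose coefficient
      \<open>q / 3\<close> depends on \<open>L\<close>; and \<open>N'\<close> last, since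
      \<open>C\<close> depends on \<open>L\<close> as well.\<close>
    obtain L0 :: nat where L0: "24 * (real M)\<^sup>2 * k * E / \<epsilon> \<le> L0" using real_arch_simple by blast
    define L where "L = Suc L0"
    have L: "24 * (real M)\<^sup>2 * k * E / \<epsilon> \<le> L" "1 \<le> L" using L0 by (auto simp: L_def)
    define q where "q = 6 * real M * (real L)\<^sup>2 * X * E"
    have q: "0 \<le> q" using True E by (simp add: q_def)
    define \<Delta> where "\<Delta> = \<epsilon> / (q + 1)"
    have \<Delta>: "0 < \<Delta>" using Suc.prems q by (simp add: \<Delta>_def)
    have "\<forall>i. \<exists>N. \<forall>n\<ge>N. \<forall>m\<ge>N. \<forall>D D'. cost_dist D \<longrightarrow> cost_dist D' \<longrightarrow> (\<forall>x\<in>{0..X}. DD n D m D' k i x \<le> \<Delta>)"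
      using Suc.IH[OF \<Delta>] by blast
    then obtain N where N: "\<And>i n m D D' x. N i \<le> n \<Longrightarrow> N i \<le> m \<Longrightarrow> cost_dist D \<Longrightarrow> cost_dist D' \<Longrightarrow> x \<in> {0..X} \<Longrightarrow> DD n D m D' k i x \<le> \<Delta>"
      by metis
    define C where "C = (\<Sum>l<M. 4 * (real l)\<^sup>2 + 24 * real l * X)
      + 2 * (real M)\<^sup>2 * (M * ((2 * (real L)\<^sup>2 + 6 * real L * X) * X) + (real L + real M) + 6 * real k * X)"
    have C: "0 \<le> C" unfolding C_def using True by (auto intro!: add_nonneg_nonneg sum_nonneg mult_nonneg_nonneg)
    obtain N1 :: nat where N1: "6 * C * X * E / \<epsilon> \<le> N1" using real_arch_simple by blast
    obtain N2 :: nat where N2: "2 * X \<le> N2" using real_arch_simple by blast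
    define N' where "N' = Suc (max (Max (N ` {..<L})) (max N1 N2))"
    have N': "1 \<le> N'" "\<And>i. i < L \<Longrightarrow> N i \<le> N'" "N1 \<le> N'" "N2 \<le> N'"
    proof -
      show "N i \<le> N'" if "i < L" for i
      proof -
        have "N i \<le> Max (N ` {..<L})" using that by (intro Max_ge) auto
        then show ?thesis unfolding N'_def by simp
      qed
    qed (auto simp: N'_def)
    show ?thesis
    proof (intro exI[of _ N'] allI impI ballI)
      fix n m D D' x assume n: "n \<ge> N'" and m: "m \<ge> N'" and D: "cost_dist D" "cost_dist D'" and x: "x \<in> {0..X}"
      have n1: "1 \<le> n" "1 \<le> m" using n m N'(1) by auto
      have "DD n D m D' (Suc k) l x \<le>
        (8 * (real M)\<^sup>2 * k / L + (2 * real M * (real L)\<^sup>2 * \<Delta> + C * (1 / n + 1 / m)) * X) * E"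
        unfolding E_def
      proof (rule DD_step[OF D n1 _ _ L(2) x _ _ C_def])
        have "real N2 \<le> n" "real N2 \<le> m" using n m N'(4) by auto
        then show "X \<le> real n / 2" "X \<le> real m / 2" using N2 by auto
        show "DD n D m D' k i y \<le> \<Delta>" if "y \<in> {0..X}" "i < L" for y i
          using that n m N'(2)[of i] by (intro N D) auto
      qed (use \<Delta> in \<open>auto simp: M_def\<close>)
      also have "\<dots> = 8 * (real M)\<^sup>2 * k * E / L + 2 * real M * (real L)\<^sup>2 * X * E * \<Delta> + C * X * E * (1 / n + 1 / m)"
        by (simp add: algebra_simps)
      also have "\<dots> \<le> \<epsilon> / 3 + \<epsilon> / 3 + \<epsilon> / 3"
      proof (intro add_mono)
        have "24 * (real M)\<^sup>2 * k * E \<le> L * \<epsilon>" using L(1) Suc.prems by (simp add: divide_le_eq)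
        then show "8 * (real M)\<^sup>2 * k * E / L \<le> \<epsilon> / 3" using L(2) by (simp add: field_simps)
        have "q * \<epsilon> \<le> \<epsilon> * (q + 1)" using Suc.prems by (simp add: algebra_simps)
        then have "q * \<Delta> \<le> \<epsilon>" unfolding \<Delta>_def using q by (simp add: divide_le_eq)
        then show "2 * real M * (real L)\<^sup>2 * X * E * \<Delta> \<le> \<epsilon> / 3" by (simp add: q_def)
        have N1': "6 * C * X * E \<le> N' * \<epsilon>"
        proof -
          have "6 * C * X * E / \<epsilon> \<le> N'" using N1 N'(3) by linarith
          then show ?thesis using Suc.prems by (simp add: divide_le_eq)
        qed
        have "1 / n + 1 / m \<le> 1 / N' + 1 / N'"
          using n m N'(1) by (intro add_mono divide_left_mono) auto
        then have "C * X * E * (1 / n + 1 / m) \<le> C * X * E * (2 / N')"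
          using C True E by (intro mult_left_mono) auto
        also have "\<dots> \<le> \<epsilon> / 3" using N1' N'(1) by (simp add: field_simps)
        finally show "C * X * E * (1 / n + 1 / m) \<le> \<epsilon> / 3" .
      qed
      finally show "DD n D m D' (Suc k) l x \<le> \<epsilon>" by simp
    qed
  qed auto
qed

section \<open>Concentration of the component counts around a common limit\<close>

lemma kap_square_diff:
  assumes n: "n \<ge> 1" "m \<ge> 1" and L: "L \<ge> 1"
  shows "(kap n k S - kap m k T)\<^sup>2 \<le> 8 / (real L)\<^sup>2 + 2 * real L * (\<Sum>l<L. (cf n k l S - cf m k l T)\<^sup>2)"
proof -
  let ?s = "\<Sum>l<L. \<bar>cf n k l S - cf m k l T\<bar>"
  have "\<bar>(\<Sum>l\<in>{1..<L}. cf n k l S / l) - (\<Sum>l\<in>{1..<L}. cf m k l T / l)\<bar> \<le> (\<Sum>l\<in>{1..<L}. \<bar>cf n k l S - cf m k l T\<bar>)"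
    unfolding sum_subtractf[symmetric] diff_divide_distrib[symmetric]
  proof (rule order_trans[OF sum_abs sum_mono])
    fix l assume "l \<in> {1..<L}"
    then show "\<bar>(cf n k l S - cf m k l T) / real l\<bar> \<le> \<bar>cf n k l S - cf m k l T\<bar>"
      by (simp add: divide_le_eq mult_le_cancel_left1)
  qed
  also have "\<dots> \<le> ?s" by (intro sum_mono2) auto
  finally have "\<bar>kap n k S - kap m k T\<bar> \<le> 2 / L + ?s"
    using kap_cf[OF n(1) L, of k S] kap_cf[OF n(2) L, of k T] by linarith
  then have "\<bar>kap n k S - kap m k T\<bar>\<^sup>2 \<le> (2 / L + ?s)\<^sup>2" by (intro power_mono) auto
  also have "\<dots> \<le> 2 * (2 / L)\<^sup>2 + 2 * ?s\<^sup>2"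
    using sum_squares_bound[of "2 / L" ?s] by (simp add: power2_sum)
  also have "?s\<^sup>2 \<le> (\<Sum>l<L. \<bar>cf n k l S - cf m k l T\<bar>\<^sup>2) * L"
    using sum_squared_le_sum_of_squares[of "\<lambda>l. \<bar>cf n k l S - cf m k l T\<bar>" "{..<L}"] by simp
  finally show ?thesis by (simp add: power_divide mult_ac)
qed

lemma kap_pair_tendsto_0:
  assumes "0 < \<epsilon>"
  shows "\<exists>N\<ge>1. \<forall>n\<ge>N. \<forall>m\<ge>N. \<forall>D D'. cost_dist D \<longrightarrow> cost_dist D' \<longrightarrow> (\<forall>x\<in>{0..X}. EE n D m D' (\<lambda>S T. (kap n k S - kap m k T)\<^sup>2) x \<le> \<epsilon>)"
proof -
  obtain L0 :: nat where L0: "16 / \<epsilon> \<le> L0" using real_arch_simple by blast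
  define L where "L = Suc L0"
  have L: "16 / \<epsilon> \<le> L" "1 \<le> L" using L0 by (auto simp: L_def)
  have L8: "8 / (real L)\<^sup>2 \<le> \<epsilon> / 2"
  proof -
    have "16 \<le> L * \<epsilon>" using L(1) assms by (simp add: divide_le_eq)
    also have "\<dots> \<le> (real L * real L) * \<epsilon>" using L(2) assms by (intro mult_right_mono) auto
    finally show ?thesis using L(2) by (simp add: field_simps power2_eq_square)
  qed
  define \<Delta> where "\<Delta> = \<epsilon> / (4 * (real L)\<^sup>2)"
  have \<Delta>: "0 < \<Delta>" using assms L by (simp add: \<Delta>_def)
  have "\<forall>i. \<exists>N. \<forall>n\<ge>N. \<forall>m\<ge>N. \<forall>D D'. cost_dist D \<longrightarrow> cost_dist D' \<longrightarrow> (\<forall>x\<in>{0..X}. DD n D m D' k i x \<le> \<Delta>)"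
    using DD_tendsto_0[OF \<Delta>] by blast
  then obtain N where N: "\<And>i n m D D' x. N i \<le> n \<Longrightarrow> N i \<le> m \<Longrightarrow> cost_dist D \<Longrightarrow> cost_dist D' \<Longrightarrow> x \<in> {0..X} \<Longrightarrow> DD n D m D' k i x \<le> \<Delta>"
    by metis
  define N' where "N' = Suc (Max (N ` {..<L}))"
  have N': "1 \<le> N'" "\<And>i. i < L \<Longrightarrow> N i \<le> N'"
    unfolding N'_def by (auto intro!: le_SucI Max_ge)
  show ?thesis
  proof (intro exI[of _ N'] conjI allI impI ballI N'(1))
    fix n m D D' x assume n: "n \<ge> N'" and m: "m \<ge> N'" and D: "cost_dist D" "cost_dist D'" and x: "x \<in> {0..X}"
    have n1: "1 \<le> n" "1 \<le> m" using n m N'(1) by auto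
    have "EE n D m D' (\<lambda>S T. (kap n k S - kap m k T)\<^sup>2) x
      \<le> EE n D m D' (\<lambda>S T. 8 / (real L)\<^sup>2 + 2 * real L * (\<Sum>l<L. (cf n k l S - cf m k l T)\<^sup>2)) x"
      by (intro EE_mono[OF D] kap_square_diff n1 L)
    also have "\<dots> = 8 / (real L)\<^sup>2 + 2 * real L * (\<Sum>l<L. DD n D m D' k l x)"
      unfolding DD_def by (simp only: EE_add[OF D] EE_cmult[OF D] EE_sum[OF D] EE_const[OF D])
    also have "(\<Sum>l<L. DD n D m D' k l x) \<le> (\<Sum>l<L. \<Delta>)"
      using n m N'(2) by (intro sum_mono N D x) (auto intro: order_trans)
    also have "8 / (real L)\<^sup>2 + 2 * real L * (\<Sum>l<L. \<Delta>) \<le> \<epsilon> / 2 + \<epsilon> / 2"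
      using L8 L(2) by (intro add_mono) (auto simp: \<Delta>_def power2_eq_square)
    finally show "EE n D m D' (\<lambda>S T. (kap n k S - kap m k T)\<^sup>2) x \<le> \<epsilon>" by (simp add: mult_left_mono)
  qed
qed

text \<open>Jensen's inequality, read off the nonnegative mean square distance of two independent
  copies with the same law.\<close>

lemma Ef_square_ge:
  assumes D: "cost_dist D"
  shows "(Ef n D \<phi> x)\<^sup>2 \<le> Ef n D (\<lambda>S. (\<phi> S)\<^sup>2) x"
proof -
  have "0 \<le> EE n D n D (\<lambda>S T. (\<phi> S - \<phi> T)\<^sup>2) x"
    using EE_mono[OF D D, of n n "\<lambda>_ _. 0" "\<lambda>S T. (\<phi> S - \<phi> T)\<^sup>2" x] by (simp add: EE_const[OF D D])
  then show ?thesis by (simp add: EE_square[OF D D] power2_eq_square[of "Ef n D \<phi> x"])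
qed

text \<open>Replacing the second copy by its mean \<open>a m\<close> can only lower the mean square
  distance. Done once, this gives concentration near \<open>a m\<close>; done for both copies, it
  makes \<open>a\<close> a Cauchy sequence. The reference law \<open>D0\<close> merely supplies the
  numbers: \<open>N\<close> is chosen before \<open>D\<close>.\<close>

lemma kap_limit:
  assumes x: "0 \<le> x"
  shows "\<exists>\<kappa>. \<forall>\<epsilon>>0. \<exists>N. \<forall>n\<ge>N. \<forall>D. cost_dist D \<longrightarrow> Ef n D (\<lambda>S. (kap n k S - \<kappa>)\<^sup>2) x \<le> \<epsilon>"
proof (cases "\<exists>D0. cost_dist D0")
  case True
  then obtain D0 where D0: "cost_dist D0" by blast
  define a where "a m = Ef m D0 (kap m k) x" for m
  have ptw: "Ef n D (\<lambda>S. (kap n k S - a m)\<^sup>2) x \<le> EE n D m D0 (\<lambda>S T. (kap n k S - kap m k T)\<^sup>2) x"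
    if D: "cost_dist D" for n m D
  proof -
    have "Ef n D (\<lambda>S. (kap n k S - a m)\<^sup>2) x = Ef n D (\<lambda>S. (kap n k S)\<^sup>2 + (- 2 * a m) * kap n k S + (a m)\<^sup>2) x"
      by (simp add: power2_diff algebra_simps)
    also have "\<dots> = Ef n D (\<lambda>S. (kap n k S)\<^sup>2) x + (- 2 * a m) * Ef n D (kap n k) x + (a m)\<^sup>2"
      by (simp only: Ef_add[OF D] Ef_cmult[OF D] Ef_const[OF D])
    also have "\<dots> \<le> EE n D m D0 (\<lambda>S T. (kap n k S - kap m k T)\<^sup>2) x"
      using Ef_square_ge[OF D0, of m "kap m k" x] by (simp add: EE_square[OF D D0] a_def[symmetric])
    finally show ?thesis .
  qed
  have dist_a: "(a n - a m)\<^sup>2 \<le> EE n D0 m D0 (\<lambda>S T. (kap n k S - kap m k T)\<^sup>2) x" for n m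
    using Ef_square_ge[OF D0, of m "kap m k" x] Ef_square_ge[OF D0, of n "kap n k" x]
    by (simp add: EE_square[OF D0 D0] a_def[symmetric] power2_diff[of "a n" "a m"])
  have "Cauchy a"
  proof (rule metric_CauchyI)
    fix e :: real assume e: "0 < e"
    then have "0 < e\<^sup>2 / 2" by simp
    from kap_pair_tendsto_0[OF this, of x k] obtain N where N0: "\<forall>n\<ge>N. \<forall>m\<ge>N. \<forall>D D'. cost_dist D \<longrightarrow> cost_dist D' \<longrightarrow>
      (\<forall>x\<in>{0..x}. EE n D m D' (\<lambda>S T. (kap n k S - kap m k T)\<^sup>2) x \<le> e\<^sup>2 / 2)" by (elim exE conjE) (rule that)
    have N: "EE n D0 m D0 (\<lambda>S T. (kap n k S - kap m k T)\<^sup>2) x \<le> e\<^sup>2 / 2" if "n \<ge> N" "m \<ge> N" for n m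
      using N0[rule_format, OF that D0 D0, of x] x by simp
    have "dist (a n) (a m) < e" if "n \<ge> N" "m \<ge> N" for n m
    proof -
      have "(a n - a m)\<^sup>2 < e\<^sup>2" using dist_a[of n m] N[OF that] \<open>0 < e\<^sup>2 / 2\<close> by linarith
      then have "\<bar>a n - a m\<bar> < e" using e abs_le_square_iff[of e "a n - a m"] by linarith
      then show ?thesis by (simp add: dist_real_def)
    qed
    then show "\<exists>N. \<forall>m\<ge>N. \<forall>n\<ge>N. dist (a m) (a n) < e" by blast
  qed
  then obtain \<kappa> where lim: "a \<longlonglongrightarrow> \<kappa>" using real_Cauchy_convergent convergent_def by blast
  show ?thesis
  proof (intro exI[of _ \<kappa>] allI impI)
    fix \<epsilon> :: real assume "0 < \<epsilon>"
    from kap_pair_tendsto_0[OF this, of x k] obtain N where N0: "\<forall>n\<ge>N. \<forall>m\<ge>N. \<forall>D D'. cost_dist D \<longrightarrow> cost_dist D' \<longrightarrow>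
      (\<forall>x\<in>{0..x}. EE n D m D' (\<lambda>S T. (kap n k S - kap m k T)\<^sup>2) x \<le> \<epsilon>)" by (elim exE conjE) (rule that)
    have N: "EE n D m D0 (\<lambda>S T. (kap n k S - kap m k T)\<^sup>2) x \<le> \<epsilon>" if "n \<ge> N" "m \<ge> N" "cost_dist D" for n m D
      using N0[rule_format, OF that(1,2,3) D0, of x] x by simp
    show "\<exists>N. \<forall>n\<ge>N. \<forall>D. cost_dist D \<longrightarrow> Ef n D (\<lambda>S. (kap n k S - \<kappa>)\<^sup>2) x \<le> \<epsilon>"
    proof (intro exI[of _ N] allI impI)
      fix n D assume n: "N \<le> n" and D: "cost_dist D"
      \<comment> \<open>As a quadratic polynomial in \<open>y\<close> the expectation is continuous,
        so \<open>m\<close> can tend to infinity while \<open>n\<close> stays fixed.\<close>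
      have ex: "Ef n D (\<lambda>S. (kap n k S - y)\<^sup>2) x = Ef n D (\<lambda>S. (kap n k S)\<^sup>2) x + (- 2 * y) * Ef n D (kap n k) x + y\<^sup>2" for y
      proof -
        have "Ef n D (\<lambda>S. (kap n k S - y)\<^sup>2) x = Ef n D (\<lambda>S. (kap n k S)\<^sup>2 + (- 2 * y) * kap n k S + y\<^sup>2) x"
          by (simp add: power2_diff algebra_simps)
        then show ?thesis by (simp only: Ef_add[OF D] Ef_cmult[OF D] Ef_const[OF D])
      qed
      have "(\<lambda>m. Ef n D (\<lambda>S. (kap n k S - a m)\<^sup>2) x) \<longlonglongrightarrow> Ef n D (\<lambda>S. (kap n k S - \<kappa>)\<^sup>2) x"
        unfolding ex by (intro tendsto_intros lim)
      then show "Ef n D (\<lambda>S. (kap n k S - \<kappa>)\<^sup>2) x \<le> \<epsilon>"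
        by (rule LIMSEQ_le_const2) (intro exI[of _ N] allI impI order_trans[OF ptw[OF D] N[OF n _ D]])
    qed
  qed
qed blast

section \<open>Growth of the largest block\<close>

lemma rl_St_mono: "t \<le> t' \<Longrightarrow> rl (St n c t) k \<subseteq> rl (St n c t') k"
proof (cases k)
  case (Suc j)
  assume "t \<le> t'"
  then have "lev c {e \<in> Kedges n. c e \<le> t} j \<subseteq> lev c {e \<in> Kedges n. c e \<le> t'} j"
    unfolding lev_restrict by auto
  then show ?thesis unfolding Suc by (simp add: St_def rl.simps cn_mono)
qed simp

section \<open>Pairs of vertices that are not yet joined\<close>

definition unc :: "nat \<Rightarrow> nat \<Rightarrow> state \<Rightarrow> real" where
  "unc n k S = avg2 n (\<lambda>u v. 1 - rls S k u v)"

lemma sum_kap_ad: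
  assumes "e \<in> Kedges n"
  shows "(\<Sum>j<k. kap n (Suc j) (ad e S)) - (\<Sum>j<k. kap n (Suc j) S) = - (\<Sum>j<k. of_bool (acc S j e)) / n"
proof -
  have "(\<Sum>j<k. kap n (Suc j) (ad e S) - kap n (Suc j) S) = (\<Sum>j<k. - (of_bool (acc S j e) / n))"
    by (intro sum.cong refl) (simp add: kap_ad[OF assms])
  also have "\<dots> = - (\<Sum>j<k. of_bool (acc S j e)) / n"
    by (simp only: sum_negf sum_divide_distrib[symmetric] minus_divide_left[symmetric])
  finally show ?thesis by (simp only: sum_subtractf)
qed

text \<open>An edge between two vertices that are not joined at level \<open>k\<close> passes level
  0 but not level \<open>k\<close>, so one of the first \<open>k\<close> forests accepts it and
  loses a component.\<close>

lemma Lg_sum_kap: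
  assumes "good n S" "n \<ge> 1"
  shows "Lg n (\<lambda>S. \<Sum>j<k. kap n (Suc j) S) S \<le> - unc n k S / 2"
proof -
  have "(\<Sum>j<k. kap n (Suc j) (ad e S)) - (\<Sum>j<k. kap n (Suc j) S) \<le> - (1 - rls S k (fst e) (snd e)) / n"
    if e: "e \<in> Kedges n" for e
  proof -
    have le: "(1 - rls S k (fst e) (snd e)) \<le> (\<Sum>j<k. of_bool (acc S j e))"
    proof (cases "e \<in> rl S k")
      case True
      then show ?thesis by (auto simp: rls_def intro!: sum_nonneg)
    next
      case False
      have "\<exists>j<k. acc S j e"
      proof (rule ccontr)
        assume no: "\<not> (\<exists>j<k. acc S j e)"
        have "j \<le> k \<Longrightarrow> e \<in> rl S j" for j
          by (induction j) (use no in \<open>auto simp: acc_def\<close>)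
        then show False using False by blast
      qed
      then obtain j where j: "j < k" "acc S j e" by blast
      have "of_bool (acc S j e) \<le> (\<Sum>j<k. of_bool (acc S j e) :: real)"
        by (rule member_le_sum) (use j in auto)
      then show ?thesis using False j by (simp add: rls_def)
    qed
    show ?thesis
      unfolding sum_kap_ad[OF e] by (rule divide_right_mono) (use le in \<open>linarith, simp\<close>)
  qed
  then have "(\<Sum>e\<in>Kedges n. (\<Sum>j<k. kap n (Suc j) (ad e S)) - (\<Sum>j<k. kap n (Suc j) S))
      \<le> (\<Sum>e\<in>Kedges n. - (1 - rls S k (fst e) (snd e)) / n)" by (rule sum_mono)
  also have "\<dots> = - (\<Sum>(u, v)\<in>Kedges n. 1 - rls S k u v) / n"
    by (simp only: sum_negf sum_divide_distrib case_prod_unfold minus_divide_left[symmetric])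
  also have "(\<Sum>(u, v)\<in>Kedges n. 1 - rls S k u v) = real n * real n * unc n k S / 2"
    unfolding unc_def by (rule sum_Kedges) (auto simp: rls_def of_bool_def intro: rl_sym)
  finally have "(\<Sum>e\<in>Kedges n. (\<Sum>j<k. kap n (Suc j) (ad e S)) - (\<Sum>j<k. kap n (Suc j) S)) / n
      \<le> (- (real n * real n * unc n k S / 2) / n) / n"
    by (rule divide_right_mono) simp
  then show ?thesis unfolding Lg_def using assms(2) by simp
qed

text \<open>The integral of \<open>unc\<close> up to \<open>x\<close> is at most twice the total
  decrease of \<open>k\<close> component proportions, hence at most \<open>2 * k\<close> up to the
  generator error. Since \<open>unc\<close> decreases in time, its last value is at most its mean
  over time.\<close>

lemma Ef_unc:
  assumes D: "cost_dist D" and n: "n \<ge> 1" and x: "0 < x" "x \<le> n / 2"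
  shows "Ef n D (unc n k) x \<le> 2 * k / x + 6 * k * x / n"
proof -
  define ks where "ks S = (\<Sum>j<k. kap n (Suc j) S)" for S
  have ks: "0 \<le> ks S" "ks S \<le> k" for S
    unfolding ks_def using kap_bounds by (auto intro: sum_nonneg order_trans[OF sum_bounded_above[where K=1]])
  have ksad: "\<bar>ks (ad e S) - ks S\<bar> \<le> k / n" if "e \<in> Kedges n" for e S
  proof -
    have "ks (ad e S) - ks S = - (\<Sum>j<k. of_bool (acc S j e)) / n"
      unfolding ks_def by (rule sum_kap_ad[OF that])
    moreover have "0 \<le> (\<Sum>j<k. of_bool (acc S j e) :: real)" "(\<Sum>j<k. of_bool (acc S j e)) \<le> real k"
      using sum_bounded_above[of "{..<k}" "\<lambda>j. of_bool (acc S j e) :: real" 1] by (auto intro!: sum_nonneg)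
    ultimately show ?thesis by (simp add: divide_right_mono)
  qed
  let ?C = "- Ef n D (unc n k) x / 2 + 3 * k * x / n"
  have "Ef n D ks x - Ef n D ks 0 \<le> ?C * (x - 0)"
  proof (rule derivative_bound_within)
    fix y assume y: "y \<in> {0..x}"
    then have y': "y \<in> {0..real n / 2}" and sub: "{0..x} \<subseteq> {0..real n / 2}" using x by auto
    have 1: "\<bar>ks S\<bar> \<le> k" for S using ks[of S] by simp
    have "0 \<le> k / real n" by simp
    from Ef_generator[OF D 1 n y' ksad this]
    obtain h where h: "(Ef n D ks has_real_derivative h) (at y within {0..n/2})"
      "\<bar>h - Ef n D (Lg n ks) y\<bar> \<le> 3 * (k / n) * y" by blast
    have "Ef n D (Lg n ks) y \<le> Ef n D (\<lambda>S. (- 1 / 2) * unc n k S) y"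
      unfolding ks_def using Lg_sum_kap[OF _ n] by (intro Ef_mono[OF D]) simp
    also have "\<dots> = (- 1 / 2) * Ef n D (unc n k) y" by (rule Ef_cmult[OF D])
    also have "\<dots> \<le> (- 1 / 2) * Ef n D (unc n k) x"
    proof (rule mult_left_mono_neg)
      show "Ef n D (unc n k) x \<le> Ef n D (unc n k) y"
        unfolding Ef_def
      proof (rule integral_mono[OF integrable_St[OF D] integrable_St[OF D]])
        fix c
        have "rl (St n c (y / n)) k \<subseteq> rl (St n c (x / n)) k"
          using y by (intro rl_St_mono divide_right_mono) auto
        then show "unc n k (St n c (x / n)) \<le> unc n k (St n c (y / n))"
          unfolding unc_def rls_def by (intro avg2_mono) auto
      qed
    qed simp
    finally have "Ef n D (Lg n ks) y \<le> - Ef n D (unc n k) x / 2" by simp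
    moreover have "3 * (k / n) * y \<le> 3 * k * x / n" using y by (auto intro!: divide_right_mono mult_left_mono)
    ultimately have "h \<le> ?C" using h(2) by linarith
    then show "\<exists>h. (Ef n D ks has_real_derivative h) (at y within {0..x}) \<and> h \<le> ?C"
      using DERIV_subset[OF h(1) sub] by blast
  qed (use x in auto)
  moreover have "0 \<le> Ef n D ks x" "Ef n D ks 0 \<le> k"
    using Ef_mono[OF D, of "\<lambda>_. 0" n x ks] Ef_mono[OF D, of ks n 0 "\<lambda>_. real k"] ks by (simp_all add: Ef_const[OF D])
  ultimately have "0 \<le> k + ?C * x" by simp
  then have "Ef n D (unc n k) x * x \<le> 2 * k + 6 * k * x / n * x" by (simp add: algebra_simps)
  then have "Ef n D (unc n k) x \<le> (2 * k + 6 * k * x / n * x) / x" using x by (simp add: le_divide_eq)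
  then show ?thesis using x by (simp add: add_divide_distrib)
qed

section \<open>The complement of the largest block\<close>

definition mxf :: "nat \<Rightarrow> nat \<Rightarrow> state \<Rightarrow> real" where
  "mxf n k S = real n - real (Max (sz n S k ` {..<n}))"

definition dg :: "nat \<Rightarrow> nat \<Rightarrow> (nat \<times> nat \<Rightarrow> real) \<Rightarrow> real \<Rightarrow> nat" where
  "dg n u c t = card {e \<in> Kedges n. (fst e = u \<or> snd e = u) \<and> c e \<le> t}"

lemma sz_le_Max: "u < n \<Longrightarrow> sz n S k u \<le> Max (sz n S k ` {..<n})"
  by (rule Max_ge) auto

lemma Max_sz_witness:
  assumes "n \<ge> 1" obtains w where "w < n" "Max (sz n S k ` {..<n}) = sz n S k w"
proof -
  have "0 \<in> {..<n}" using assms by simp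
  then have "Max (sz n S k ` {..<n}) \<in> sz n S k ` {..<n}" by (intro Max_in) auto
  then show ?thesis using that by auto
qed

lemma mxf_nonneg: "n \<ge> 1 \<Longrightarrow> 0 \<le> mxf n k S"
  using Max_sz_witness[of n S k] sz_le[of n S k] unfolding mxf_def by (metis diff_ge_0_iff_ge of_nat_le_iff)

lemma mxf_mono:
  assumes "n \<ge> 1" "rl S i \<subseteq> rl T j" shows "mxf n j T \<le> mxf n i S"
proof -
  obtain w where w: "w < n" "Max (sz n S i ` {..<n}) = sz n S i w" using Max_sz_witness[OF assms(1)] .
  have "sz n S i w \<le> sz n T j w" by (rule sz_mono[OF assms(2)])
  also have "\<dots> \<le> Max (sz n T j ` {..<n})" by (rule sz_le_Max[OF w(1)])
  finally show ?thesis using w by (simp add: mxf_def)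
qed

lemma mxf_0 [simp]: "n \<ge> 1 \<Longrightarrow> mxf n 0 S = 0"
proof -
  assume "n \<ge> 1"
  then have "0 \<in> {..<n}" by simp
  then have "sz n S 0 ` {..<n} = {n}" unfolding sz_0 by blast
  then show ?thesis by (simp add: mxf_def)
qed

text \<open>Every vertex is separated from at least as many vertices as lie outside a largest
  block.\<close>

lemma mxf_unc:
  assumes "n \<ge> 1" shows "mxf n k S \<le> n * unc n k S"
proof -
  have "mxf n k S / n = avg n (\<lambda>_. mxf n k S / n)" using assms by simp
  also have "\<dots> \<le> avg n (\<lambda>u. 1 - sz n S k u / n)"
  proof (rule avg_mono)
    fix u assume "u < n"
    then have "mxf n k S / n \<le> (real n - sz n S k u) / n"
      using sz_le_Max[of u n S k] unfolding mxf_def by (intro divide_right_mono) auto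
    then show "mxf n k S / n \<le> 1 - sz n S k u / n" using assms by (simp add: diff_divide_distrib)
  qed
  also have "\<dots> = unc n k S" using assms by (simp add: unc_def avg2_def avg_diff avg_rls)
  finally show ?thesis using assms by (simp add: divide_le_eq mult.commute)
qed

text \<open>Each block other than a chosen largest one uses up at least one vertex of its
  complement.\<close>

lemma kap_mxf:
  assumes "n \<ge> 1" shows "n * kap n k S - 1 \<le> mxf n k S"
proof -
  obtain w where w: "w < n" "Max (sz n S k ` {..<n}) = sz n S k w" using Max_sz_witness[OF assms] .
  define B where "B = blk n S k w"
  have B: "B \<subseteq> {..<n}" "finite B" "card B = sz n S k w"
    using blk_subset by (auto simp: B_def sz_def)
  have "n * kap n k S = (\<Sum>u<n. 1 / real (sz n S k u))" using assms by (simp add: kap_def stat_def avg_def)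
  also have "\<dots> = (\<Sum>u\<in>B. 1 / real (sz n S k u)) + (\<Sum>u\<in>{..<n} - B. 1 / real (sz n S k u))"
    using sum.subset_diff[OF B(1), of "\<lambda>u. 1 / real (sz n S k u)"] by simp
  also have "(\<Sum>u\<in>B. 1 / real (sz n S k u)) = (\<Sum>u\<in>B. 1 / real (sz n S k w))"
    unfolding B_def by (intro sum.cong refl) (simp add: sz_blk)
  also have "\<dots> \<le> 1" using B by simp
  also have "(\<Sum>u\<in>{..<n} - B. 1 / real (sz n S k u)) \<le> (\<Sum>u\<in>{..<n} - B. 1)"
  proof (rule sum_mono)
    fix u assume "u \<in> {..<n} - B"
    then have "1 \<le> sz n S k u" by (intro sz_pos) simp
    then show "1 / real (sz n S k u) \<le> 1" by simp
  qed
  also have "(\<Sum>u\<in>{..<n} - B. 1) = real n - real (card B)"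
    using B card_mono[OF _ B(1)] by (simp add: card_Diff_subset of_nat_diff)
  finally show ?thesis using w B by (simp add: mxf_def)
qed

definition edge :: "nat \<Rightarrow> nat \<Rightarrow> nat \<times> nat" where
  "edge u w = (min u w, max u w)"

lemma edge_Kedges: "u < n \<Longrightarrow> w < n \<Longrightarrow> u \<noteq> w \<Longrightarrow> edge u w \<in> Kedges n"
  by (auto simp: edge_def Kedges_def)

text \<open>The key inequality for the tail: most edges between the giant block of a level and the other
  vertices of the giant block one level below have not arrived yet, and each of them shrinks the
  complement of the giant.\<close>

lemma mxf_decrease:
  assumes n: "n \<ge> 1" and small: "mxf n (Suc j) (St n c t) \<le> n / 4"
    and deg: "\<And>u. u < n \<Longrightarrow> real (dg n u c t) \<le> n / 4"
  shows "(mxf n (Suc j) (St n c t) - mxf n j (St n c t)) * (n / 2) \<le>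
    (\<Sum>e | e \<in> Kedges n \<and> t < c e. min (mxf n (Suc j) (St n c t)) (n / 4) - min (mxf n (Suc j) (ad e (St n c t))) (n / 4))"
proof -
  define S where "S = St n c t"
  have S: "good n S" by (simp add: S_def)
  obtain w0 where w0: "w0 < n" "Max (sz n S (Suc j) ` {..<n}) = sz n S (Suc j) w0" using Max_sz_witness[OF n] .
  define B where "B = blk n S (Suc j) w0"
  define C where "C = blk n S j w0"
  have BC: "B \<subseteq> C" unfolding B_def C_def by (intro blk_mono rl_Suc_subset[OF S])
  have C: "C \<subseteq> {..<n}" "finite C" unfolding C_def using blk_subset by auto
  have finB: "finite B" by (simp add: B_def)
  have cB: "mxf n (Suc j) S = real n - real (card B)" using w0 by (simp add: mxf_def B_def sz_def)
  then have cB34: "3 * n / 4 \<le> card B" using small by (simp add: S_def[symmetric])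
  \<comment> \<open>The block \<open>C\<close> contains \<open>B\<close> and so has at least
    \<open>3 * n / 4\<close> vertices; any other block is disjoint from it and cannot be
    larger.\<close>
  have MC: "Max (sz n S j ` {..<n}) = card C"
  proof (rule Max_eqI)
    show "card C \<in> sz n S j ` {..<n}" using w0 by (auto simp: C_def sz_def)
    fix y assume "y \<in> sz n S j ` {..<n}"
    then obtain u where u: "u < n" "y = sz n S j u" by auto
    show "y \<le> card C"
    proof (cases "(u, w0) \<in> rl S j")
      case True
      then show ?thesis using u sz_eq[OF True, of n] by (simp add: C_def sz_def)
    next
      case False
      have "card (blk n S j u) + card C = card (blk n S j u \<union> C)"
        using blk_disjoint[OF False, of n] C by (simp add: C_def card_Un_disjoint)
      also have "\<dots> \<le> card {..<n}" using C blk_subset[of n S j u] by (intro card_mono) auto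
      finally have "y + card C \<le> n" by (simp add: u sz_def)
      moreover have "card B \<le> card C" using BC C by (intro card_mono)
      ultimately show ?thesis using cB34 by linarith
    qed
  qed simp
  have cC: "mxf n j S = real n - real (card C)" by (simp add: mxf_def MC)
  have diffm: "mxf n (Suc j) S - mxf n j S = card (C - B)"
    using BC C card_mono[OF C(2) BC] by (simp add: cB cC card_Diff_subset finB of_nat_diff)
  define P where "P = (SIGMA u:C - B. {w \<in> B. t < c (edge u w)})"
  have finP: "finite P" using C finB by (auto simp: P_def)
  \<comment> \<open>At least \<open>3 * n / 4\<close> vertices in \<open>B\<close>, minus at most
    \<open>n / 4\<close> edges at \<open>u\<close> that have arrived.\<close>
  have cardu: "n / 2 \<le> real (card {w \<in> B. t < c (edge u w)})" if u: "u \<in> C - B" for u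
  proof -
    have un: "u < n" using u C by auto
    have "card {w \<in> B. c (edge u w) \<le> t} \<le> dg n u c t"
      unfolding dg_def
    proof (rule card_inj_on_le[of "edge u"])
      show "inj_on (edge u) {w \<in> B. c (edge u w) \<le> t}"
        by (auto simp: inj_on_def edge_def min_def max_def split: if_splits)
      show "edge u ` {w \<in> B. c (edge u w) \<le> t} \<subseteq> {e \<in> Kedges n. (fst e = u \<or> snd e = u) \<and> c e \<le> t}"
      proof (rule image_subsetI)
        fix w assume "w \<in> {w \<in> B. c (edge u w) \<le> t}"
        then have w: "w \<in> B" "c (edge u w) \<le> t" by auto
        then have "w < n" "u \<noteq> w" using BC C u by auto
        then have "edge u w \<in> Kedges n" using un by (intro edge_Kedges)
        moreover have "fst (edge u w) = u \<or> snd (edge u w) = u" by (auto simp: edge_def)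
        ultimately show "edge u w \<in> {e \<in> Kedges n. (fst e = u \<or> snd e = u) \<and> c e \<le> t}" using w by simp
      qed
    qed simp
    moreover have "card B = card {w \<in> B. t < c (edge u w)} + card {w \<in> B. c (edge u w) \<le> t}"
    proof -
      have "B = {w \<in> B. t < c (edge u w)} \<union> {w \<in> B. c (edge u w) \<le> t}" by auto
      then show ?thesis using finB by (subst card_Un_disjoint[symmetric]) auto
    qed
    ultimately show ?thesis using cB34 deg[OF un] by linarith
  qed
  have "real (card (C - B)) * (n / 2) = (\<Sum>u\<in>C - B. n / 2)" by simp
  also have "\<dots> \<le> (\<Sum>u\<in>C - B. real (card {w \<in> B. t < c (edge u w)}))" by (intro sum_mono cardu)
  also have "\<dots> = real (card P)" unfolding P_def using C finB by (simp add: card_SigmaI)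
  \<comment> \<open>Exactly one end of such an edge lies in \<open>B\<close>, so the normalised edge
    determines the pair.\<close>
  also have "card P = card ((\<lambda>(u, w). edge u w) ` P)"
  proof (rule card_image[symmetric], rule inj_onI, clarify)
    fix u w u' w' assume p: "(u, w) \<in> P" "(u', w') \<in> P" and e: "edge u w = edge u' w'"
    then have "u \<notin> B" "w \<in> B" "u' \<notin> B" "w' \<in> B" by (auto simp: P_def)
    moreover have "u = u' \<and> w = w' \<or> u = w' \<and> w = u'" using e by (auto simp: edge_def min_def max_def split: if_splits)
    ultimately show "u = u' \<and> w = w'" by auto
  qed
  also have "real (card ((\<lambda>(u, w). edge u w) ` P)) = (\<Sum>e\<in>(\<lambda>(u, w). edge u w) ` P. 1)" by simp
  also have "\<dots> \<le> (\<Sum>e\<in>(\<lambda>(u, w). edge u w) ` P. min (mxf n (Suc j) S) (n / 4) - min (mxf n (Suc j) (ad e S)) (n / 4))"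
  proof (rule sum_mono)
    fix e assume "e \<in> (\<lambda>(u, w). edge u w) ` P"
    then obtain u w where uw: "u \<in> C - B" "w \<in> B" "e = edge u w" by (auto simp: P_def)
    then have n': "u < n" "w < n" using C BC by auto
    have r: "(u, w) \<in> rl S j" using uw BC rl_sym rl_trans unfolding C_def blk_def by blast
    have nr: "(u, w) \<notin> rl S (Suc j)"
    proof
      assume "(u, w) \<in> rl S (Suc j)"
      moreover have "(w0, w) \<in> rl S (Suc j)" using uw by (simp add: B_def blk_def)
      ultimately have "(w0, u) \<in> rl S (Suc j)" using rl_sym rl_trans by blast
      then show False using uw n' by (simp add: B_def blk_def)
    qed
    have a: "acc S j (u, w)" using r nr by (simp add: acc_def)
    obtain u' w' where e': "e = (u', w')" "acc S j (u', w')" "{u', w'} = {u, w}"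
    proof (cases "u \<le> w")
      case True
      then show ?thesis using that[of u w] uw(3) a by (simp add: edge_def)
    next
      case False
      then show ?thesis using that[of w u] uw(3) a acc_sym[of S j u w] by (auto simp: edge_def)
    qed
    have wB: "blk n S (Suc j) w = B"
      using uw blk_eq[of w0 w S "Suc j" n] by (simp add: B_def blk_def)
    have "insert u B \<subseteq> blk n (ad e S) (Suc j) w"
      using blk_ad_acc[OF e'(2) n'(2)] e'(1,3) wB blk_self[OF n'(1), of S "Suc j"] blk_self[OF n'(2), of S "Suc j"]
      by (auto simp: doubleton_eq_iff)
    then have "card (insert u B) \<le> sz n (ad e S) (Suc j) w" unfolding sz_def by (intro card_mono) auto
    then have "card B + 1 \<le> sz n (ad e S) (Suc j) w" using uw finB by simp
    also have "\<dots> \<le> Max (sz n (ad e S) (Suc j) ` {..<n})" by (rule sz_le_Max[OF n'(2)])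
    finally have "mxf n (Suc j) (ad e S) \<le> mxf n (Suc j) S - 1" unfolding cB by (simp add: mxf_def)
    then show "1 \<le> min (mxf n (Suc j) S) (n / 4) - min (mxf n (Suc j) (ad e S)) (n / 4)"
      using small by (simp add: S_def[symmetric])
  qed
  also have "\<dots> \<le> (\<Sum>e | e \<in> Kedges n \<and> t < c e. min (mxf n (Suc j) S) (n / 4) - min (mxf n (Suc j) (ad e S)) (n / 4))"
  proof (rule sum_mono2)
    show "(\<lambda>(u, w). edge u w) ` P \<subseteq> {e \<in> Kedges n. t < c e}"
    proof
      fix e assume "e \<in> (\<lambda>(u, w). edge u w) ` P"
      then obtain u w where "(u, w) \<in> P" and e: "e = edge u w" by auto
      then have "u < n" "w < n" "u \<noteq> w" "t < c (edge u w)" using C BC by (auto simp: P_def)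
      then show "e \<in> {e \<in> Kedges n. t < c e}" unfolding e using edge_Kedges by simp
    qed
    fix e
    have "mxf n (Suc j) (ad e S) \<le> mxf n (Suc j) S" by (intro mxf_mono n rl_ad_mono)
    from min.mono[OF this order_refl, of "n / 4"]
    show "0 \<le> min (mxf n (Suc j) S) (n / 4) - min (mxf n (Suc j) (ad e S)) (n / 4)" by (simp only: diff_ge_0_iff_ge)
  qed simp
  finally show ?thesis unfolding S_def[symmetric] diffm .
qed

section \<open>Low degrees at early times\<close>

lemma dg_mono: "t \<le> t' \<Longrightarrow> dg n u c t \<le> dg n u c t'"
  unfolding dg_def by (intro card_mono) auto

text \<open>Degrees only grow, so this single condition at time \<open>1/256\<close> covers all
  scaled times up to \<open>n / 256\<close>, the range on which the tail is estimated.\<close>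

definition lowdeg :: "nat \<Rightarrow> (nat \<times> nat \<Rightarrow> real) set" where
  "lowdeg n = {c. \<forall>u<n. real (dg n u c (1/256)) \<le> n / 4}"

context
  fixes n :: nat and D :: "real measure"
  assumes D: "cost_dist D"
begin

lemma measurable_dg: "(\<lambda>c. real (dg n u c t)) \<in> borel_measurable (cost_space n D)"
proof -
  have eq: "real (dg n u c t) = (\<Sum>e\<in>Kedges n. of_bool (fst e = u \<or> snd e = u) * indicator {..t} (c e))" for c
  proof -
    have "(\<Sum>e\<in>Kedges n. of_bool (fst e = u \<or> snd e = u) * indicator {..t} (c e))
      = (\<Sum>e\<in>Kedges n. if (fst e = u \<or> snd e = u) \<and> c e \<le> t then 1 else 0 :: real)"
      by (intro sum.cong) auto
    then show ?thesis unfolding dg_def by (simp add: sum.If_cases Int_def)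
  qed
  have "(\<lambda>c. \<Sum>e\<in>Kedges n. of_bool (fst e = u \<or> snd e = u) * indicator {..t} (c e) :: real) \<in> borel_measurable (cost_space n D)"
    by (intro borel_measurable_sum borel_measurable_times borel_measurable_const
      measurable_compose[OF measurable_cost[OF D], where g="indicator {..t}"]) auto
  then show ?thesis unfolding eq .
qed

lemma lowdeg_sets: "{c \<in> space (cost_space n D). c \<in> lowdeg n} \<in> sets (cost_space n D)"
proof -
  have [measurable]: "(\<lambda>c. real (dg n u c (1/256))) \<in> borel_measurable (cost_space n D)" for u
    by (rule measurable_dg)
  show ?thesis unfolding lowdeg_def mem_Collect_eq by measurable
qed

text \<open>Exponential Markov inequality with base 256. Each of the at most \<open>n\<close> edges
  at \<open>u\<close> contributes a factor of mean at most \<open>1 + 255 / 256 \<le> 2\<close>,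
  whereas a degree above \<open>n / 4\<close> makes the product at least
  \<open>256 ^ (n / 4) = 4 ^ n\<close>. This explains the time \<open>1/256\<close>.\<close>

lemma prob_high_degree:
  assumes u: "u < n"
  shows "measure (cost_space n D) {c \<in> space (cost_space n D). n / 4 < real (dg n u c (1/256))} \<le> (1/2) ^ n"
proof -
  define M where "M = cost_space n D"
  interpret M: prob_space M unfolding M_def by (rule prob_cost_space[OF D])
  interpret D: prob_space D by (rule prob_D[OF D])
  interpret product_sigma_finite "\<lambda>_::nat \<times> nat. D" by unfold_locales
  define E where "E = {e \<in> Kedges n. fst e = u \<or> snd e = u}"
  have finE: "finite E" "E \<subseteq> Kedges n" by (auto simp: E_def)
  have cardE: "card E \<le> n"
  proof -
    have "card E \<le> card {..<n}"
    proof (rule card_inj_on_le[of "\<lambda>e. if fst e = u then snd e else fst e"])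
      show "inj_on (\<lambda>e. if fst e = u then snd e else fst e) E"
        by (auto simp: inj_on_def E_def Kedges_def split: if_splits)
    qed (auto simp: E_def Kedges_def)
    then show ?thesis by simp
  qed
  define f where "f e y = (if e \<in> E then 1 + 255 * indicator {..1/256} y else 1 :: real)" for e and y :: real
  have fm: "f e \<in> borel_measurable borel" for e unfolding f_def by (cases "e \<in> E") auto
  have fint: "integrable D (f e)" for e
    using fm[of e] by (intro D.integrable_const_bound[of _ 256]) (auto simp: f_def indicator_def sets_D[OF D] cong: measurable_cong_sets)
  have fint2: "0 \<le> (\<integral>y. f e y \<partial>D)" "(\<integral>y. f e y \<partial>D) \<le> (if e \<in> E then 2 else 1)" if e: "e \<in> Kedges n" for e
  proof -
    show "0 \<le> (\<integral>y. f e y \<partial>D)" by (intro Bochner_Integration.integral_nonneg) (auto simp: f_def)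
    have ind: "(\<integral>y. indicator {..1/256} y \<partial>D) \<le> (1 / 256 :: real)"
    proof -
      have "(\<integral>y. indicator {..1/256} y \<partial>D) = (measure D {..1/256} :: real)"
        by (simp add: sets_D[OF D] sets_eq_imp_space_eq[OF sets_D[OF D]])
      also have "\<dots> = (\<integral>c. indicator {..1/256} (c e) \<partial>cost_space n D)"
        by (rule prob_cost[OF D e, symmetric]) simp
      also have "\<dots> \<le> 1 / 256" using prob_le[OF D e, of "1/256"] by simp
      finally show ?thesis .
    qed
    have "integrable D (\<lambda>y. indicator {..1/256} y :: real)"
      by (intro D.integrable_const_bound[of _ 1]) (auto simp: indicator_def sets_D[OF D] cong: measurable_cong_sets)
    then have "e \<in> E \<Longrightarrow> (\<integral>y. f e y \<partial>D) = 1 + 255 * (\<integral>y. indicator {..1/256} y \<partial>D)"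
      by (simp add: f_def D.prob_space)
    then show "(\<integral>y. f e y \<partial>D) \<le> (if e \<in> E then 2 else 1)"
      using ind by (auto simp: f_def D.prob_space)
  qed
  have prod_eq: "(\<Prod>e\<in>Kedges n. f e (c e)) = 256 ^ dg n u c (1/256)" for c
  proof -
    have "(\<Prod>e\<in>Kedges n. f e (c e)) = (\<Prod>e\<in>Kedges n. if e \<in> {e \<in> E. c e \<le> 1/256} then 256 else 1)"
      by (intro prod.cong) (auto simp: f_def)
    also have "\<dots> = (\<Prod>e\<in>{e \<in> E. c e \<le> 1/256}. 256)"
    proof -
      have "Kedges n \<inter> {e \<in> E. c e \<le> 1/256} = {e \<in> E. c e \<le> 1/256}" using finE by auto
      then show ?thesis
        using prod.inter_restrict[of "Kedges n" "\<lambda>_. 256 :: real" "{e \<in> E. c e \<le> 1/256}"] by simp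
    qed
    also have "{e \<in> E. c e \<le> 1/256} = {e \<in> Kedges n. (fst e = u \<or> snd e = u) \<and> c e \<le> 1/256}"
      by (auto simp: E_def)
    finally show ?thesis by (simp add: dg_def)
  qed
  have int256: "integrable M (\<lambda>c. 256 ^ dg n u c (1/256) :: real)"
    unfolding M_def cost_space_def prod_eq[symmetric] by (rule product_integrable_prod) (auto intro: fint)
  have "measure M {c \<in> space M. n / 4 < real (dg n u c (1/256))} = (\<integral>c. indicator {c \<in> space M. n / 4 < real (dg n u c (1/256))} c \<partial>M)"
  proof -
    have "{c \<in> space M. n / 4 < real (dg n u c (1/256))} \<inter> space M = {c \<in> space M. n / 4 < real (dg n u c (1/256))}" by auto
    then show ?thesis by (simp only: Bochner_Integration.integral_indicator)
  qed
  also have "\<dots> \<le> (\<integral>c. 256 ^ dg n u c (1/256) / 4 ^ n \<partial>M)"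
  proof (rule integral_mono)
    have "{c \<in> space M. n / 4 < real (dg n u c (1/256))} \<in> sets M"
      using measurable_dg[of u "1/256"] unfolding M_def by measurable
    then show "integrable M (indicator {c \<in> space M. n / 4 < real (dg n u c (1/256))} :: _ \<Rightarrow> real)"
      by (intro M.integrable_const_bound[of _ 1]) (auto simp: indicator_def intro: borel_measurable_indicator)
    show "integrable M (\<lambda>c. 256 ^ dg n u c (1/256) / 4 ^ n :: real)" using int256 by simp
    fix c
    show "indicator {c \<in> space M. n / 4 < real (dg n u c (1/256))} c \<le> (256 ^ dg n u c (1/256) / 4 ^ n :: real)"
    proof (cases "n / 4 < real (dg n u c (1/256))")
      case True
      then have "n \<le> 4 * dg n u c (1/256)" by linarith
      then have "(4::real) ^ n \<le> 4 ^ (4 * dg n u c (1/256))" by (intro power_increasing) auto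
      also have "\<dots> = 256 ^ dg n u c (1/256)" by (simp add: power_mult)
      finally show ?thesis by (simp add: indicator_def le_divide_eq)
    qed simp
  qed
  also have "\<dots> = (\<integral>c. 256 ^ dg n u c (1/256) \<partial>M) / 4 ^ n" by simp
  also have "(\<integral>c. 256 ^ dg n u c (1/256) \<partial>M) = (\<Prod>e\<in>Kedges n. (\<integral>y. f e y \<partial>D))"
    unfolding M_def cost_space_def prod_eq[symmetric] by (rule product_integral_prod) (auto intro: fint)
  also have "\<dots> \<le> (\<Prod>e\<in>Kedges n. if e \<in> E then 2 else 1)" using fint2 by (intro prod_mono) auto
  also have "\<dots> = 2 ^ card E"
    using finE by (subst prod.inter_restrict[symmetric]) (auto simp: Int_absorb1)
  also have "(2::real) ^ card E \<le> 2 ^ n" using cardE by (intro power_increasing) auto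
  also have "(2::real) ^ n / 4 ^ n = (1/2) ^ n" by (simp add: power_divide[symmetric])
  finally show ?thesis by (simp add: M_def divide_right_mono)
qed

lemma prob_not_lowdeg:
  "measure (cost_space n D) {c \<in> space (cost_space n D). c \<notin> lowdeg n} \<le> n * (1/2) ^ n"
proof -
  define M where "M = cost_space n D"
  interpret M: prob_space M unfolding M_def by (rule prob_cost_space[OF D])
  let ?A = "\<lambda>u. {c \<in> space M. n / 4 < real (dg n u c (1/256))}"
  have A: "?A u \<in> sets M" for u
    using measurable_dg[of u "1/256"] unfolding M_def by measurable
  have "{c \<in> space M. c \<notin> lowdeg n} = (\<Union>u\<in>{..<n}. ?A u)" by (auto simp: lowdeg_def not_le)
  then have "measure M {c \<in> space M. c \<notin> lowdeg n} \<le> (\<Sum>u<n. measure M (?A u))"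
    using M.finite_measure_subadditive_finite[of "{..<n}" ?A] A by auto
  also have "\<dots> \<le> (\<Sum>u<n. (1/2) ^ n)" unfolding M_def by (intro sum_mono prob_high_degree) simp
  finally show ?thesis by (simp add: M_def)
qed

end

context
  fixes n :: nat and D :: "real measure"
  assumes D: "cost_dist D" and n: "n \<ge> 1"
begin

lemma integrable_St_lowdeg:
  fixes \<phi> :: "state \<Rightarrow> real"
  shows "integrable (cost_space n D) (\<lambda>c. \<phi> (St n c t) * of_bool (c \<in> lowdeg n \<and> P (St n c t')))"
proof -
  let ?M = "cost_space n D"
  have P: "{c \<in> space ?M. P (St n c t')} \<in> sets ?M"
  proof -
    have "(\<lambda>c. P (St n c t')) \<in> measurable ?M (count_space UNIV)" by (rule measurable_St'[OF D])
    then show ?thesis by measurable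
  qed
  have "{c \<in> space ?M. c \<in> lowdeg n} \<inter> {c \<in> space ?M. P (St n c t')} \<in> sets ?M"
    by (intro sets.Int lowdeg_sets[OF D] P)
  also have "{c \<in> space ?M. c \<in> lowdeg n} \<inter> {c \<in> space ?M. P (St n c t')} = {c \<in> space ?M. c \<in> lowdeg n \<and> P (St n c t')}" by auto
  finally have G: "{c \<in> space ?M. c \<in> lowdeg n \<and> P (St n c t')} \<in> sets ?M" .
  have "integrable ?M (\<lambda>c. indicator {c \<in> space ?M. c \<in> lowdeg n \<and> P (St n c t')} c *\<^sub>R \<phi> (St n c t))"
    by (rule integrable_mult_indicator[OF G integrable_St[OF D]])
  then show ?thesis
    by (rule Bochner_Integration.integrable_cong[THEN iffD1, rotated -1]) (auto simp: indicator_def)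
qed

text \<open>The event changes with the level. As complements grow from level to level, the event of
  level \<open>j + 1\<close> is contained in that of level \<open>j\<close>, which is the direction
  needed when the two are subtracted.\<close>

definition yl :: "nat \<Rightarrow> real \<Rightarrow> real" where
  "yl j x = (\<integral>c. mxf n j (St n c (x / n)) * of_bool (c \<in> lowdeg n \<and> mxf n j (St n c (x / n)) \<le> n / 4) \<partial>cost_space n D)"

text \<open>\<open>mxf_decrease\<close> inside the expectation. Of the factor 4, one half undoes the
  rate \<open>n / 2\<close> per vertex and the other is the 2 of
  \<open>Ef_generator_decreasing\<close>.\<close>

lemma yl_step:
  assumes x: "0 \<le> x" "x \<le> n / 256"
  shows "\<exists>h. (Ef n D (\<lambda>S. min (mxf n (Suc j) S) (n / 4)) has_real_derivative h) (at x within {0..n/2}) \<and>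
    yl (Suc j) x - yl j x \<le> - 4 * h"
proof -
  define W where "W c = (n / 2) * ((mxf n (Suc j) (St n c (x / n)) - mxf n j (St n c (x / n))) *
     of_bool (c \<in> lowdeg n \<and> mxf n (Suc j) (St n c (x / n)) \<le> n / 4))" for c
  have Wint: "integrable (cost_space n D) W"
    unfolding W_def
    by (intro integrable_mult_right integrable_St_lowdeg[of "\<lambda>S. mxf n (Suc j) S - mxf n j S" _ "\<lambda>S. mxf n (Suc j) S \<le> n / 4"])
  have dec: "min (mxf n (Suc j) (ad e S)) (n / 4) \<le> min (mxf n (Suc j) S) (n / 4)" for e S
    by (intro min.mono order_refl mxf_mono n rl_ad_mono)
  have t: "x / n \<le> 1 / 256" using x n by (simp add: field_simps)
  have Wle: "W c \<le> (\<Sum>e | e \<in> Kedges n \<and> x / n < c e. min (mxf n (Suc j) (St n c (x / n))) (n / 4) - min (mxf n (Suc j) (ad e (St n c (x / n)))) (n / 4))" for c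
  proof (cases "c \<in> lowdeg n \<and> mxf n (Suc j) (St n c (x / n)) \<le> n / 4")
    case True
    have "W c = (mxf n (Suc j) (St n c (x / n)) - mxf n j (St n c (x / n))) * (n / 2)" using True by (simp add: W_def)
    also have "\<dots> \<le> (\<Sum>e | e \<in> Kedges n \<and> x / n < c e. min (mxf n (Suc j) (St n c (x / n))) (n / 4) - min (mxf n (Suc j) (ad e (St n c (x / n)))) (n / 4))"
    proof (rule mxf_decrease[OF n])
      fix u assume "u < n"
      then have "real (dg n u c (1/256)) \<le> n / 4" using True by (simp add: lowdeg_def)
      moreover have "dg n u c (x / n) \<le> dg n u c (1/256)" by (rule dg_mono[OF t])
      ultimately show "real (dg n u c (x / n)) \<le> n / 4" by linarith
    qed (use True in simp)
    finally show ?thesis .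
  next
    case False
    then have "W c = 0" unfolding W_def by (simp only: of_bool_eq mult_zero_right simp_thms)
    also have "0 \<le> (\<Sum>e | e \<in> Kedges n \<and> x / n < c e. min (mxf n (Suc j) (St n c (x / n))) (n / 4) - min (mxf n (Suc j) (ad e (St n c (x / n)))) (n / 4))"
      using dec by (intro sum_nonneg) (simp only: diff_ge_0_iff_ge)
    finally show ?thesis .
  qed
  have B: "\<bar>min (mxf n (Suc j) S) (n / 4)\<bar> \<le> n" for S using mxf_nonneg[OF n, of "Suc j" S] by (simp add: min_def)
  have x': "x \<in> {0..real n / 2}" using x by auto
  obtain h where h: "(Ef n D (\<lambda>S. min (mxf n (Suc j) S) (n / 4)) has_real_derivative h) (at x within {0..n/2})"
    "(\<integral>c. W c \<partial>cost_space n D) / n \<le> - 2 * h"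
    using Ef_generator_decreasing[where \<phi>="\<lambda>S. min (mxf n (Suc j) S) (n / 4)", OF D B n x' dec Wint Wle] by blast
  have "yl (Suc j) x - yl j x = (\<integral>c. mxf n (Suc j) (St n c (x / n)) * of_bool (c \<in> lowdeg n \<and> mxf n (Suc j) (St n c (x / n)) \<le> n / 4)
      - mxf n j (St n c (x / n)) * of_bool (c \<in> lowdeg n \<and> mxf n j (St n c (x / n)) \<le> n / 4) \<partial>cost_space n D)"
    unfolding yl_def
    by (rule Bochner_Integration.integral_diff[symmetric])
      (rule integrable_St_lowdeg[of "mxf n (Suc j)" _ "\<lambda>S. mxf n (Suc j) S \<le> n / 4"],
       rule integrable_St_lowdeg[of "mxf n j" _ "\<lambda>S. mxf n j S \<le> n / 4"])
  also have "\<dots> \<le> (\<integral>c. 2 / n * W c \<partial>cost_space n D)"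
  proof (rule integral_mono)
    show "integrable (cost_space n D) (\<lambda>c. 2 / n * W c)" using Wint by simp
    show "integrable (cost_space n D) (\<lambda>c. mxf n (Suc j) (St n c (x / n)) * of_bool (c \<in> lowdeg n \<and> mxf n (Suc j) (St n c (x / n)) \<le> n / 4)
      - mxf n j (St n c (x / n)) * of_bool (c \<in> lowdeg n \<and> mxf n j (St n c (x / n)) \<le> n / 4))"
      by (intro Bochner_Integration.integrable_diff integrable_St_lowdeg[of "mxf n (Suc j)" _ "\<lambda>S. mxf n (Suc j) S \<le> n / 4"]
       integrable_St_lowdeg[of "mxf n j" _ "\<lambda>S. mxf n j S \<le> n / 4"])
    fix c
    have "mxf n j (St n c (x / n)) \<le> mxf n (Suc j) (St n c (x / n))" "0 \<le> mxf n j (St n c (x / n))"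
      by (intro mxf_mono[OF n] rl_Suc_subset[OF good_St]) (rule mxf_nonneg[OF n])
    moreover have "2 / n * W c = (mxf n (Suc j) (St n c (x / n)) - mxf n j (St n c (x / n))) *
     of_bool (c \<in> lowdeg n \<and> mxf n (Suc j) (St n c (x / n)) \<le> n / 4)"
      unfolding W_def using n by simp
    ultimately show "mxf n (Suc j) (St n c (x / n)) * of_bool (c \<in> lowdeg n \<and> mxf n (Suc j) (St n c (x / n)) \<le> n / 4)
      - mxf n j (St n c (x / n)) * of_bool (c \<in> lowdeg n \<and> mxf n j (St n c (x / n)) \<le> n / 4) \<le> 2 / n * W c"
      by (auto simp: of_bool_def)
  qed
  also have "\<dots> = 2 * ((\<integral>c. W c \<partial>cost_space n D) / n)" by simp
  finally have "yl (Suc j) x - yl j x \<le> - 4 * h" using h(2) by linarith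
  with h(1) show ?thesis by blast
qed

text \<open>A Lyapunov function. The inequalities of \<open>yl_step\<close> telescope over the
  levels down to \<open>yl 0 = 0\<close>, since level 0 is a single block; hence \<open>Zl k\<close>
  decreases at least at the rate \<open>yl k\<close>.\<close>

definition Zl :: "nat \<Rightarrow> real \<Rightarrow> real" where
  "Zl k x = (\<Sum>j<k. 4 * Ef n D (\<lambda>S. min (mxf n (Suc j) S) (n / 4)) x)"

lemma Zl_derivative:
  assumes x: "0 \<le> x" "x \<le> n / 256"
  shows "\<exists>h. (Zl k has_real_derivative h) (at x within {0..n/2}) \<and> h \<le> - yl k x"
proof (induction k)
  case 0
  then show ?case using n by (auto simp: Zl_def yl_def intro!: exI[of _ 0])
next
  case (Suc k)
  then obtain h where h: "(Zl k has_real_derivative h) (at x within {0..n/2})" "h \<le> - yl k x" by blast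
  obtain g where g: "(Ef n D (\<lambda>S. min (mxf n (Suc k) S) (n / 4)) has_real_derivative g) (at x within {0..n/2})"
    "yl (Suc k) x - yl k x \<le> - 4 * g" using yl_step[OF x, of k] by blast
  have "Zl (Suc k) = (\<lambda>x. Zl k x + 4 * Ef n D (\<lambda>S. min (mxf n (Suc k) S) (n / 4)) x)"
    by (simp add: Zl_def fun_eq_iff)
  then have "(Zl (Suc k) has_real_derivative h + 4 * g) (at x within {0..n/2})"
    using DERIV_add[OF h(1) DERIV_cmult[OF g(1), of 4]] by simp
  moreover have "h + 4 * g \<le> - yl (Suc k) x" using h(2) g(2) by linarith
  ultimately show ?case by blast
qed

lemma Zl_bounds:
  assumes x: "0 < x" "x \<le> n / 2"
  shows "0 \<le> Zl k x" "Zl k x \<le> 4 * k * n * (2 * real k / x + 6 * real k * x / n)"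
proof -
  have 0: "0 \<le> Ef n D (\<lambda>S. min (mxf n (Suc j) S) (n / 4)) x" for j
    using Ef_mono[OF D, of "\<lambda>_. 0" n x "\<lambda>S. min (mxf n (Suc j) S) (n / 4)"] mxf_nonneg[OF n]
    by (simp add: Ef_const[OF D])
  then show "0 \<le> Zl k x" by (auto simp: Zl_def intro!: sum_nonneg)
  have "Ef n D (\<lambda>S. min (mxf n (Suc j) S) (n / 4)) x \<le> n * (2 * real k / x + 6 * real k * x / n)" if "j < k" for j
  proof -
    have "Ef n D (\<lambda>S. min (mxf n (Suc j) S) (n / 4)) x \<le> Ef n D (\<lambda>S. n * unc n (Suc j) S) x"
    proof (rule Ef_mono[OF D])
      fix c show "min (mxf n (Suc j) (St n c (x / n))) (n / 4) \<le> n * unc n (Suc j) (St n c (x / n))"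
        using mxf_unc[OF n, of "Suc j" "St n c (x / n)"] by linarith
    qed
    also have "\<dots> = n * Ef n D (unc n (Suc j)) x" by (rule Ef_cmult[OF D])
    also have "\<dots> \<le> n * (2 * real (Suc j) / x + 6 * real (Suc j) * x / n)"
      using Ef_unc[OF D n x, of "Suc j"] by (intro mult_left_mono) auto
    also have "\<dots> \<le> n * (2 * real k / x + 6 * real k * x / n)"
    proof -
      have "real (Suc j) \<le> k" using that by simp
      then show ?thesis using x by (intro mult_left_mono add_mono divide_right_mono mult_right_mono) auto
    qed
    finally show ?thesis .
  qed
  then have "Zl k x \<le> (\<Sum>j<k. 4 * (n * (2 * real k / x + 6 * real k * x / n)))"
    unfolding Zl_def by (intro sum_mono mult_left_mono) auto
  then show "Zl k x \<le> 4 * k * n * (2 * real k / x + 6 * real k * x / n)" by (simp add: mult_ac)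
qed

text \<open>A Riemann sum of a decreasing function at right end points is at most its integral,
  which here is at most \<open>Zl k X\<close>. The event is fixed at time \<open>X\<close> and
  persists, because the complement of the giant only shrinks.\<close>

lemma tail_grid:
  assumes X: "0 < X" "0 < \<delta>" "X + real R * \<delta> \<le> n / 256"
  shows "(\<integral>c. (\<Sum>r\<in>{1..R}. \<delta> * mxf n k (St n c ((X + real r * \<delta>) / n))) * of_bool (c \<in> lowdeg n \<and> mxf n k (St n c (X / n)) \<le> n / 4) \<partial>cost_space n D)
    \<le> 4 * k * n * (2 * real k / X + 6 * real k * X / n)" (is "?I \<le> _")
proof -
  define G where "G c = (of_bool (c \<in> lowdeg n \<and> mxf n k (St n c (X / n)) \<le> n / 4) :: real)" for c
  define g where "g r = (\<integral>c. mxf n k (St n c ((X + real r * \<delta>) / n)) * G c \<partial>cost_space n D)" for r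
  have int: "integrable (cost_space n D) (\<lambda>c. mxf n k (St n c t) * G c)" for t
    unfolding G_def by (rule integrable_St_lowdeg[of "mxf n k" _ "\<lambda>S. mxf n k S \<le> n / 4"])
  have step: "\<delta> * g r \<le> Zl k (X + real (r - 1) * \<delta>) - Zl k (X + real r * \<delta>)" if r: "r \<in> {1..R}" for r
  proof -
    define a where "a = X + real (r - 1) * \<delta>"
    define b where "b = X + real r * \<delta>"
    have r1: "real (r - 1) = real r - 1" using r by (simp add: of_nat_diff)
    have ba: "b - a = \<delta>" unfolding a_def b_def r1 by (simp add: left_diff_distrib)
    have aX: "X \<le> a" using X by (simp add: a_def)
    have "b \<le> X + real R * \<delta>" using r X by (simp add: b_def mult_right_mono)
    then have bn: "b \<le> n / 256" using X by linarith
    have "Zl k b - Zl k a \<le> - g r * (b - a)"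
    proof (rule derivative_bound_within)
      show "a \<le> b" using ba X by linarith
      fix y assume y: "y \<in> {a..b}"
      then have y': "0 \<le> y" "y \<le> n / 256" using aX bn X by auto
      obtain h where h: "(Zl k has_real_derivative h) (at y within {0..n/2})" "h \<le> - yl k y" using Zl_derivative[OF y', of k] by blast
      have "g r \<le> yl k y"
        unfolding g_def yl_def
      proof (rule integral_mono[OF int integrable_St_lowdeg[of "mxf n k" _ "\<lambda>S. mxf n k S \<le> n / 4"]])
        fix c
        have 1: "mxf n k (St n c ((X + real r * \<delta>) / n)) \<le> mxf n k (St n c (y / n))"
          using y by (intro mxf_mono n rl_St_mono divide_right_mono) (auto simp: b_def)
        have 2: "mxf n k (St n c (y / n)) \<le> mxf n k (St n c (X / n))"
          using y aX by (intro mxf_mono n rl_St_mono divide_right_mono) auto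
        show "mxf n k (St n c ((X + real r * \<delta>) / n)) * G c \<le> mxf n k (St n c (y / n)) * of_bool (c \<in> lowdeg n \<and> mxf n k (St n c (y / n)) \<le> n / 4)"
        proof (cases "c \<in> lowdeg n \<and> mxf n k (St n c (X / n)) \<le> n / 4")
          case True
          then have "mxf n k (St n c (y / n)) \<le> n / 4" using 2 by linarith
          then show ?thesis using True 1 by (simp add: G_def)
        next
          case False
          then have "G c = 0" by (simp add: G_def)
          then show ?thesis using mxf_nonneg[OF n, of k "St n c (y / n)"] by simp
        qed
      qed
      then have "h \<le> - g r" using h by linarith
      moreover have "{a..b} \<subseteq> {0..real n/2}" using aX bn X by auto
      ultimately show "\<exists>h. (Zl k has_real_derivative h) (at y within {a..b}) \<and> h \<le> - g r"
        using DERIV_subset[OF h(1)] by blast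
    qed
    then have "\<delta> * g r \<le> Zl k a - Zl k b" unfolding ba by (simp add: mult.commute)
    then show ?thesis unfolding a_def b_def .
  qed
  have "?I = (\<integral>c. (\<Sum>r\<in>{1..R}. \<delta> * (mxf n k (St n c ((X + real r * \<delta>) / n)) * G c)) \<partial>cost_space n D)"
    unfolding G_def by (simp only: sum_distrib_right mult.assoc)
  also have "\<dots> = (\<Sum>r\<in>{1..R}. \<delta> * g r)"
    unfolding g_def using int by (subst Bochner_Integration.integral_sum) auto
  also have "\<dots> \<le> (\<Sum>r\<in>{1..R}. Zl k (X + real (r - 1) * \<delta>) - Zl k (X + real r * \<delta>))"
    by (intro sum_mono step)
  also have "\<dots> = Zl k X - Zl k (X + real R * \<delta>)"
    by (induction R) auto
  also have "\<dots> \<le> Zl k X" using Zl_bounds(1)[of "X + real R * \<delta>" k] X by (simp add: add_pos_nonneg)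
  also have "\<dots> \<le> 4 * k * n * (2 * real k / X + 6 * real k * X / n)"
  proof (rule Zl_bounds(2))
    have "0 \<le> real R * \<delta>" using X by simp
    then show "X \<le> n / 2" using X by linarith
  qed (use X in auto)
  finally show ?thesis .
qed

text \<open>Markov's inequality for \<open>unc\<close>: a complement larger than
  \<open>n / 4\<close> forces \<open>unc\<close> above \<open>1 / 4\<close>.\<close>

lemma prob_mxf_large:
  assumes X: "0 < X" "X \<le> n / 2"
  shows "measure (cost_space n D) {c \<in> space (cost_space n D). \<not> mxf n k (St n c (X / n)) \<le> n / 4} \<le> 4 * (2 * real k / X + 6 * real k * X / n)"
proof -
  let ?M = "cost_space n D" and ?A = "{c \<in> space (cost_space n D). \<not> mxf n k (St n c (X / n)) \<le> n / 4}"
  interpret M: prob_space ?M by (rule prob_cost_space[OF D])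
  have A: "?A \<in> sets ?M"
  proof -
    have "(\<lambda>c. \<not> mxf n k (St n c (X / n)) \<le> n / 4) \<in> measurable ?M (count_space UNIV)"
      by (rule measurable_St'[OF D, where \<phi>="\<lambda>S. \<not> mxf n k S \<le> n / 4"])
    then show ?thesis by (rule predE)
  qed
  have "measure ?M ?A = (\<integral>c. indicator ?A c \<partial>?M)"
  proof -
    have "?A \<inter> space ?M = ?A" by auto
    then show ?thesis by (simp only: Bochner_Integration.integral_indicator)
  qed
  also have "\<dots> \<le> (\<integral>c. 4 * unc n k (St n c (X / n)) \<partial>?M)"
  proof (rule integral_mono)
    show "integrable ?M (indicator ?A :: _ \<Rightarrow> real)"
      by (rule M.integrable_const_bound[of _ 1], simp) (rule borel_measurable_indicator[OF A])
    show "integrable ?M (\<lambda>c. 4 * unc n k (St n c (X / n)))" by (rule integrable_St[OF D, of n "\<lambda>S. 4 * unc n k S"])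
    fix c
    have "0 \<le> unc n k (St n c (X / n))" unfolding unc_def by (intro avg2_nonneg) (simp add: rls_def)
    moreover have "1 \<le> 4 * unc n k (St n c (X / n))" if "\<not> mxf n k (St n c (X / n)) \<le> n / 4"
    proof -
      have "n / 4 < n * unc n k (St n c (X / n))" using that mxf_unc[OF n, of k "St n c (X / n)"] by linarith
      then have "real n * 1 < real n * (4 * unc n k (St n c (X / n)))" by simp
      then have "1 < 4 * unc n k (St n c (X / n))" using n by (simp only: mult_less_cancel_left_pos of_nat_0_less_iff)
      then show ?thesis by simp
    qed
    ultimately show "indicator ?A c \<le> 4 * unc n k (St n c (X / n))" by (simp add: indicator_def)
  qed
  also have "\<dots> = 4 * Ef n D (unc n k) X" by (simp add: Ef_def)
  also have "\<dots> \<le> 4 * (2 * real k / X + 6 * real k * X / n)" using Ef_unc[OF D n X, of k] by simp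
  finally show ?thesis .
qed

end

section \<open>Minimum spanning trees by Kruskal's rule\<close>

text \<open>When an edge is deleted, the rest of the cycle still joins its ends. At least 3 vertices
  make the edges of the cycle distinct, so the way round does not use the deleted one.\<close>

lemma has_cycle_edges:
  assumes "has_cycle T"
  shows "\<exists>C\<subseteq>T. finite C \<and> C \<noteq> {} \<and> (\<forall>e\<in>C. e \<in> cn (C - {e}))"
proof -
  obtain vs where vs: "3 \<le> length vs" "distinct vs"
    "\<And>i. i < length vs \<Longrightarrow> adj T (vs ! i) (vs ! ((i + 1) mod length vs))"
    using assms unfolding has_cycle_def by blast
  define L where "L = length vs"
  define nx where "nx i = (i + 1) mod L" for i
  have L: "3 \<le> L" using vs by (simp add: L_def)
  have nx: "nx i < L" for i using L by (simp add: nx_def)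
  \<comment> \<open>Edges are ordered pairs, while a cycle is given by adjacency; each step picks an
    orientation that occurs in \<open>T\<close>.\<close>
  define ed where "ed i = (if (vs ! i, vs ! nx i) \<in> T then (vs ! i, vs ! nx i) else (vs ! nx i, vs ! i))" for i
  have edT: "ed i \<in> T" if "i < L" for i
    using vs(3)[of i] that by (auto simp: ed_def adj_def nx_def L_def)
  have vinj: "vs ! i = vs ! j \<longleftrightarrow> i = j" if "i < L" "j < L" for i j
    using that vs(2) by (simp add: nth_eq_iff_index_eq L_def)
  have nxcase: "nx i = (if Suc i = L then 0 else Suc i)" if "i < L" for i
    using that by (auto simp: nx_def)
  have edinj: "i = j" if "i < L" "j < L" "ed i = ed j" for i j
  proof -
    have "(i = j \<and> nx i = nx j) \<or> (i = nx j \<and> nx i = j)"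
      using that(3) vinj[OF that(1,2)] vinj[OF that(1) nx] vinj[OF nx that(2)] vinj[OF nx nx]
        vinj[OF that(2,1)] vinj[OF that(2) nx] vinj[OF nx that(1)]
      unfolding ed_def by (auto split: if_splits)
    then show ?thesis using nxcase[OF that(1)] nxcase[OF that(2)] L by (auto split: if_splits)
  qed
  define C where "C = ed ` {..<L}"
  have step: "(vs ! i, vs ! nx i) \<in> cn (C - {e})" if "i < L" "ed i \<noteq> e" for i e
  proof -
    have "ed i \<in> cn (C - {e})" using that by (intro cn_edge) (auto simp: C_def)
    then show ?thesis unfolding ed_def using cn_sym by (auto split: if_splits)
  qed
  have "ed i \<in> cn (C - {ed i})" if i: "i < L" for i
  proof -
    have path: "m < L \<Longrightarrow> (vs ! ((i + 1) mod L), vs ! ((i + 1 + m) mod L)) \<in> cn (C - {ed i})" for m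
    proof (induction m)
      case (Suc m)
      let ?p = "(i + 1 + m) mod L"
      have pL: "?p < L" using L by simp
      have "?p \<noteq> i"
      proof
        assume a: "?p = i"
        show False
        proof (cases "i + 1 + m < L")
          case True
          then show False using a by simp
        next
          case False
          then have "i + 1 + m - L < L" using Suc.prems i by linarith
          then have "?p = i + 1 + m - L" using False by (simp add: mod_if)
          then show False using a False Suc.prems by linarith
        qed
      qed
      then have "ed ?p \<noteq> ed i" using edinj[OF pL i] by blast
      from step[OF pL this] have "(vs ! ?p, vs ! nx ?p) \<in> cn (C - {ed i})" .
      moreover have "nx ?p = (i + 1 + Suc m) mod L" by (simp add: nx_def mod_simps)
      ultimately show ?case using Suc cn_trans by (metis Suc_lessD)
    qed simp
    have "(i + 1 + (L - 1)) mod L = i" using i L by simp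
    with path[of "L - 1"] L have "(vs ! nx i, vs ! i) \<in> cn (C - {ed i})" by (simp add: nx_def)
    then show ?thesis unfolding ed_def[of i] using cn_sym by (auto split: if_splits)
  qed
  then have "\<forall>e\<in>C. e \<in> cn (C - {e})" by (simp add: C_def)
  moreover have "C \<subseteq> T" "finite C" using edT by (auto simp: C_def)
  moreover have "ed 0 \<in> C" using L by (simp add: C_def)
  then have "C \<noteq> {}" by blast
  ultimately show ?thesis by (intro exI[of _ C] conjI)
qed

lemma rtrancl_simple_path:
  assumes "(x, y) \<in> r\<^sup>*"
  shows "\<exists>xs. xs \<noteq> [] \<and> hd xs = x \<and> last xs = y \<and> distinct xs \<and>
    (\<forall>i. Suc i < length xs \<longrightarrow> (xs ! i, xs ! Suc i) \<in> r)"
  using assms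
proof (induction rule: converse_rtrancl_induct)
  case base
  show ?case by (rule exI[of _ "[y]"]) simp
next
  case (step x z)
  then obtain xs where xs: "xs \<noteq> []" "hd xs = z" "last xs = y" "distinct xs"
    "\<And>i. Suc i < length xs \<Longrightarrow> (xs ! i, xs ! Suc i) \<in> r" by blast
  show ?case
  proof (cases "x \<in> set xs")
    case True
    then obtain i where i: "i < length xs" "xs ! i = x" by (auto simp: in_set_conv_nth)
    then show ?thesis using xs by (intro exI[of _ "drop i xs"]) (auto simp: hd_drop_conv_nth)
  next
    case False
    have "(\<forall>i. Suc i < length (x # xs) \<longrightarrow> ((x # xs) ! i, (x # xs) ! Suc i) \<in> r)"
    proof (intro allI impI)
      fix i assume "Suc i < length (x # xs)"
      then show "((x # xs) ! i, (x # xs) ! Suc i) \<in> r"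
        using xs step(1) by (cases i) (auto simp: hd_conv_nth)
    qed
    then show ?thesis using xs False by (intro exI[of _ "x # xs"]) auto
  qed
qed

text \<open>A simple path closed by the edge. The assumption on \<open>(v, u)\<close> excludes a
  path of two vertices along the reversed pair.\<close>

lemma has_cycleI:
  assumes "(u, v) \<in> T" "(v, u) \<notin> T" "u \<noteq> v" "(u, v) \<in> cn (T - {(u, v)})"
  shows "has_cycle T"
proof -
  obtain xs where xs: "xs \<noteq> []" "hd xs = u" "last xs = v" "distinct xs"
    "\<And>i. Suc i < length xs \<Longrightarrow> adj (T - {(u, v)}) (xs ! i) (xs ! Suc i)"
  proof -
    obtain xs where "xs \<noteq> []" "hd xs = u" "last xs = v" "distinct xs"
      "\<forall>i. Suc i < length xs \<longrightarrow> (xs ! i, xs ! Suc i) \<in> {(x, y). adj (T - {(u, v)}) x y}"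
      using rtrancl_simple_path[OF assms(4)[unfolded cn_def]] by (elim exE conjE) (rule that)
    then show ?thesis by (intro that[of xs]) auto
  qed
  have h: "xs ! 0 = u" "xs ! (length xs - 1) = v" using xs by (auto simp: hd_conv_nth last_conv_nth)
  have "length xs \<noteq> 1" using h assms(3) by auto
  moreover have "length xs \<noteq> 2"
  proof
    assume l: "length xs = 2"
    then have "adj (T - {(u, v)}) u v" using xs(5)[of 0] h by simp
    then show False using assms by (auto simp: adj_def)
  qed
  moreover have "length xs \<noteq> 0" using xs by simp
  ultimately have l: "3 \<le> length xs" by linarith
  have "adj T (xs ! i) (xs ! ((i + 1) mod length xs))" if "i < length xs" for i
  proof (cases "Suc i = length xs")
    case True
    then have "i = length xs - 1" by simp
    then have "xs ! i = v" "(i + 1) mod length xs = 0" using h True by auto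
    then show ?thesis using assms(1) h by (simp add: adj_def)
  next
    case False
    then show ?thesis using that xs(5)[of i] by (auto simp: adj_def)
  qed
  then show ?thesis unfolding has_cycle_def using l xs(4) by blast
qed

section \<open>Spanning trees and the exchange argument\<close>

lemma connected_on_mono: "A \<subseteq> B \<Longrightarrow> connected_on V A \<Longrightarrow> connected_on V B"
  unfolding connected_on_cn using cn_mono by blast

lemma connected_on_cnI: "A \<subseteq> cn B \<Longrightarrow> connected_on V A \<Longrightarrow> connected_on V B"
  unfolding connected_on_cn using cn_subset by blast

lemma subset_cn: "f \<in> cn U \<Longrightarrow> T - {f} \<subseteq> U \<Longrightarrow> T \<subseteq> cn U"
  using cn_edge[of _ U] by auto

text \<open>A connected subset of least cardinality has no cycle, since an edge of a cycle could be
  removed from it.\<close>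

lemma spanning_tree_in_connected:
  assumes "finite F" "connected_on V F"
  shows "\<exists>T\<subseteq>F. spanning_tree V F T"
proof -
  have "\<exists>T. (T \<subseteq> F \<and> connected_on V T) \<and> (\<forall>T'. T' \<subseteq> F \<and> connected_on V T' \<longrightarrow> card T \<le> card T')"
    by (rule ex_has_least_nat[of "\<lambda>T. T \<subseteq> F \<and> connected_on V T" F card]) (use assms in simp)
  then obtain T where T: "T \<subseteq> F" "connected_on V T"
    and least: "\<forall>T'. T' \<subseteq> F \<and> connected_on V T' \<longrightarrow> card T \<le> card T'"
    by (elim exE conjE) (rule that)
  have "\<not> has_cycle T"
  proof
    assume "has_cycle T"
    from has_cycle_edges[OF this] obtain C where C: "C \<subseteq> T" "C \<noteq> {}" "\<forall>e\<in>C. e \<in> cn (C - {e})" by (elim exE conjE) (rule that)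
    then obtain e where e: "e \<in> C" by auto
    have eC: "e \<in> cn (C - {e})" by (rule bspec[OF C(3) e])
    have "e \<in> cn (T - {e})" using subsetD[OF cn_mono[of "C - {e}" "T - {e}"] eC] C(1) by auto
    then have "T \<subseteq> cn (T - {e})" by (rule subset_cn) simp
    then have "connected_on V (T - {e})" using T(2) by (rule connected_on_cnI)
    moreover have "T - {e} \<subseteq> F" using T(1) by auto
    ultimately have "card T \<le> card (T - {e})" by (intro least[rule_format] conjI)
    moreover have "card (T - {e}) < card T" using e C(1) finite_subset[OF T(1) assms(1)] by (intro card_Diff1_less) auto
    ultimately show False by simp
  qed
  then show ?thesis using T by (auto simp: spanning_tree_def)
qed

lemma has_spanning_tree_iff:
  "finite F \<Longrightarrow> has_spanning_tree n F \<longleftrightarrow> connected_on {..<n} F"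
  unfolding has_spanning_tree_def using spanning_tree_in_connected connected_on_mono
  by (metis spanning_tree_def)

text \<open>A static form of the greedy rule. Its condition is the negation of the one in
  \<open>lev\<close>, so at each level these are the edges that do not move on to the next.\<close>

definition kruskal :: "(nat \<times> nat \<Rightarrow> real) \<Rightarrow> (nat \<times> nat) set \<Rightarrow> (nat \<times> nat) set" where
  "kruskal c F = {e \<in> F. e \<notin> cn {f \<in> F. c f < c e}}"

context
  fixes n :: nat and F :: "(nat \<times> nat) set" and c :: "nat \<times> nat \<Rightarrow> real"
  assumes F: "F \<subseteq> Kedges n" and inj: "inj_on c F" and pos: "\<And>e. e \<in> F \<Longrightarrow> 0 < c e"
    and conn: "connected_on {..<n} F"
begin

lemma finF: "finite F"
  using F finite_Kedges finite_subset by blast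

text \<open>Induction on the rank of the cost: a rejected edge is bridged by cheaper edges, and each
  of these by Kruskal edges that are no costlier than itself.\<close>

lemma kru_spans: "e \<in> F \<Longrightarrow> e \<in> cn {f \<in> kruskal c F. c f \<le> c e}"
proof (induction "card {f \<in> F. c f < c e}" arbitrary: e rule: less_induct)
  case less
  show ?case
  proof (cases "e \<in> kruskal c F")
    case True
    then show ?thesis by (intro cn_edge) simp
  next
    case False
    then have "e \<in> cn {f \<in> F. c f < c e}" using less.prems by (simp add: kruskal_def)
    moreover have "{f \<in> F. c f < c e} \<subseteq> cn {f \<in> kruskal c F. c f \<le> c e}"
    proof
      fix f assume f: "f \<in> {f \<in> F. c f < c e}"
      then have "{g \<in> F. c g < c f} \<subset> {g \<in> F. c g < c e}" by auto
      then have "card {g \<in> F. c g < c f} < card {g \<in> F. c g < c e}" using finF by (intro psubset_card_mono) auto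
      from less.hyps[OF this] f have "f \<in> cn {g \<in> kruskal c F. c g \<le> c f}" by simp
      also have "\<dots> \<subseteq> cn {g \<in> kruskal c F. c g \<le> c e}" using f by (intro cn_mono) auto
      finally show "f \<in> cn {f \<in> kruskal c F. c f \<le> c e}" .
    qed
    ultimately show ?thesis using cn_subset by blast
  qed
qed

lemma kru_cn: "F \<subseteq> cn (kruskal c F)"
  using kru_spans cn_mono[of "{f \<in> kruskal c F. c f \<le> c e}" "kruskal c F" for e] by blast

lemma kru_subset: "kruskal c F \<subseteq> F"
  by (auto simp: kruskal_def)

text \<open>Exchange argument. A Kruskal edge missing from \<open>T\<close> is bridged in
  \<open>T\<close> by a path with a costlier edge; swapping the two gives a cheaper connected set
  and, costs being positive, a cheaper spanning tree inside it. Once \<open>T\<close> contains all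
  Kruskal edges, any further edge of \<open>T\<close> closes a cycle with them.\<close>

lemma min_tree_eq_kru:
  assumes T: "spanning_tree {..<n} F T"
    and min: "\<And>T'. spanning_tree {..<n} F T' \<Longrightarrow> weight c T \<le> weight c T'"
  shows "T = kruskal c F"
proof
  have TF: "T \<subseteq> F" and Tc: "connected_on {..<n} T" and Tn: "\<not> has_cycle T"
    using T by (auto simp: spanning_tree_def)
  have finT: "finite T" using TF finF finite_subset by blast
  show KT: "kruskal c F \<subseteq> T"
  proof (rule ccontr)
    assume "\<not> kruskal c F \<subseteq> T"
    then obtain u v where e: "(u, v) \<in> kruskal c F" "(u, v) \<notin> T" by auto
    have eF: "(u, v) \<in> F" using e kru_subset by blast
    then have uv: "u < n" "v < n" using F by (auto simp: Kedges_def)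
    then have "(u, v) \<in> cn T" using Tc by (auto simp: connected_on_cn)
    \<comment> \<open>A minimal connecting set stands in for a simple path: removing any of its
      edges separates \<open>u\<close> from \<open>v\<close>.\<close>
    then have "\<exists>P. (P \<subseteq> T \<and> (u, v) \<in> cn P) \<and> (\<forall>P'. P' \<subseteq> T \<and> (u, v) \<in> cn P' \<longrightarrow> card P \<le> card P')"
      by (intro ex_has_least_nat[of "\<lambda>P. P \<subseteq> T \<and> (u, v) \<in> cn P" T card]) simp
    then obtain P where P: "P \<subseteq> T" "(u, v) \<in> cn P" "\<And>P'. P' \<subseteq> T \<Longrightarrow> (u, v) \<in> cn P' \<Longrightarrow> card P \<le> card P'" by blast
    have "\<not> P \<subseteq> {f \<in> F. c f < c (u, v)}"
      using P(2) e(1) cn_mono[of P "{f \<in> F. c f < c (u, v)}"] by (auto simp: kruskal_def)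
    then obtain f where f: "f \<in> P" "\<not> c f < c (u, v)" using P(1) TF by blast
    have fF: "f \<in> F" "f \<noteq> (u, v)" "f \<in> T" using f P TF e by auto
    have "c f \<noteq> c (u, v)" using inj_onD[OF inj _ fF(1) eF] fF by blast
    then have cf: "c (u, v) < c f" using f by linarith
    obtain a b where ab: "f = (a, b)" by (cases f)
    have np: "(u, v) \<notin> cn (P - {f})"
    proof
      assume "(u, v) \<in> cn (P - {f})"
      then have "card P \<le> card (P - {f})" using P(1) by (intro P(3)) auto
      moreover have "card (P - {f}) < card P" using f(1) finite_subset[OF P(1) finT] by (intro card_Diff1_less) auto
      ultimately show False by simp
    qed
    have "insert (a, b) (P - {f}) = P" using f ab by auto
    with P(2) have "(u, v) \<in> cn (insert (a, b) (P - {f}))" by simp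
    with np have "(u, a) \<in> cn (P - {f}) \<and> (b, v) \<in> cn (P - {f}) \<or> (u, b) \<in> cn (P - {f}) \<and> (a, v) \<in> cn (P - {f})"
      unfolding cn_insert by blast
    then have "(a, u) \<in> cn (P - {f}) \<and> (v, b) \<in> cn (P - {f}) \<or> (a, v) \<in> cn (P - {f}) \<and> (u, b) \<in> cn (P - {f})"
      using cn_sym by blast
    then have "(a, b) \<in> cn (insert (u, v) (P - {f}))" unfolding cn_insert by blast
    also have "\<dots> \<subseteq> cn (insert (u, v) (T - {f}))" using P(1) by (intro cn_mono) auto
    finally have "f \<in> cn (insert (u, v) (T - {f}))" using ab by simp
    then have "T \<subseteq> cn (insert (u, v) (T - {f}))" by (rule subset_cn) auto
    then have "connected_on {..<n} (insert (u, v) (T - {f}))" using Tc by (rule connected_on_cnI)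
    then obtain T' where T': "T' \<subseteq> insert (u, v) (T - {f})" "spanning_tree {..<n} (insert (u, v) (T - {f})) T'"
      using spanning_tree_in_connected[of "insert (u, v) (T - {f})"] finT by auto
    have sub: "insert (u, v) (T - {f}) \<subseteq> F" using TF eF by auto
    then have "spanning_tree {..<n} F T'" using T' by (auto simp: spanning_tree_def)
    from min[OF this] have "weight c T \<le> weight c T'" .
    also have "\<dots> \<le> weight c (insert (u, v) (T - {f}))"
      unfolding weight_def 
    proof (rule sum_mono2)
      fix g assume "g \<in> insert (u, v) (T - {f}) - T'"
      then have "g \<in> F" using sub by blast
      then show "0 \<le> c g" by (rule less_imp_le[OF pos])
    qed (use T'(1) finT in auto)
    also have "\<dots> = c (u, v) + (weight c T - c f)"
      unfolding weight_def using e(2) finT fF(3) by (simp add: sum_diff1)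
    finally show False using cf by simp
  qed
  show "T \<subseteq> kruskal c F"
  proof (rule ccontr)
    assume "\<not> T \<subseteq> kruskal c F"
    then obtain u v where e: "(u, v) \<in> T" "(u, v) \<notin> kruskal c F" by auto
    have "u < v" using e TF F by (auto simp: Kedges_def)
    moreover have "(v, u) \<notin> T"
    proof
      assume "(v, u) \<in> T"
      then have "v < u" using TF F by (auto simp: Kedges_def)
      then show False using \<open>u < v\<close> by simp
    qed
    moreover have "(u, v) \<in> cn (T - {(u, v)})"
      using kru_cn e TF KT cn_mono[of "kruskal c F" "T - {(u, v)}"] by blast
    ultimately have "has_cycle T" using e by (intro has_cycleI) auto
    then show False using Tn by simp
  qed
qed

text \<open>For distinct positive costs there is exactly one minimiser, so the selection in
  \<open>mst\<close> returns it.\<close>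

lemma mst_eq_kru: "mst n F c = kruskal c F"
proof -
  let ?A = "{T. spanning_tree {..<n} F T}"
  have "?A \<subseteq> Pow F" by (auto simp: spanning_tree_def)
  then have fin: "finite ?A" using finF finite_subset by blast
  obtain T0 where "T0 \<in> ?A" using spanning_tree_in_connected[OF finF conn] by blast
  then have ne: "?A \<noteq> {}" by blast
  obtain T where T: "T \<in> ?A" "\<And>T'. T' \<in> ?A \<Longrightarrow> weight c T \<le> weight c T'"
    using arg_min_if_finite(1)[OF fin ne, of "weight c"] arg_min_least[OF fin ne, of _ "weight c"] by blast
  have "T = kruskal c F" using T by (intro min_tree_eq_kru) auto
  have "{T. spanning_tree {..<n} F T \<and> (\<forall>T'. spanning_tree {..<n} F T' \<longrightarrow> weight c T \<le> weight c T')} = {kruskal c F}"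
    using T \<open>T = kruskal c F\<close> min_tree_eq_kru by blast
  then show ?thesis
    unfolding mst_def arg_min_on_def arg_min_def is_arg_min_def by (auto intro!: some_equality)
qed

end

text \<open>Connectivity is assumed at level \<open>k\<close> alone because the lower levels contain
  that one. It guarantees that every graph up to that stage has a spanning tree, which is then the
  Kruskal tree.\<close>

lemma avail_eq_lev:
  assumes inj: "inj_on c (Kedges n)" and pos: "\<And>e. e \<in> Kedges n \<Longrightarrow> 0 < c e"
    and conn: "connected_on {..<n} (lev c (Kedges n) k)" and j: "j \<le> Suc k"
  shows "avail n c j = lev c (Kedges n) j"
  using j
proof (induction j)
  case (Suc j)
  let ?F = "lev c (Kedges n) j"
  have F: "?F \<subseteq> Kedges n" by (rule lev_subset)
  have "lev c (Kedges n) k \<subseteq> ?F"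
    by (rule lift_Suc_antimono_le[of "lev c (Kedges n)"]) (use Suc.prems in auto)
  then have cF: "connected_on {..<n} ?F" using conn by (rule connected_on_mono)
  have finF: "finite ?F" using F finite_Kedges finite_subset by blast
  have injF: "inj_on c ?F" using inj F inj_on_subset by blast
  have posF: "0 < c e" if "e \<in> ?F" for e using pos F that by blast
  have "mst n ?F c = {e \<in> ?F. e \<notin> cn {f \<in> ?F. c f < c e}}"
    using mst_eq_kru[OF F injF posF cF] unfolding kruskal_def .
  then show ?case using Suc cF finF by (auto simp: has_spanning_tree_iff)
qed simp

lemma wT_eq_lev:
  assumes inj: "inj_on c (Kedges n)" and pos: "\<And>e. e \<in> Kedges n \<Longrightarrow> 0 < c e"
    and conn: "connected_on {..<n} (lev c (Kedges n) k)"
  shows "wT (Suc k) n c = ereal (weight c (lev c (Kedges n) k - lev c (Kedges n) (Suc k)))"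
proof -
  let ?F = "lev c (Kedges n) k"
  have F: "?F \<subseteq> Kedges n" by (rule lev_subset)
  have finF: "finite ?F" using F finite_Kedges finite_subset by blast
  have a: "avail n c k = ?F" by (rule avail_eq_lev[OF inj pos conn]) simp_all
  have b: "avail n c (Suc k) = lev c (Kedges n) (Suc k)" by (rule avail_eq_lev[OF inj pos conn]) simp_all
  have h: "has_spanning_tree n ?F" using conn finF by (simp add: has_spanning_tree_iff)
  have injF: "inj_on c ?F" using inj F inj_on_subset by blast
  have posF: "0 < c e" if "e \<in> ?F" for e using pos F that by blast
  have m: "mst n ?F c = {e \<in> ?F. e \<notin> cn {f \<in> ?F. c f < c e}}"
    using mst_eq_kru[OF F injF posF conn] unfolding kruskal_def .
  have "?F - lev c (Kedges n) (Suc k) = mst n ?F c" unfolding m by auto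
  then show ?thesis using a h by (simp add: wT_def)
qed

text \<open>Each accepted edge lowers the number \<open>n * kap\<close> of components by 1, starting
  from \<open>n\<close>. The induction adds the costliest edge last, so that
  \<open>lev_insert\<close> applies.\<close>

lemma card_forest:
  assumes "A \<subseteq> Kedges n" "inj_on c A" "n \<ge> 1"
  shows "real (card (lev c A j - lev c A (Suc j))) = n - n * kap n (Suc j) (lev c A)"
proof -
  have "finite A" using assms(1) finite_Kedges finite_subset by blast
  then show ?thesis using assms(1,2)
  proof (induction A rule: finite_ranking_induct[where f=c])
    case empty
    have "sz n (\<lambda>_. {}) (Suc j) u = 1" if "u < n" for u
    proof -
      have "cn {} = Id" by (simp add: cn_def adj_def)
      then have "blk n (\<lambda>_. {}) (Suc j) u = {u}" using that by (auto simp: blk_def rl.simps)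
      then show ?thesis by (simp add: sz_def)
    qed
    then have "kap n (Suc j) (\<lambda>_. {}) = avg n (\<lambda>_. 1)"
      unfolding kap_def stat_def by (intro avg_cong) simp
    moreover have "lev c {} = (\<lambda>_. {})" by (simp add: fun_eq_iff lev_empty)
    ultimately show ?case using assms(3) by simp
  next
    case (insert e A)
    show ?case
    proof (cases "e \<in> A")
      case True
      then show ?thesis using insert by (simp add: insert_absorb)
    next
      case False
      have lt: "c f < c e" if "f \<in> A" for f
        using insert.hyps(2)[OF that] inj_onD[OF insert.prems(2), of f e] that False by force
      have lev: "lev c (insert e A) = ad e (lev c A)" by (rule lev_insert) (rule lt)
      have eL: "e \<notin> lev c A i" for i using False subsetD[OF lev_subset[of c A i]] by blast
      have eK: "e \<in> Kedges n" using insert.prems by simp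
      have IH: "real (card (lev c A j - lev c A (Suc j))) = n - n * kap n (Suc j) (lev c A)"
        by (rule insert.IH) (use insert.prems in \<open>auto intro: inj_on_subset\<close>)
      have fin: "finite (lev c A j)" by (rule finite_subset[OF lev_subset insert.hyps(1)])
      have sub: "rl (lev c A) (Suc j) \<subseteq> rl (lev c A) j"
        using insert.prems by (intro rl_Suc_subset[OF good_lev]) auto
      show ?thesis
      proof (cases "acc (lev c A) j e")
        case True
        then have "ad e (lev c A) j = insert e (lev c A j)" "ad e (lev c A) (Suc j) = lev c A (Suc j)"
          by (simp_all add: ad_def acc_def del: lev.simps)
        then have "ad e (lev c A) j - ad e (lev c A) (Suc j) = insert e (lev c A j - lev c A (Suc j))"
          using eL[of "Suc j"] by (simp add: insert_Diff_if del: lev.simps)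
        then have "real (card (ad e (lev c A) j - ad e (lev c A) (Suc j))) = 1 + real (card (lev c A j - lev c A (Suc j)))"
          using fin eL[of j] by simp
        moreover have "n * kap n (Suc j) (ad e (lev c A)) = n * kap n (Suc j) (lev c A) - 1"
          using True assms(3) by (simp add: kap_ad[OF eK] right_diff_distrib)
        ultimately show ?thesis unfolding lev using IH by simp
      next
        case False
        then have "e \<in> rl (lev c A) j \<longleftrightarrow> e \<in> rl (lev c A) (Suc j)" using sub by (auto simp: acc_def simp del: lev.simps)
        then have "ad e (lev c A) j - ad e (lev c A) (Suc j) = lev c A j - lev c A (Suc j)"
          using eL[of j] by (auto simp: ad_def simp del: lev.simps)
        moreover have "kap n (Suc j) (ad e (lev c A)) = kap n (Suc j) (lev c A)"
          using False by (simp add: kap_ad[OF eK])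
        ultimately show ?thesis unfolding lev using IH by simp
      qed
    qed
  qed
qed

lemma grid_count:
  fixes a y :: real
  assumes "0 < a" "0 < y" "y \<le> real R * a"
  shows "a * card {r \<in> {1..R}. real r * a < y} \<le> y" "y \<le> a * card {r \<in> {1..R}. real r * a < y} + a"
proof -
  define m where "m = nat (\<lceil>y / a\<rceil> - 1)"
  have c1: "1 \<le> \<lceil>y / a\<rceil>" using assms by (simp add: one_le_ceiling)
  then have m: "real m = \<lceil>y / a\<rceil> - 1" by (simp add: m_def)
  have ub: "y / a \<le> real m + 1" and lb: "real m < y / a" unfolding m by linarith+
  have "y / a \<le> real R" using assms by (simp add: divide_le_eq)
  then have mR: "m < R" using lb by linarith
  have "{r \<in> {1..R}. real r * a < y} = {1..m}"
  proof (rule set_eqI)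
    fix r
    have "real r * a < y \<longleftrightarrow> real r < y / a" using assms by (simp add: less_divide_eq)
    also have "\<dots> \<longleftrightarrow> r \<le> m"
    proof
      assume "real r < y / a"
      then have "real r < real m + 1" using ub by linarith
      then show "r \<le> m" by linarith
    next
      assume "r \<le> m" then show "real r < y / a" using lb by linarith
    qed
    finally show "r \<in> {r \<in> {1..R}. real r * a < y} \<longleftrightarrow> r \<in> {1..m}" using mR by auto
  qed
  then have c: "card {r \<in> {1..R}. real r * a < y} = m" by simp
  show "a * card {r \<in> {1..R}. real r * a < y} \<le> y" unfolding c using lb assms by (simp add: less_divide_eq mult.commute)
  show "y \<le> a * card {r \<in> {1..R}. real r * a < y} + a" unfolding c using ub assms by (simp add: divide_le_eq algebra_simps)
qed

text \<open>The layer-cake formula on a grid: the cost of the tree is the integral over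
  \<open>t\<close> of the number of its edges costing more than \<open>t\<close>, which is the
  number of components at time \<open>t\<close> minus 1. Each of fewer than \<open>n\<close> edges
  is rounded by at most the mesh \<open>\<delta> / n\<close>. The hypothesis \<open>full\<close>
  says that the tree is complete when the grid ends.\<close>

lemma wT_grid:
  assumes inj: "inj_on c (Kedges n)" and pos: "\<And>e. e \<in> Kedges n \<Longrightarrow> 0 < c e" and n: "n \<ge> 1"
    and \<delta>: "0 < \<delta>" and full: "mxf n (Suc k) (St n c (real R * \<delta> / n)) = 0"
  shows "\<exists>w. wT (Suc k) n c = ereal w \<and>
    \<bar>w - \<delta> * (\<Sum>r\<in>{1..R}. kap n (Suc k) (St n c (real r * \<delta> / n)) - 1 / n)\<bar> \<le> \<delta>"
proof -
  define E where "E = Kedges n"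
  define T where "T = lev c E k - lev c E (Suc k)"
  define a where "a = \<delta> / n"
  have a: "0 < a" using \<delta> n by (simp add: a_def)
  have finE: "finite E" by (simp add: E_def)
  have finT: "finite T" unfolding T_def by (rule finite_Diff) (rule finite_subset[OF lev_subset finE])
  have cnt: "real (card {e \<in> T. c e \<le> t}) = n - n * kap n (Suc k) (St n c t)" for t
  proof -
    have "{e \<in> T. c e \<le> t} = lev c {e \<in> E. c e \<le> t} k - lev c {e \<in> E. c e \<le> t} (Suc k)"
      unfolding lev_restrict T_def by (auto simp del: lev.simps)
    moreover have "real (card (lev c {e \<in> E. c e \<le> t} k - lev c {e \<in> E. c e \<le> t} (Suc k))) = n - n * kap n (Suc k) (lev c {e \<in> E. c e \<le> t})"
      by (rule card_forest) (use inj n in \<open>auto simp: E_def intro: inj_on_subset\<close>)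
    ultimately show ?thesis by (simp add: St_def E_def)
  qed
  have all: "real (card T) = n - n * kap n (Suc k) (lev c E)"
    unfolding T_def by (rule card_forest) (use inj n in \<open>auto simp: E_def\<close>)
  have kap1: "1 \<le> n * kap n (Suc k) S" for S
  proof -
    have "avg n (\<lambda>_. 1 / n) \<le> kap n (Suc k) S"
      unfolding kap_def stat_def
    proof (rule avg_mono)
      fix u assume "u < n"
      then show "1 / real n \<le> 1 / real (sz n S (Suc k) u)"
        using sz_pos[of u n S "Suc k"] sz_le[of n S "Suc k" u] by (intro divide_left_mono) auto
    qed
    then show ?thesis using n by (simp add: divide_le_eq mult.commute)
  qed
  let ?t = "real R * \<delta> / n"
  have tR: "?t = real R * a" by (simp add: a_def)
  have "n * kap n (Suc k) (St n c ?t) \<le> 1" using kap_mxf[OF n, of "Suc k" "St n c ?t"] full by simp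
  then have full1: "real (card {e \<in> T. c e \<le> ?t}) = real n - 1" using cnt[of ?t] kap1[of "St n c ?t"] by simp
  have "card {e \<in> T. c e \<le> ?t} \<le> card T" using finT by (intro card_mono) auto
  then have cT: "real (card T) = real n - 1" using full1 all kap1[of "lev c E"] by linarith
  have "card {e \<in> T. c e \<le> ?t} = card T" using cT full1 by linarith
  then have Tall: "{e \<in> T. c e \<le> ?t} = T" by (intro card_subset_eq finT) auto
  have Tle: "c e \<le> real R * a" if "e \<in> T" for e
  proof -
    have "e \<in> {e \<in> T. c e \<le> ?t}" using that unfolding Tall .
    then show ?thesis using tR by simp
  qed
  have Tpos: "0 < c e" if "e \<in> T" for e
  proof -
    have "e \<in> lev c E k" using that by (simp add: T_def del: lev.simps)
    then have "e \<in> E" by (rule subsetD[OF lev_subset])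
    then show ?thesis using pos by (simp add: E_def)
  qed
  have rl_full: "(u, v) \<in> rl (St n c ?t) (Suc k)" if uv: "u < n" "v < n" for u v
  proof -
    have "Max (sz n (St n c ?t) (Suc k) ` {..<n}) = n" using full by (simp add: mxf_def)
    then obtain w where w: "w < n" "sz n (St n c ?t) (Suc k) w = n" using Max_sz_witness[OF n] by metis
    have "blk n (St n c ?t) (Suc k) w = {..<n}"
      using w blk_subset by (intro card_subset_eq) (auto simp: sz_def)
    then have "u \<in> blk n (St n c ?t) (Suc k) w" "v \<in> blk n (St n c ?t) (Suc k) w" using uv by auto
    then have "(w, u) \<in> rl (St n c ?t) (Suc k)" "(w, v) \<in> rl (St n c ?t) (Suc k)" by (auto simp: blk_def)
    then show ?thesis using rl_sym rl_trans by blast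
  qed
  have "connected_on {..<n} (lev c E k)"
  proof -
    have "cn (lev c {e \<in> E. c e \<le> ?t} k) \<subseteq> cn (lev c E k)" unfolding lev_restrict by (intro cn_mono) auto
    then show ?thesis using rl_full unfolding connected_on_cn by (auto simp: rl.simps St_def E_def)
  qed
  then have w: "wT (Suc k) n c = ereal (weight c T)"
    unfolding T_def E_def by (intro wT_eq_lev inj pos)
  have "(\<Sum>e\<in>T. a * card {r \<in> {1..R}. real r * a < c e}) = a * (\<Sum>r\<in>{1..R}. real (card {e \<in> T. real r * a < c e}))"
  proof -
    have "(\<Sum>e\<in>T. real (card {r \<in> {1..R}. real r * a < c e})) = (\<Sum>e\<in>T. \<Sum>r\<in>{1..R}. of_bool (real r * a < c e))"
      by (intro sum.cong refl) (simp add: of_bool_def sum.If_cases Int_def)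
    also have "\<dots> = (\<Sum>r\<in>{1..R}. \<Sum>e\<in>T. of_bool (real r * a < c e))" by (rule sum.swap)
    also have "\<dots> = (\<Sum>r\<in>{1..R}. real (card {e \<in> T. real r * a < c e}))"
      using finT by (intro sum.cong refl) (simp add: of_bool_def sum.If_cases Int_def)
    finally show ?thesis by (simp add: sum_distrib_left[symmetric])
  qed
  also have "\<dots> = a * (\<Sum>r\<in>{1..R}. n * kap n (Suc k) (St n c (real r * \<delta> / n)) - 1)"
  proof (intro arg_cong[where f="(*) a"] sum.cong refl)
    fix r
    have "card T = card {e \<in> T. real r * a < c e} + card {e \<in> T. c e \<le> real r * a}"
    proof -
      have "T = {e \<in> T. real r * a < c e} \<union> {e \<in> T. c e \<le> real r * a}" by auto
      then show ?thesis using finT by (subst card_Un_disjoint[symmetric]) auto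
    qed
    then show "real (card {e \<in> T. real r * a < c e}) = n * kap n (Suc k) (St n c (real r * \<delta> / n)) - 1"
      using cT cnt[of "real r * a"] by (simp add: a_def)
  qed
  also have "\<dots> = \<delta> * (\<Sum>r\<in>{1..R}. kap n (Suc k) (St n c (real r * \<delta> / n)) - 1 / n)"
    using n by (simp add: a_def sum_distrib_left right_diff_distrib)
  finally have eq: "(\<Sum>e\<in>T. a * card {r \<in> {1..R}. real r * a < c e}) = \<delta> * (\<Sum>r\<in>{1..R}. kap n (Suc k) (St n c (real r * \<delta> / n)) - 1 / n)" .
  have lo: "(\<Sum>e\<in>T. a * card {r \<in> {1..R}. real r * a < c e}) \<le> weight c T"
    unfolding weight_def
  proof (rule sum_mono)
    fix e assume "e \<in> T"
    from grid_count(1)[OF a Tpos[OF this] Tle[OF this]]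
    show "a * card {r \<in> {1..R}. real r * a < c e} \<le> c e" .
  qed
  have "weight c T \<le> (\<Sum>e\<in>T. a * card {r \<in> {1..R}. real r * a < c e} + a)"
    unfolding weight_def
  proof (rule sum_mono)
    fix e assume "e \<in> T"
    from grid_count(2)[OF a Tpos[OF this] Tle[OF this]]
    show "c e \<le> a * card {r \<in> {1..R}. real r * a < c e} + a" .
  qed
  also have "\<dots> = (\<Sum>e\<in>T. a * card {r \<in> {1..R}. real r * a < c e}) + card T * a" by (simp add: sum.distrib)
  also have "card T * a \<le> n * a" using cT a by (intro mult_right_mono) auto
  also have "n * a = \<delta>" using n by (simp add: a_def)
  finally have "\<bar>weight c T - \<delta> * (\<Sum>r\<in>{1..R}. kap n (Suc k) (St n c (real r * \<delta> / n)) - 1 / n)\<bar> \<le> \<delta>"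
    using lo unfolding eq by simp
  then show ?thesis using w by blast
qed

section \<open>The two cost distributions\<close>

lemma cost_dist_unif01: "cost_dist unif01"
proof -
  have 1: "emeasure lborel {0<..<1 :: real} = 1" by simp
  have P: "prob_space unif01" unfolding unif01_def by (rule prob_space_uniform_measure) simp_all
  have m: "measure unif01 A = measure lborel ({0<..<1} \<inter> A)" if "A \<in> sets borel" for A
    unfolding unif01_def using that by (simp add: measure_uniform_measure)
  have ioc: "measure unif01 {a<..b} = b - a" if "0 \<le> a" "a \<le> b" "b \<le> 1/2" for a b
  proof -
    have "{0<..<1} \<inter> {a<..b} = {a<..b}" using that by auto
    then show ?thesis using that by (simp add: m)
  qed
  have "{0<..<1} \<inter> {..0 :: real} = {}" by auto
  then have "measure unif01 {..0} = 0" by (simp add: m)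
  moreover have "measure unif01 {x} = 0" for x
    by (cases "0 < x \<and> x < 1") (auto simp: m)
  moreover have "\<exists>F p. (\<forall>a b. 0 \<le> a \<longrightarrow> a \<le> b \<longrightarrow> b \<le> 1/2 \<longrightarrow> measure unif01 {a<..b} = F b - F a) \<and>
      (\<forall>t\<in>{0..1/2 :: real}. (F has_real_derivative p t) (at t within {0..1/2}) \<and> 1 - t \<le> p t \<and> p t \<le> 1)"
    by (rule exI[of _ "\<lambda>x. x"], rule exI[of _ "\<lambda>x. 1"]) (auto simp: ioc)
  ultimately show ?thesis
    unfolding cost_dist_def using P by (auto simp: unif01_def)
qed

lemma cost_dist_exp1: "cost_dist exp1"
proof -
  have P: "prob_space exp1" unfolding exp1_def by (rule prob_space_exponential_density) simp
  interpret prob_space exp1 by (rule P)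
  have s: "sets exp1 = sets borel" by (simp add: exp1_def)
  have sp: "space exp1 = UNIV" by (simp add: exp1_def)
  have "distributed exp1 lborel (\<lambda>x. x) (exponential_density 1)"
    unfolding distributed_def
  proof (intro conjI)
    show "distr exp1 lborel (\<lambda>x. x) = density lborel (exponential_density 1)"
      unfolding exp1_def[symmetric] by (rule distr_id2) (simp add: exp1_def)
  qed (simp_all add: exp1_def)
  from exponential_distributed_memoryless[OF this] exponential_distributedD_le[OF this]
  have le: "measure exp1 {..a} = 1 - exp (- a)" if "0 \<le> a" for a
    using that sp by (simp add: atMost_def)
  have ioc: "measure exp1 {a<..b} = - exp (- b) - - exp (- a)" if "0 \<le> a" "a \<le> b" for a b
  proof -
    have "measure exp1 ({..b} - {..a}) = measure exp1 {..b} - measure exp1 {..a}"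
      using that by (intro finite_measure_Diff) (auto simp: s)
    moreover have "{..b} - {..a} = {a<..b}" by auto
    ultimately show ?thesis using that by (simp add: le)
  qed
  have "measure exp1 {x} = 0" for x
  proof -
    have "absolutely_continuous lborel exp1" unfolding exp1_def by (rule absolutely_continuousI_density) simp
    moreover have "{x} \<in> null_sets lborel" by (simp add: null_sets_def)
    ultimately have "{x} \<in> null_sets exp1" unfolding absolutely_continuous_def by blast
    then show ?thesis by (simp add: null_sets_def measure_def)
  qed
  moreover have "\<exists>F p. (\<forall>a b. 0 \<le> a \<longrightarrow> a \<le> b \<longrightarrow> b \<le> 1/2 \<longrightarrow> measure exp1 {a<..b} = F b - F a) \<and>
      (\<forall>t\<in>{0..1/2 :: real}. (F has_real_derivative p t) (at t within {0..1/2}) \<and> 1 - t \<le> p t \<and> p t \<le> 1)"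
  proof (rule exI[of _ "\<lambda>x. - exp (- x)"], rule exI[of _ "\<lambda>x. exp (- x)"], intro conjI ballI allI impI)
    fix t :: real assume "t \<in> {0..1/2}"
    show "((\<lambda>x. - exp (- x)) has_real_derivative exp (- t)) (at t within {0..1/2})"
      by (rule derivative_eq_intros refl | simp)+
    show "1 - t \<le> exp (- t)" using exp_ge_add_one_self[of "- t"] by simp
    show "exp (- t) \<le> 1" using \<open>t \<in> {0..1/2}\<close> by simp
  qed (simp add: ioc)
  ultimately show ?thesis
    unfolding cost_dist_def using P s le[of 0] by simp
qed

section \<open>Measurability of the costs of the successive trees\<close>

context
  fixes n :: nat and D :: "real measure"
  assumes D: "cost_dist D"
begin

lemma measurable_weight: "(\<lambda>c. weight c T) \<in> borel_measurable (cost_space n D)" if "T \<subseteq> Kedges n"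
  unfolding weight_def using that measurable_cost[OF D] by (intro borel_measurable_sum) auto

text \<open>The tie-breaking choice made by \<open>mst\<close> is a function of this finite comparison table.\<close>

definition better :: "(nat \<times> nat) set \<Rightarrow> (nat \<times> nat \<Rightarrow> real) \<Rightarrow> ((nat \<times> nat) set \<times> (nat \<times> nat) set) set" where
  "better F c = {z \<in> Pow F \<times> Pow F. weight c (fst z) \<le> weight c (snd z)}"

lemma measurable_better:
  assumes F: "F \<subseteq> Kedges n"
  shows "better F \<in> measurable (cost_space n D) (count_space (Pow (Pow F \<times> Pow F)))"
proof (rule measurable_finite_set_valued)
  show "finite (Pow F \<times> Pow F)" using F finite_subset[OF F] by simp
  fix z assume z: "z \<in> Pow F \<times> Pow F"
  then have [measurable]: "(\<lambda>c. weight c (fst z)) \<in> borel_measurable (cost_space n D)"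
    "(\<lambda>c. weight c (snd z)) \<in> borel_measurable (cost_space n D)"
    using F by (auto intro!: measurable_weight)
  have "{c \<in> space (cost_space n D). weight c (fst z) \<le> weight c (snd z)} \<in> sets (cost_space n D)" by measurable
  then show "{c \<in> space (cost_space n D). z \<in> better F c} \<in> sets (cost_space n D)"
    using z by (simp add: better_def)
qed (auto simp: better_def)

definition tie :: "(nat \<times> nat) set \<Rightarrow> ((nat \<times> nat) set \<times> (nat \<times> nat) set) set \<Rightarrow> (nat \<times> nat) set" where
  "tie F z = arg_min_on (\<lambda>T. to_nat (sorted_list_of_set (prod_encode ` T)))
     {T. spanning_tree {..<n} F T \<and> (\<forall>T'. spanning_tree {..<n} F T' \<longrightarrow> (T, T') \<in> z)}"

lemma mst_eq_tie: "mst n F c = tie F (better F c)"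
  unfolding mst_def tie_def better_def
  by (rule arg_cong2[where f=arg_min_on]) (auto simp: spanning_tree_def)

lemma mst_subset:
  assumes F: "F \<subseteq> Kedges n" and h: "has_spanning_tree n F"
  shows "mst n F c \<subseteq> F"
proof -
  let ?A = "{T. spanning_tree {..<n} F T}"
  let ?P = "\<lambda>T. T \<in> {T. spanning_tree {..<n} F T \<and> (\<forall>T'. spanning_tree {..<n} F T' \<longrightarrow> weight c T \<le> weight c T')}"
  have "?A \<subseteq> Pow F" by (auto simp: spanning_tree_def)
  then have fin: "finite ?A" using finite_subset[OF F finite_Kedges] by (meson finite_Pow_iff finite_subset)
  have ne: "?A \<noteq> {}" using h by (auto simp: has_spanning_tree_def)
  have "?P (arg_min_on (weight c) ?A)"
    using arg_min_if_finite(1)[OF fin ne, of "weight c"] arg_min_least[OF fin ne, of _ "weight c"] by simp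
  then have "?P (arg_min (\<lambda>T. to_nat (sorted_list_of_set (prod_encode ` T))) ?P)"
    by (rule arg_min_nat_lemma[THEN conjunct1])
  then have "?P (mst n F c)" unfolding mst_def arg_min_on_def .
  then show ?thesis by (simp add: spanning_tree_def)
qed

lemma measurable_mst:
  assumes F: "F \<subseteq> Kedges n"
  shows "(\<lambda>c. mst n F c) \<in> measurable (cost_space n D) (count_space UNIV)"
  unfolding mst_eq_tie by (rule measurable_compose[OF measurable_better[OF F]]) simp

lemma avail_subset: "avail n c j \<subseteq> Kedges n"
  by (induction j) auto

text \<open>The previous graph takes finitely many values; for each fixed value the tree removed
  from it is a measurable function of the costs.\<close>

lemma measurable_avail: "(\<lambda>c. avail n c j) \<in> measurable (cost_space n D) (count_space (Pow (Kedges n)))"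
proof (induction j)
  case (Suc j)
  have "(\<lambda>c. avail n c (Suc j)) \<in> measurable (cost_space n D) (count_space UNIV)"
    unfolding avail.simps
  proof (rule measurable_compose_countable'[OF _ Suc, where f="\<lambda>F c. F - (if has_spanning_tree n F then mst n F c else {})"])
    fix F assume "F \<in> Pow (Kedges n)"
    then show "(\<lambda>c. F - (if has_spanning_tree n F then mst n F c else {})) \<in> measurable (cost_space n D) (count_space UNIV)"
      by (cases "has_spanning_tree n F") (auto intro!: measurable_compose[OF measurable_mst])
  qed (auto intro!: countable_finite)
  then have pre: "(\<lambda>c. avail n c (Suc j)) -` Z \<inter> space (cost_space n D) \<in> sets (cost_space n D)" for Z
    by (rule measurable_sets) simp
  show ?case
  proof (rule measurable_finite_set_valued[OF finite_Kedges avail_subset])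
    fix e
    show "{c \<in> space (cost_space n D). e \<in> avail n c (Suc j)} \<in> sets (cost_space n D)"
      using pre[of "{F. e \<in> F}"] by (simp only: vimage_def mem_Collect_eq Int_def conj_commute)
  qed
qed simp

lemma measurable_wT: "(\<lambda>c. wT k n c) \<in> borel_measurable (cost_space n D)"
  unfolding wT_def
proof (rule measurable_compose_countable'[OF _ measurable_avail,
    where f="\<lambda>F c. if has_spanning_tree n F then ereal (weight c (mst n F c)) else \<infinity>"])
  fix F assume F: "F \<in> Pow (Kedges n)"
  show "(\<lambda>c. if has_spanning_tree n F then ereal (weight c (mst n F c)) else \<infinity>) \<in> borel_measurable (cost_space n D)"
  proof (cases "has_spanning_tree n F")
    case True
    \<comment> \<open>For a table \<open>z\<close> that no costs realise, \<open>tie F z\<close> may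
      be an arbitrary set; intersecting it with \<open>F\<close> keeps its weight measurable for
      every \<open>z\<close>.\<close>
    have "mst n F c = tie F (better F c) \<inter> F" for c
      using mst_subset[of F c] F True mst_eq_tie[of F c] by auto
    then have "(\<lambda>c. ereal (weight c (mst n F c))) = (\<lambda>c. ereal (weight c (tie F (better F c) \<inter> F)))" by simp
    also have "\<dots> \<in> borel_measurable (cost_space n D)"
    proof (rule measurable_compose_countable'[OF _ measurable_better, where f="\<lambda>z c. ereal (weight c (tie F z \<inter> F))"])
      fix z
      show "(\<lambda>c. ereal (weight c (tie F z \<inter> F))) \<in> borel_measurable (cost_space n D)"
        using F by (intro borel_measurable_ereal measurable_weight) auto
      show "countable (Pow (Pow F \<times> Pow F))"
        using F finite_subset[OF _ finite_Kedges, of F n] by (intro countable_finite) simp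
    qed (use F in simp)
    finally show ?thesis using True by simp
  qed simp
qed (auto intro!: countable_finite)

section \<open>Null events: nonpositive costs and ties\<close>

lemma prob_nonpos: 
  assumes e: "e \<in> Kedges n"
  shows "measure (cost_space n D) {c \<in> space (cost_space n D). c e \<le> 0} = 0"
proof -
  let ?A = "{c \<in> space (cost_space n D). c e \<le> 0}"
  have "measure (cost_space n D) ?A = (\<integral>c. indicator ?A c \<partial>cost_space n D)"
  proof -
    have "?A \<inter> space (cost_space n D) = ?A" by auto
    then show ?thesis by (simp only: Bochner_Integration.integral_indicator)
  qed
  also have "\<dots> = (\<integral>c. indicator {..0} (c e) \<partial>cost_space n D)"
    by (intro Bochner_Integration.integral_cong) (auto simp: indicator_def)
  also have "\<dots> = measure D {..0}" by (rule prob_cost[OF D e]) simp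
  finally show ?thesis using D by (simp add: cost_dist_def)
qed

text \<open>Given the other costs, a tie requires the cost of \<open>e\<close> to hit a single
  point, and \<open>cost_dist\<close> excludes atoms.\<close>

lemma prob_tie:
  assumes e: "e \<in> Kedges n" and f: "f \<in> Kedges n" and ef: "e \<noteq> f"
  shows "measure (cost_space n D) {c \<in> space (cost_space n D). c e = c f} = 0"
proof -
  interpret Dp: prob_space D by (rule prob_D[OF D])
  interpret product_sigma_finite "\<lambda>_::nat \<times> nat. D" by unfold_locales
  let ?A = "{c \<in> space (cost_space n D). c e = c f}"
  define J where "J = Kedges n - {e}"
  have ins: "Kedges n = insert e J" and J: "finite J" "e \<notin> J" using e by (auto simp: J_def)
  have [measurable]: "(\<lambda>c. c e) \<in> borel_measurable (cost_space n D)" "(\<lambda>c. c f) \<in> borel_measurable (cost_space n D)"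
    by (intro measurable_cost[OF D] e f)+
  have m: "(\<lambda>c. indicator {0} (c e - c f) :: real) \<in> borel_measurable (cost_space n D)" by measurable
  have int: "integrable (cost_space n D) (\<lambda>c. indicator {0} (c e - c f) :: real)"
    by (rule integrable_bounded[OF D m, of 1]) (simp add: indicator_def)
  have "measure (cost_space n D) ?A = (\<integral>c. indicator ?A c \<partial>cost_space n D)"
  proof -
    have "?A \<inter> space (cost_space n D) = ?A" by auto
    then show ?thesis by (simp only: Bochner_Integration.integral_indicator)
  qed
  also have "\<dots> = (\<integral>c. indicator {0} (c e - c f) \<partial>cost_space n D)"
    by (intro Bochner_Integration.integral_cong) (auto simp: indicator_def)
  also have "\<dots> = (\<integral>c. (\<integral>y. indicator {0} ((c(e := y)) e - (c(e := y)) f) \<partial>D) \<partial>PiM J (\<lambda>_. D))"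
    using int unfolding cost_space_def ins by (rule product_integral_insert[OF J])
  also have "\<dots> = (\<integral>c. (\<integral>y. indicator {c f} y \<partial>D) \<partial>PiM J (\<lambda>_. D))"
    using ef by (intro Bochner_Integration.integral_cong refl) (auto simp: indicator_def)
  also have "\<dots> = 0"
    using D by (simp add: cost_dist_def sets_eq_imp_space_eq[OF sets_D[OF D]])
  finally show ?thesis .
qed

end

section \<open>Convergence in probability\<close>

text \<open>The measurable exceptional set spares any proof that \<open>P\<close> itself is
  measurable, which would be awkward for properties with an existential quantifier.\<close>

definition wp :: "real measure \<Rightarrow> nat \<Rightarrow> real \<Rightarrow> ((nat \<times> nat \<Rightarrow> real) \<Rightarrow> bool) \<Rightarrow> bool" where
  "wp D n \<epsilon> P \<longleftrightarrow> (\<exists>B\<in>sets (cost_space n D). measure (cost_space n D) B \<le> \<epsilon> \<and>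
    (\<forall>c\<in>space (cost_space n D) - B. P c))"

context
  fixes n :: nat and D :: "real measure"
  assumes D: "cost_dist D"
begin

lemma wp_conj:
  assumes "wp D n a P" "wp D n b Q"
  shows "wp D n (a + b) (\<lambda>c. P c \<and> Q c)"
proof -
  interpret M: prob_space "cost_space n D" by (rule prob_cost_space[OF D])
  obtain A where A: "A \<in> sets (cost_space n D)" "measure (cost_space n D) A \<le> a" "\<forall>c\<in>space (cost_space n D) - A. P c"
    using assms(1) unfolding wp_def by blast
  obtain B where B: "B \<in> sets (cost_space n D)" "measure (cost_space n D) B \<le> b" "\<forall>c\<in>space (cost_space n D) - B. Q c"
    using assms(2) unfolding wp_def by blast
  have "measure (cost_space n D) (A \<union> B) \<le> a + b"
    using measure_Un_le[OF A(1) B(1)] A(2) B(2) by linarith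
  then show ?thesis unfolding wp_def using A B by (intro bexI[of _ "A \<union> B"]) auto
qed

lemma wp_mono:
  assumes "wp D n a P" "\<And>c. P c \<Longrightarrow> Q c" "a \<le> b"
  shows "wp D n b Q"
  using assms unfolding wp_def by (meson order_trans)

lemma wp_ball:
  assumes "finite I" "\<And>i. i \<in> I \<Longrightarrow> wp D n (a i) (P i)"
  shows "wp D n (sum a I) (\<lambda>c. \<forall>i\<in>I. P i c)"
  using assms
proof (induction I rule: finite_induct)
  case empty
  show ?case unfolding wp_def by (intro bexI[of _ "{}"]) auto
next
  case (insert i I)
  have "wp D n (a i + sum a I) (\<lambda>c. P i c \<and> (\<forall>i\<in>I. P i c))"
    by (intro wp_conj insert) auto
  then show ?case by (rule wp_mono) (use insert in auto)
qed

lemma wp_markov: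
  assumes f: "integrable (cost_space n D) f" and f0: "\<And>c. 0 \<le> f c" and a: "(\<integral>c. f c \<partial>cost_space n D) \<le> a" and b: "0 < b"
  shows "wp D n (a / b) (\<lambda>c. f c < b)"
proof -
  let ?B = "{c \<in> space (cost_space n D). b \<le> f c}"
  have "?B \<in> sets (cost_space n D)" using borel_measurable_integrable[OF f] by measurable
  moreover have "measure (cost_space n D) ?B \<le> (\<integral>c. f c \<partial>cost_space n D) / b"
    by (rule integral_Markov_inequality_measure[OF f sets.empty_sets _ b]) (simp add: f0)
  then have "measure (cost_space n D) ?B \<le> a / b"
    using a b by (meson divide_right_mono less_imp_le order_trans)
  ultimately show ?thesis unfolding wp_def by (intro bexI[of _ ?B]) auto
qed

text \<open>Turns a statement with positive probability into one about a single cost function;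
  inequalities between deterministic numbers are extracted this way.\<close>

lemma wp_exists:
  assumes "wp D n a P" "a < 1"
  shows "\<exists>c. P c"
proof -
  interpret M: prob_space "cost_space n D" by (rule prob_cost_space[OF D])
  obtain A where A: "A \<in> sets (cost_space n D)" "measure (cost_space n D) A \<le> a" "\<forall>c\<in>space (cost_space n D) - A. P c"
    using assms(1) unfolding wp_def by blast
  have "space (cost_space n D) - A \<noteq> {}"
  proof
    assume "space (cost_space n D) - A = {}"
    then have "A = space (cost_space n D)" using sets.sets_into_space[OF A(1)] by blast
    then show False using A(2) assms(2) M.prob_space by simp
  qed
  then show ?thesis using A(3) by blast
qed

lemma wp_generic: "wp D n 0 (\<lambda>c. inj_on c (Kedges n) \<and> (\<forall>e\<in>Kedges n. 0 < c e))"
proof -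
  have 1: "wp D n 0 (\<lambda>c. 0 < c e)" if "e \<in> Kedges n" for e
    unfolding wp_def
  proof (intro bexI conjI ballI)
    show "measure (cost_space n D) {c \<in> space (cost_space n D). c e \<le> 0} \<le> 0" using prob_nonpos[OF D that] by simp
    show "{c \<in> space (cost_space n D). c e \<le> 0} \<in> sets (cost_space n D)" using measurable_cost[OF D that] by measurable
  qed auto
  have 2: "wp D n 0 (\<lambda>c. fst z \<noteq> snd z \<longrightarrow> c (fst z) \<noteq> c (snd z))" if z: "z \<in> Kedges n \<times> Kedges n" for z
  proof (cases "fst z = snd z")
    case True
    then show ?thesis unfolding wp_def by (intro bexI[of _ "{}"]) auto
  next
    case False
    have f: "fst z \<in> Kedges n" "snd z \<in> Kedges n" using z by auto
    have [measurable]: "(\<lambda>c. c (fst z)) \<in> borel_measurable (cost_space n D)" "(\<lambda>c. c (snd z)) \<in> borel_measurable (cost_space n D)"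
      by (intro measurable_cost[OF D] f)+
    show ?thesis
      unfolding wp_def
    proof (intro bexI conjI ballI)
      show "measure (cost_space n D) {c \<in> space (cost_space n D). c (fst z) = c (snd z)} \<le> 0"
        using prob_tie[OF D f False] by simp
      show "{c \<in> space (cost_space n D). c (fst z) = c (snd z)} \<in> sets (cost_space n D)" by measurable
    qed auto
  qed
  have "wp D n ((\<Sum>e\<in>Kedges n. 0) + (\<Sum>z\<in>Kedges n \<times> Kedges n. 0))
      (\<lambda>c. (\<forall>e\<in>Kedges n. 0 < c e) \<and> (\<forall>z\<in>Kedges n \<times> Kedges n. fst z \<noteq> snd z \<longrightarrow> c (fst z) \<noteq> c (snd z)))"
    by (intro wp_conj wp_ball finite_cartesian_product finite_Kedges 1 2)
  then show ?thesis
  proof (rule wp_mono)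
    fix c assume c: "(\<forall>e\<in>Kedges n. 0 < c e) \<and> (\<forall>z\<in>Kedges n \<times> Kedges n. fst z \<noteq> snd z \<longrightarrow> c (fst z) \<noteq> c (snd z))"
    have "inj_on c (Kedges n)"
    proof (rule inj_onI)
      fix e f assume "e \<in> Kedges n" "f \<in> Kedges n" "c e = c f"
      then show "e = f" using bspec[OF conjunct2[OF c], of "(e, f)"] by auto
    qed
    then show "inj_on c (Kedges n) \<and> (\<forall>e\<in>Kedges n. 0 < c e)" using c by blast
  qed simp
qed

text \<open>\<open>q\<close> is both the truncation time and the inverse of the mesh of the grid.\<close>

lemma wT_approx:
  assumes q: "q \<ge> 1" and n: "real n \<ge> 512 * (real q + 1)" and \<epsilon>: "0 < \<epsilon>" "\<epsilon> \<le> 1 / 512"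
    and K_def: "K = real (Suc k)"
  shows "wp D n (n * (1/2) ^ n + 4 * (2 * K / q + 6 * K * q / n) + 4 * K * (2 * K / q + 6 * K * q / n) / \<epsilon>)
    (\<lambda>c. \<exists>w. wT (Suc k) n c = ereal w \<and>
      \<bar>w - (\<Sum>r\<in>{1..q * q}. kap n (Suc k) (St n c (real r / real q / n))) / q\<bar> \<le> 1 / q + q / n + \<epsilon>)"
proof -
  define \<delta> where "\<delta> = 1 / real q"
  define X where "X = real q"
  have \<delta>: "0 < \<delta>" "\<delta> \<le> 1" and X: "0 < X" using q by (auto simp: \<delta>_def X_def)
  have n1: "n \<ge> 1" using n by (cases n) auto
  \<comment> \<open>The second part of the grid runs from \<open>X\<close> to just below
    \<open>n / 256\<close>, as far as \<open>tail_grid\<close> reaches. The lower bound on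
    \<open>n\<close> leaves it a length of at least \<open>n / 512\<close>.\<close>
  define R where "R = nat \<lfloor>(n / 256 - X) / \<delta>\<rfloor>"
  have pos: "0 \<le> (n / 256 - X) / \<delta>" using n \<delta> by (simp add: X_def)
  have Rle: "real R \<le> (n / 256 - X) / \<delta>" "(n / 256 - X) / \<delta> \<le> real R + 1"
    unfolding R_def using pos by linarith+
  have R1: "X + real R * \<delta> \<le> n / 256" using Rle(1) \<delta> by (simp add: le_divide_eq)
  have R2: "n / 512 \<le> real R * \<delta>"
  proof -
    have "n / 256 - X \<le> (real R + 1) * \<delta>" using Rle(2) \<delta> by (simp add: divide_le_eq)
    then show ?thesis using n \<delta> by (simp add: X_def distrib_right)
  qed
  define mx where "mx c t = mxf n (Suc k) (St n c (t / n))" for c t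
  define G where "G c \<longleftrightarrow> c \<in> lowdeg n \<and> mx c X \<le> n / 4" for c
  define T where "T c = (\<Sum>r\<in>{1..R}. \<delta> * mx c (X + real r * \<delta>))" for c
  have mx0: "0 \<le> mx c t" for c t unfolding mx_def by (rule mxf_nonneg[OF n1])
  have mxmono: "mx c t' \<le> mx c t" if "t \<le> t'" for c t t'
    unfolding mx_def using that by (intro mxf_mono[OF n1] rl_St_mono divide_right_mono) auto
  have w1: "wp D n (n * (1/2) ^ n) (\<lambda>c. c \<in> lowdeg n)"
    unfolding wp_def
  proof (intro bexI conjI ballI)
    show "measure (cost_space n D) {c \<in> space (cost_space n D). c \<notin> lowdeg n} \<le> n * (1/2) ^ n" by (rule prob_not_lowdeg[OF D])
    have "space (cost_space n D) - {c \<in> space (cost_space n D). c \<in> lowdeg n} \<in> sets (cost_space n D)"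
      by (intro sets.Diff sets.top lowdeg_sets[OF D])
    also have "space (cost_space n D) - {c \<in> space (cost_space n D). c \<in> lowdeg n} = {c \<in> space (cost_space n D). c \<notin> lowdeg n}" by auto
    finally show "{c \<in> space (cost_space n D). c \<notin> lowdeg n} \<in> sets (cost_space n D)" .
  qed auto
  have w2: "wp D n (4 * (2 * K / q + 6 * K * q / n)) (\<lambda>c. mx c X \<le> n / 4)"
    unfolding wp_def
  proof (intro bexI conjI ballI)
    show "measure (cost_space n D) {c \<in> space (cost_space n D). \<not> mx c X \<le> n / 4} \<le> 4 * (2 * K / q + 6 * K * q / n)"
      using prob_mxf_large[OF D n1 X, of "Suc k"] n unfolding mx_def X_def K_def by simp
    have "(\<lambda>c. \<not> mx c X \<le> n / 4) \<in> measurable (cost_space n D) (count_space UNIV)"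
      unfolding mx_def by (rule measurable_St'[OF D, where \<phi>="\<lambda>S. \<not> mxf n (Suc k) S \<le> n / 4"])
    then show "{c \<in> space (cost_space n D). \<not> mx c X \<le> n / 4} \<in> sets (cost_space n D)" by (rule predE)
  qed auto
  have w3: "wp D n ((4 * K * n * (2 * K / q + 6 * K * q / n)) / (n * \<epsilon>)) (\<lambda>c. T c * of_bool (G c) < n * \<epsilon>)"
  proof (rule wp_markov)
    have "integrable (cost_space n D) (\<lambda>c. \<Sum>r\<in>{1..R}. \<delta> * (mx c (X + real r * \<delta>) * of_bool (G c)))"
      unfolding mx_def G_def
      by (intro Bochner_Integration.integrable_sum integrable_mult_right
        integrable_St_lowdeg[OF D n1, of "mxf n (Suc k)" _ "\<lambda>S. mxf n (Suc k) S \<le> n / 4"])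
    also have "(\<lambda>c. \<Sum>r\<in>{1..R}. \<delta> * (mx c (X + real r * \<delta>) * of_bool (G c))) = (\<lambda>c. T c * of_bool (G c))"
      unfolding T_def by (simp only: sum_distrib_right mult.assoc)
    finally show "integrable (cost_space n D) (\<lambda>c. T c * of_bool (G c))" .
    show "0 \<le> T c * of_bool (G c)" for c unfolding T_def using mx0 \<delta> by (intro mult_nonneg_nonneg sum_nonneg) auto
    show "(\<integral>c. T c * of_bool (G c) \<partial>cost_space n D) \<le> 4 * K * n * (2 * K / q + 6 * K * q / n)"
      using tail_grid[OF D n1 X \<delta>(1) R1, of "Suc k"] unfolding T_def G_def mx_def K_def X_def by simp
  qed (use n1 \<epsilon> in simp)
  have "wp D n (0 + (n * (1/2) ^ n + 4 * (2 * K / q + 6 * K * q / n) + (4 * K * n * (2 * K / q + 6 * K * q / n)) / (n * \<epsilon>)))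
    (\<lambda>c. (inj_on c (Kedges n) \<and> (\<forall>e\<in>Kedges n. 0 < c e)) \<and> ((c \<in> lowdeg n \<and> mx c X \<le> n / 4) \<and> T c * of_bool (G c) < n * \<epsilon>))"
    by (intro wp_conj wp_generic w1 w2 w3)
  then show ?thesis
  proof (rule wp_mono)
    show "0 + (n * (1/2) ^ n + 4 * (2 * K / q + 6 * K * q / n) + (4 * K * n * (2 * K / q + 6 * K * q / n)) / (n * \<epsilon>))
      \<le> n * (1/2) ^ n + 4 * (2 * K / q + 6 * K * q / n) + 4 * K * (2 * K / q + 6 * K * q / n) / \<epsilon>"
      using n1 \<epsilon> by (simp add: mult.assoc mult.left_commute[of _ "real n"])
    fix c assume c: "(inj_on c (Kedges n) \<and> (\<forall>e\<in>Kedges n. 0 < c e)) \<and> ((c \<in> lowdeg n \<and> mx c X \<le> n / 4) \<and> T c * of_bool (G c) < n * \<epsilon>)"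
    then have "G c" unfolding G_def by blast
    then have Tc: "T c < n * \<epsilon>" using c by simp
    \<comment> \<open>The complement of the giant is an integer that decreases in time. If it were
      not 0 at the end, it would be at least 1 at all \<open>R\<close> times, and \<open>T c\<close>
      would be at least \<open>n / 512\<close>, contradicting \<open>T c < n * \<epsilon>\<close>.
      Hence the requirement \<open>\<epsilon> \<le> 1 / 512\<close>.\<close>
    have "mx c (X + real R * \<delta>) = 0"
    proof (rule ccontr)
      assume ne: "mx c (X + real R * \<delta>) \<noteq> 0"
      have int: "\<exists>i::int. mx c t = of_int i" for t
        unfolding mx_def mxf_def by (intro exI[of _ "int n - int (Max (sz n (St n c (t / n)) (Suc k) ` {..<n}))"]) simp
      have ge1: "1 \<le> mx c (X + real R * \<delta>)"
      proof -
        obtain i :: int where i: "mx c (X + real R * \<delta>) = of_int i" using int by blast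
        then have "0 < i" using ne mx0[of c "X + real R * \<delta>"] by (metis less_eq_real_def of_int_0_less_iff)
        then show ?thesis unfolding i by simp
      qed
      have "real R * \<delta> = (\<Sum>r\<in>{1..R}. \<delta> * 1)" by simp
      also have "\<dots> \<le> T c"
        unfolding T_def
      proof (intro sum_mono mult_left_mono)
        fix r assume "r \<in> {1..R}"
        then have "mx c (X + real R * \<delta>) \<le> mx c (X + real r * \<delta>)" using \<delta> by (intro mxmono add_left_mono mult_right_mono) auto
        then show "1 \<le> mx c (X + real r * \<delta>)" using ge1 by linarith
      qed (use \<delta> in simp)
      finally have "n / 512 < n * \<epsilon>" using R2 Tc by linarith
      moreover have "n * \<epsilon> \<le> n * (1 / 512)" using \<epsilon> by (intro mult_left_mono) auto
      ultimately show False by simp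
    qed
    then have full: "mxf n (Suc k) (St n c (real (q * q + R) * \<delta> / n)) = 0"
      using q by (simp add: mx_def X_def \<delta>_def distrib_right add_divide_distrib)
    obtain w where w: "wT (Suc k) n c = ereal w"
      "\<bar>w - \<delta> * (\<Sum>r\<in>{1..q * q + R}. kap n (Suc k) (St n c (real r * \<delta> / n)) - 1 / n)\<bar> \<le> \<delta>"
      using wT_grid[OF _ _ n1 \<delta>(1) full] c by blast
    define f where "f r = kap n (Suc k) (St n c (real r * \<delta> / n))" for r
    \<comment> \<open>Up to time \<open>q\<close>, subtracting \<open>1 / n\<close> at
      \<open>q * q\<close> grid points of mesh \<open>1 / q\<close> gives the error
      \<open>q / n\<close>. Beyond it, the summands are nonnegative and \<open>T c\<close> bounds
      their sum.\<close>
    have split: "(\<Sum>r\<in>{1..q * q + R}. f r - 1 / n) = (\<Sum>r\<in>{1..q * q}. f r) - q * q / n + (\<Sum>r\<in>{1..R}. f (q * q + r) - 1 / n)"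
    proof -
      have "(\<Sum>r\<in>{1..q * q + R}. f r - 1 / n) = (\<Sum>r\<in>{1..q * q}. f r - 1 / n) + (\<Sum>r\<in>{q * q + 1..q * q + R}. f r - 1 / n)"
        by (rule sum.ub_add_nat) simp
      also have "(\<Sum>r\<in>{q * q + 1..q * q + R}. f r - 1 / n) = (\<Sum>r\<in>{1..R}. f (q * q + r) - 1 / n)"
        using sum.shift_bounds_cl_nat_ivl[of "\<lambda>r. f r - 1 / n" 1 "q * q" R] by (simp add: add.commute)
      finally show ?thesis by (simp add: sum_subtractf)
    qed
    have shift: "real (q * q + r) * \<delta> = X + real r * \<delta>" for r
      using q by (simp add: X_def \<delta>_def distrib_right add_divide_distrib)
    have tl: "0 \<le> f (q * q + r) - 1 / n" "f (q * q + r) - 1 / n \<le> mx c (X + real r * \<delta>) / n" for r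
    proof -
      let ?S = "St n c ((X + real r * \<delta>) / n)"
      have "avg n (\<lambda>_. 1 / n) \<le> kap n (Suc k) ?S"
        unfolding kap_def stat_def
      proof (rule avg_mono)
        fix u assume "u < n"
        then show "1 / real n \<le> 1 / real (sz n ?S (Suc k) u)"
          using sz_pos[of u n ?S "Suc k"] sz_le[of n ?S "Suc k" u] by (intro divide_left_mono) auto
      qed
      then show "0 \<le> f (q * q + r) - 1 / n" using n1 unfolding f_def shift by simp
      have "n * kap n (Suc k) ?S - 1 \<le> mx c (X + real r * \<delta>)" unfolding mx_def by (rule kap_mxf[OF n1])
      then have "(n * kap n (Suc k) ?S - 1) / n \<le> mx c (X + real r * \<delta>) / n" by (rule divide_right_mono) simp
      then show "f (q * q + r) - 1 / n \<le> mx c (X + real r * \<delta>) / n" using n1 unfolding f_def shift by (simp add: diff_divide_distrib)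
    qed
    have t0: "0 \<le> \<delta> * (\<Sum>r\<in>{1..R}. f (q * q + r) - 1 / n)" using \<delta> tl by (intro mult_nonneg_nonneg sum_nonneg) auto
    have "\<delta> * (\<Sum>r\<in>{1..R}. f (q * q + r) - 1 / n) \<le> \<delta> * (\<Sum>r\<in>{1..R}. mx c (X + real r * \<delta>) / n)"
      using \<delta> by (intro mult_left_mono sum_mono tl) auto
    also have "\<dots> = T c / n" unfolding T_def by (simp add: sum_distrib_left sum_divide_distrib)
    also have "\<dots> \<le> \<epsilon>" using Tc n1 by (simp add: divide_le_eq mult.commute)
    finally have t1: "\<delta> * (\<Sum>r\<in>{1..R}. f (q * q + r) - 1 / n) \<le> \<epsilon>" .
    have "\<delta> * (\<Sum>r\<in>{1..q * q + R}. f r - 1 / n) = \<delta> * (\<Sum>r\<in>{1..q * q}. f r) - q / n + \<delta> * (\<Sum>r\<in>{1..R}. f (q * q + r) - 1 / n)"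
      unfolding split using q by (simp add: \<delta>_def algebra_simps)
    then have "\<bar>w - \<delta> * (\<Sum>r\<in>{1..q * q}. f r)\<bar> \<le> \<delta> + q / n + \<epsilon>"
      using w(2)[folded f_def] t0 t1 divide_nonneg_nonneg[of "real q" "real n"] unfolding abs_le_iff by linarith
    moreover have "\<delta> * (\<Sum>r\<in>{1..q * q}. f r) = (\<Sum>r\<in>{1..q * q}. kap n (Suc k) (St n c (real r / real q / n))) / q"
      by (simp add: \<delta>_def f_def)
    ultimately show "\<exists>w. wT (Suc k) n c = ereal w \<and>
      \<bar>w - (\<Sum>r\<in>{1..q * q}. kap n (Suc k) (St n c (real r / real q / n))) / q\<bar> \<le> 1 / q + q / n + \<epsilon>"
      using w(1) by (auto simp: \<delta>_def)
  qed
qed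

end

text \<open>Chebyshev's inequality at each of the \<open>q * q\<close> grid times and a union bound.
  A deviation of \<open>\<epsilon> / q\<close> at each time adds up to \<open>\<epsilon>\<close>
  after the division by \<open>q\<close>, and \<open>a\<close> is chosen so that the failure
  probabilities add up to \<open>\<eta>\<close>.\<close>

lemma wp_kap_sum:
  fixes \<kappa> :: "real \<Rightarrow> real" and q :: nat
  assumes \<kappa>: "\<And>x \<epsilon>. 0 \<le> x \<Longrightarrow> 0 < \<epsilon> \<Longrightarrow> \<exists>N. \<forall>n\<ge>N. \<forall>D. cost_dist D \<longrightarrow> Ef n D (\<lambda>S. (kap n k S - \<kappa> x)\<^sup>2) x \<le> \<epsilon>"
    and q: "q \<ge> 1" and \<epsilon>: "0 < \<epsilon>" and \<eta>: "0 < \<eta>"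
  shows "\<exists>N. \<forall>n\<ge>N. \<forall>D. cost_dist D \<longrightarrow> wp D n \<eta> (\<lambda>c.
    \<bar>(\<Sum>r\<in>{1..q * q}. kap n k (St n c (real r / real q / n))) / q - (\<Sum>r\<in>{1..q * q}. \<kappa> (real r / real q)) / q\<bar> \<le> \<epsilon>)"
proof -
  define b where "b = (\<epsilon> / q)\<^sup>2"
  define a where "a = \<eta> * b / real (q * q)"
  have b: "0 < b" and a: "0 < a" using q \<epsilon> \<eta> by (auto simp: b_def a_def)
  have "\<forall>r::nat. \<exists>N. \<forall>n\<ge>N. \<forall>D. cost_dist D \<longrightarrow> Ef n D (\<lambda>S. (kap n k S - \<kappa> (real r / real q))\<^sup>2) (real r / real q) \<le> a"
    using \<kappa>[OF _ a] by simp
  then obtain N where N: "\<forall>r::nat. \<forall>n\<ge>N r. \<forall>D. cost_dist D \<longrightarrow> Ef n D (\<lambda>S. (kap n k S - \<kappa> (real r / real q))\<^sup>2) (real r / real q) \<le> a"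
    unfolding choice_iff by (elim exE) (rule that)
  show ?thesis
  proof (intro exI[of _ "Max (N ` {1..q * q})"] allI impI)
    fix n D assume n: "Max (N ` {1..q * q}) \<le> n" and D: "cost_dist D"
    have 1: "wp D n (a / b) (\<lambda>c. (kap n k (St n c (real r / real q / n)) - \<kappa> (real r / real q))\<^sup>2 < b)" if r: "r \<in> {1..q * q}" for r
    proof (rule wp_markov[OF D _ _ _ b])
      show "integrable (cost_space n D) (\<lambda>c. (kap n k (St n c (real r / real q / n)) - \<kappa> (real r / real q))\<^sup>2)"
        by (rule integrable_St[OF D, where \<phi>="\<lambda>S. (kap n k S - \<kappa> (real r / real q))\<^sup>2"])
      have "N r \<le> Max (N ` {1..q * q})" using r by (intro Max_ge) auto
      then have "N r \<le> n" using n by simp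
      from N[rule_format, OF this D]
      show "(\<integral>c. (kap n k (St n c (real r / real q / n)) - \<kappa> (real r / real q))\<^sup>2 \<partial>cost_space n D) \<le> a" by (simp add: Ef_def)
    qed simp
    have "wp D n (\<Sum>r\<in>{1..q * q}. a / b) (\<lambda>c. \<forall>r\<in>{1..q * q}. (kap n k (St n c (real r / real q / n)) - \<kappa> (real r / real q))\<^sup>2 < b)"
      by (intro wp_ball[OF D] 1) auto
    then show "wp D n \<eta> (\<lambda>c. \<bar>(\<Sum>r\<in>{1..q * q}. kap n k (St n c (real r / real q / n))) / q - (\<Sum>r\<in>{1..q * q}. \<kappa> (real r / real q)) / q\<bar> \<le> \<epsilon>)"
    proof (rule wp_mono[OF D])
      show "(\<Sum>r\<in>{1..q * q}. a / b) \<le> \<eta>" using b q by (simp add: a_def)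
      fix c assume c: "\<forall>r\<in>{1..q * q}. (kap n k (St n c (real r / real q / n)) - \<kappa> (real r / real q))\<^sup>2 < b"
      have "\<bar>(\<Sum>r\<in>{1..q * q}. kap n k (St n c (real r / real q / n)) - \<kappa> (real r / real q))\<bar> \<le> (\<Sum>r\<in>{1..q * q}. \<epsilon> / q)"
      proof (rule order_trans[OF sum_abs sum_mono])
        fix r assume "r \<in> {1..q * q}"
        then have "(kap n k (St n c (real r / real q / n)) - \<kappa> (real r / real q))\<^sup>2 < (\<epsilon> / q)\<^sup>2" using c by (simp add: b_def)
        then have "\<bar>kap n k (St n c (real r / real q / n)) - \<kappa> (real r / real q)\<bar> < \<bar>\<epsilon> / q\<bar>"
          using abs_le_square_iff[of "\<epsilon> / q" "kap n k (St n c (real r / real q / n)) - \<kappa> (real r / real q)"] by linarith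
        then show "\<bar>kap n k (St n c (real r / real q / n)) - \<kappa> (real r / real q)\<bar> \<le> \<epsilon> / q" using \<epsilon> by simp
      qed
      also have "\<dots> = \<epsilon> * q" using q by simp
      finally have "\<bar>(\<Sum>r\<in>{1..q * q}. kap n k (St n c (real r / real q / n)) - \<kappa> (real r / real q)) / q\<bar> \<le> \<epsilon>"
        using q by (simp add: divide_le_eq)
      then show "\<bar>(\<Sum>r\<in>{1..q * q}. kap n k (St n c (real r / real q / n))) / q - (\<Sum>r\<in>{1..q * q}. \<kappa> (real r / real q)) / q\<bar> \<le> \<epsilon>"
        by (simp only: sum_subtractf diff_divide_distrib)
    qed
  qed
qed

text \<open>The number \<open>\<gamma> q\<close> is a Riemann sum of the limiting component
  proportion up to time \<open>q\<close>. The order of the quantifiers matters: \<open>q\<close>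
  controls the mesh and the tail, and only then does \<open>n\<close> grow, to make
  \<open>q / n\<close> and the fluctuations at the finitely many grid times small.\<close>

lemma wT_near_constants:
  "\<exists>\<gamma> :: nat \<Rightarrow> real. \<forall>\<epsilon>>0. \<exists>q0. \<forall>q\<ge>q0. \<exists>N. \<forall>n\<ge>N. \<forall>D. cost_dist D \<longrightarrow>
    wp D n \<epsilon> (\<lambda>c. \<exists>w. wT (Suc k) n c = ereal w \<and> \<bar>w - \<gamma> q\<bar> \<le> \<epsilon>)"
proof -
  have "\<forall>x. \<exists>\<kappa>. 0 \<le> x \<longrightarrow> (\<forall>\<epsilon>>0. \<exists>N. \<forall>n\<ge>N. \<forall>D. cost_dist D \<longrightarrow> Ef n D (\<lambda>S. (kap n (Suc k) S - \<kappa>)\<^sup>2) x \<le> \<epsilon>)"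
    using kap_limit[of _ "Suc k"] by blast
  then obtain \<kappa> where \<kappa>: "\<forall>x. 0 \<le> x \<longrightarrow> (\<forall>\<epsilon>>0. \<exists>N. \<forall>n\<ge>N. \<forall>D. cost_dist D \<longrightarrow> Ef n D (\<lambda>S. (kap n (Suc k) S - \<kappa> x)\<^sup>2) x \<le> \<epsilon>)"
    unfolding choice_iff by (elim exE) (rule that)
  define \<gamma> where "\<gamma> q = (\<Sum>r\<in>{1..q * q}. \<kappa> (real r / real q)) / real q" for q :: nat
  show ?thesis
  proof (intro exI[of _ \<gamma>] allI impI)
    fix \<epsilon> :: real assume \<epsilon>: "0 < \<epsilon>"
    define K where "K = real (Suc k)"
    define \<epsilon>' where "\<epsilon>' = min (\<epsilon> / 8) (1 / 512)"
    have \<epsilon>': "0 < \<epsilon>'" "\<epsilon>' \<le> 1 / 512" "\<epsilon>' \<le> \<epsilon> / 8" using \<epsilon> by (auto simp: \<epsilon>'_def)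
    \<comment> \<open>For fixed \<open>q\<close>, the bound of \<open>wT_approx\<close> on the
      failure probability tends to \<open>C / q\<close> as \<open>n\<close> grows.\<close>
    define C where "C = 8 * K + 8 * K * K / \<epsilon>'"
    have C: "0 \<le> C" using \<epsilon>' by (simp add: C_def K_def)
    obtain q1 :: nat where q1: "8 / \<epsilon> + 2 * C / \<epsilon> \<le> q1" using real_arch_simple by blast
    show "\<exists>q0. \<forall>q\<ge>q0. \<exists>N. \<forall>n\<ge>N. \<forall>D. cost_dist D \<longrightarrow>
      wp D n \<epsilon> (\<lambda>c. \<exists>w. wT (Suc k) n c = ereal w \<and> \<bar>w - \<gamma> q\<bar> \<le> \<epsilon>)"
    proof (rule exI[of _ "Suc q1"], intro allI impI)
      fix q assume q: "Suc q1 \<le> q"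
      have q1': "1 \<le> q" using q by simp
      have qb: "8 / \<epsilon> + 2 * C / \<epsilon> < q" using q1 q by linarith
      have "0 \<le> 2 * C / \<epsilon>" "0 < 8 / \<epsilon>" using C \<epsilon> by auto
      then have "8 / \<epsilon> < q" "2 * C / \<epsilon> < q" using qb by linarith+
      then have qe: "1 / q \<le> \<epsilon> / 8" and qC: "C / q < \<epsilon> / 2" using \<epsilon> q1' by (auto simp: field_simps)
      define tot where "tot n = n * (1/2) ^ n + 4 * (2 * K / q + 6 * K * q / n) + 4 * K * (2 * K / q + 6 * K * q / n) / \<epsilon>'" for n :: nat
      have z: "(\<lambda>n. 6 * K * q / real n) \<longlonglongrightarrow> 0"
        by (rule tendsto_divide_0[OF tendsto_const]) (rule filterlim_at_top_imp_at_infinity[OF filterlim_real_sequentially])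
      have "tot \<longlonglongrightarrow> 0 + 4 * (2 * K / q + 0) + 4 * K * (2 * K / q + 0) / \<epsilon>'"
        unfolding tot_def
        by (intro tendsto_add tendsto_mult tendsto_const tendsto_divide z powser_times_n_limit_0[where 'a=real, simplified]) (use \<epsilon>' in auto)
      moreover have "0 + 4 * (2 * K / q + 0) + 4 * K * (2 * K / q + 0) / \<epsilon>' = C / q"
        by (simp add: C_def add_divide_distrib mult_ac)
      ultimately have "tot \<longlonglongrightarrow> C / q" by (simp only:)
      from order_tendstoD(2)[OF this qC] have "eventually (\<lambda>n. tot n < \<epsilon> / 2) sequentially" .
      then obtain N1 where N1: "\<And>n. N1 \<le> n \<Longrightarrow> tot n < \<epsilon> / 2" unfolding eventually_sequentially by blast
      have "0 < \<epsilon> / 8" "0 < \<epsilon> / 4" using \<epsilon> by auto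
      have "\<exists>N. \<forall>n\<ge>N. \<forall>D. cost_dist D \<longrightarrow> wp D n (\<epsilon> / 4) (\<lambda>c.
        \<bar>(\<Sum>r\<in>{1..q * q}. kap n (Suc k) (St n c (real r / real q / n))) / q - \<gamma> q\<bar> \<le> \<epsilon> / 8)"
        unfolding \<gamma>_def using \<kappa> \<open>0 < \<epsilon> / 8\<close> \<open>0 < \<epsilon> / 4\<close> by (intro wp_kap_sum q1') blast+
      then obtain N2 where N2: "\<forall>n\<ge>N2. \<forall>D. cost_dist D \<longrightarrow> wp D n (\<epsilon> / 4) (\<lambda>c.
        \<bar>(\<Sum>r\<in>{1..q * q}. kap n (Suc k) (St n c (real r / real q / n))) / q - \<gamma> q\<bar> \<le> \<epsilon> / 8)"
        by (elim exE) (rule that)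
      obtain N3 :: nat where N3: "512 * (real q + 1) + 8 * real q / \<epsilon> \<le> N3" using real_arch_simple by blast
      show "\<exists>N. \<forall>n\<ge>N. \<forall>D. cost_dist D \<longrightarrow>
        wp D n \<epsilon> (\<lambda>c. \<exists>w. wT (Suc k) n c = ereal w \<and> \<bar>w - \<gamma> q\<bar> \<le> \<epsilon>)"
      proof (intro exI[of _ "max N1 (max N2 N3)"] allI impI)
        fix n D assume n: "max N1 (max N2 N3) \<le> n" and D: "cost_dist D"
        have nn: "512 * (real q + 1) + 8 * real q / \<epsilon> \<le> n" using N3 n by (meson max.boundedE of_nat_mono order_trans)
        have "0 \<le> 8 * real q / \<epsilon>" using \<epsilon> by simp
        moreover have "0 \<le> 512 * (real q + 1)" by simp
        ultimately have n512: "512 * (real q + 1) \<le> n" and nq: "8 * real q / \<epsilon> \<le> n" using nn by linarith+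
        have n0: "0 < n" using n512 by (cases n) auto
        have qn: "q / n \<le> \<epsilon> / 8" using nq \<epsilon> n0 by (simp add: field_simps)
        have A: "wp D n (tot n) (\<lambda>c. \<exists>w. wT (Suc k) n c = ereal w \<and>
          \<bar>w - (\<Sum>r\<in>{1..q * q}. kap n (Suc k) (St n c (real r / real q / n))) / q\<bar> \<le> 1 / q + q / n + \<epsilon>')"
          unfolding tot_def by (rule wT_approx[OF D q1' n512 \<epsilon>'(1,2) K_def])
        have B: "wp D n (\<epsilon> / 4) (\<lambda>c.
          \<bar>(\<Sum>r\<in>{1..q * q}. kap n (Suc k) (St n c (real r / real q / n))) / q - \<gamma> q\<bar> \<le> \<epsilon> / 8)"
          using N2[rule_format, OF _ D] n by simp
        show "wp D n \<epsilon> (\<lambda>c. \<exists>w. wT (Suc k) n c = ereal w \<and> \<bar>w - \<gamma> q\<bar> \<le> \<epsilon>)"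
        proof (rule wp_mono[OF D wp_conj[OF D A B]])
          have "tot n < \<epsilon> / 2" using n by (intro N1) simp
          then show "tot n + \<epsilon> / 4 \<le> \<epsilon>" using \<epsilon> by simp
          fix c assume "(\<exists>w. wT (Suc k) n c = ereal w \<and>
            \<bar>w - (\<Sum>r\<in>{1..q * q}. kap n (Suc k) (St n c (real r / real q / n))) / q\<bar> \<le> 1 / q + q / n + \<epsilon>') \<and>
            \<bar>(\<Sum>r\<in>{1..q * q}. kap n (Suc k) (St n c (real r / real q / n))) / q - \<gamma> q\<bar> \<le> \<epsilon> / 8"
          then obtain w where w: "wT (Suc k) n c = ereal w"
            "\<bar>w - (\<Sum>r\<in>{1..q * q}. kap n (Suc k) (St n c (real r / real q / n))) / q\<bar> \<le> 1 / q + q / n + \<epsilon>'"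
            "\<bar>(\<Sum>r\<in>{1..q * q}. kap n (Suc k) (St n c (real r / real q / n))) / q - \<gamma> q\<bar> \<le> \<epsilon> / 8" by blast
          have tri: "\<bar>u - g\<bar> \<le> \<epsilon>" if "\<bar>u - y\<bar> \<le> a + b + d" "\<bar>y - g\<bar> \<le> \<epsilon> / 8" "a \<le> \<epsilon> / 8" "b \<le> \<epsilon> / 8" "d \<le> \<epsilon> / 8"
            for u g y a b d :: real
            using that \<epsilon> by linarith
          show "\<exists>w. wT (Suc k) n c = ereal w \<and> \<bar>w - \<gamma> q\<bar> \<le> \<epsilon>"
            using w(1) tri[OF w(2,3) qe qn \<epsilon>'(3)] by blast
        qed
      qed
    qed
  qed
qed

text \<open>For two large values of \<open>q\<close>, both approximations hold with positive
  probability at a common \<open>n\<close>, so one cost function satisfies both and the two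
  constants are close. The Riemann sums converge for this reason, without any study of the limiting
  proportions.\<close>

lemma wT_near_constant:
  "\<exists>\<gamma> :: real. \<forall>\<epsilon>>0. \<exists>N. \<forall>n\<ge>N. \<forall>D. cost_dist D \<longrightarrow>
    wp D n \<epsilon> (\<lambda>c. \<exists>w. wT (Suc k) n c = ereal w \<and> \<bar>w - \<gamma>\<bar> \<le> \<epsilon>)"
proof -
  obtain \<gamma> :: "nat \<Rightarrow> real" where \<gamma>: "\<forall>\<epsilon>>0. \<exists>q0. \<forall>q\<ge>q0. \<exists>N. \<forall>n\<ge>N. \<forall>D. cost_dist D \<longrightarrow>
    wp D n \<epsilon> (\<lambda>c. \<exists>w. wT (Suc k) n c = ereal w \<and> \<bar>w - \<gamma> q\<bar> \<le> \<epsilon>)"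
    using wT_near_constants[of k] by (elim exE) (rule that)
  have "Cauchy \<gamma>"
  proof (rule metric_CauchyI)
    fix e :: real assume e: "0 < e"
    \<comment> \<open>The bound \<open>1 / 4\<close> keeps the sum of two failure probabilities
      below 1; \<open>e / 3\<close> leaves room for the triangle inequality.\<close>
    define \<epsilon> where "\<epsilon> = min (e / 3) (1 / 4)"
    have \<epsilon>: "0 < \<epsilon>" "\<epsilon> \<le> e / 3" "\<epsilon> \<le> 1 / 4" using e by (auto simp: \<epsilon>_def)
    obtain q0 where q0: "\<forall>q\<ge>q0. \<exists>N. \<forall>n\<ge>N. \<forall>D. cost_dist D \<longrightarrow>
      wp D n \<epsilon> (\<lambda>c. \<exists>w. wT (Suc k) n c = ereal w \<and> \<bar>w - \<gamma> q\<bar> \<le> \<epsilon>)" using \<gamma>[rule_format, OF \<epsilon>(1)] by (elim exE) (rule that)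
    have "dist (\<gamma> q) (\<gamma> q') < e" if q: "q0 \<le> q" "q0 \<le> q'" for q q'
    proof -
      obtain N where N: "\<forall>n\<ge>N. \<forall>D. cost_dist D \<longrightarrow>
        wp D n \<epsilon> (\<lambda>c. \<exists>w. wT (Suc k) n c = ereal w \<and> \<bar>w - \<gamma> q\<bar> \<le> \<epsilon>)" using q0[rule_format, OF q(1)] by (elim exE) (rule that)
      obtain N' where N': "\<forall>n\<ge>N'. \<forall>D. cost_dist D \<longrightarrow>
        wp D n \<epsilon> (\<lambda>c. \<exists>w. wT (Suc k) n c = ereal w \<and> \<bar>w - \<gamma> q'\<bar> \<le> \<epsilon>)" using q0[rule_format, OF q(2)] by (elim exE) (rule that)
      have "wp unif01 (max N N') (\<epsilon> + \<epsilon>) (\<lambda>c. (\<exists>w. wT (Suc k) (max N N') c = ereal w \<and> \<bar>w - \<gamma> q\<bar> \<le> \<epsilon>) \<and>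
          (\<exists>w. wT (Suc k) (max N N') c = ereal w \<and> \<bar>w - \<gamma> q'\<bar> \<le> \<epsilon>))"
        by (intro wp_conj[OF cost_dist_unif01] N[rule_format] N'[rule_format] cost_dist_unif01) auto
      from wp_exists[OF cost_dist_unif01 this] \<epsilon>
      obtain c where "\<exists>w. wT (Suc k) (max N N') c = ereal w \<and> \<bar>w - \<gamma> q\<bar> \<le> \<epsilon>"
          "\<exists>w. wT (Suc k) (max N N') c = ereal w \<and> \<bar>w - \<gamma> q'\<bar> \<le> \<epsilon>" by auto
      then obtain w where "\<bar>w - \<gamma> q\<bar> \<le> \<epsilon>" "\<bar>w - \<gamma> q'\<bar> \<le> \<epsilon>" by auto
      then show ?thesis using \<epsilon> e by (simp add: dist_real_def)
    qed
    then show "\<exists>M. \<forall>m\<ge>M. \<forall>n\<ge>M. dist (\<gamma> m) (\<gamma> n) < e" by blast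
  qed
  then obtain g where lim: "\<gamma> \<longlonglongrightarrow> g" using real_Cauchy_convergent convergent_def by blast
  show ?thesis
  proof (intro exI[of _ g] allI impI)
    fix \<epsilon> :: real assume "0 < \<epsilon>"
    then have \<epsilon>: "0 < \<epsilon> / 2" by simp
    obtain q0 where q0: "\<forall>q\<ge>q0. \<exists>N. \<forall>n\<ge>N. \<forall>D. cost_dist D \<longrightarrow>
      wp D n (\<epsilon> / 2) (\<lambda>c. \<exists>w. wT (Suc k) n c = ereal w \<and> \<bar>w - \<gamma> q\<bar> \<le> \<epsilon> / 2)" using \<gamma>[rule_format, OF \<epsilon>] by (elim exE) (rule that)
    obtain q1 where q1: "\<And>q. q1 \<le> q \<Longrightarrow> \<bar>\<gamma> q - g\<bar> < \<epsilon> / 2" using LIMSEQ_D[OF lim \<epsilon>] by auto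
    define q where "q = max q0 q1"
    have "q0 \<le> q" by (simp add: q_def)
    from q0[rule_format, OF this] obtain N where N: "\<forall>n\<ge>N. \<forall>D. cost_dist D \<longrightarrow>
      wp D n (\<epsilon> / 2) (\<lambda>c. \<exists>w. wT (Suc k) n c = ereal w \<and> \<bar>w - \<gamma> q\<bar> \<le> \<epsilon> / 2)"
      by (elim exE) (rule that)
    have gq: "\<bar>\<gamma> q - g\<bar> < \<epsilon> / 2" by (rule q1) (simp add: q_def)
    show "\<exists>N. \<forall>n\<ge>N. \<forall>D. cost_dist D \<longrightarrow> wp D n \<epsilon> (\<lambda>c. \<exists>w. wT (Suc k) n c = ereal w \<and> \<bar>w - g\<bar> \<le> \<epsilon>)"
    proof (intro exI[of _ N] allI impI)
      fix n D assume n: "N \<le> n" and D: "cost_dist D"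
      show "wp D n \<epsilon> (\<lambda>c. \<exists>w. wT (Suc k) n c = ereal w \<and> \<bar>w - g\<bar> \<le> \<epsilon>)"
      proof (rule wp_mono[OF D N[rule_format, OF n D]])
        fix c assume "\<exists>w. wT (Suc k) n c = ereal w \<and> \<bar>w - \<gamma> q\<bar> \<le> \<epsilon> / 2"
        then obtain w where w: "wT (Suc k) n c = ereal w" "\<bar>w - \<gamma> q\<bar> \<le> \<epsilon> / 2" by blast
        have "\<bar>w - g\<bar> \<le> \<epsilon>" using w(2) gq by linarith
        then show "\<exists>w. wT (Suc k) n c = ereal w \<and> \<bar>w - g\<bar> \<le> \<epsilon>" using w(1) by blast
      qed (use \<open>0 < \<epsilon>\<close> in simp)
    qed
  qed
qed

lemma conv_in_prob_wp:
  assumes D: "cost_dist D"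
    and g: "\<forall>\<epsilon>>0. \<exists>N. \<forall>n\<ge>N. wp D n \<epsilon> (\<lambda>c. \<exists>w. wT k n c = ereal w \<and> \<bar>w - \<gamma>\<bar> \<le> \<epsilon>)"
  shows "conv_in_prob (\<lambda>n. cost_space n D) (\<lambda>n. wT k n) \<gamma>"
  unfolding conv_in_prob_def
proof (intro conjI allI impI)
  show "wT k n \<in> borel_measurable (cost_space n D)" for n using measurable_wT[OF D, of k n] .
  fix \<epsilon> :: real assume \<epsilon>: "0 < \<epsilon>"
  let ?A = "\<lambda>n. {\<omega> \<in> space (cost_space n D). \<not> (ereal (\<gamma> - \<epsilon>) < wT k n \<omega> \<and> wT k n \<omega> < ereal (\<gamma> + \<epsilon>))}"
  show "(\<lambda>n. measure (cost_space n D) (?A n)) \<longlonglongrightarrow> 0"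
  proof (rule LIMSEQ_I)
    fix \<eta> :: real assume \<eta>: "0 < \<eta>"
    define e where "e = min (\<epsilon> / 2) (\<eta> / 2)"
    have e: "0 < e" "e < \<epsilon>" "e < \<eta>" using \<epsilon> \<eta> by (auto simp: e_def min_def)
    obtain N where N: "\<forall>n\<ge>N. wp D n e (\<lambda>c. \<exists>w. wT k n c = ereal w \<and> \<bar>w - \<gamma>\<bar> \<le> e)"
      using g[rule_format, OF e(1)] by (elim exE) (rule that)
    have "norm (measure (cost_space n D) (?A n) - 0) < \<eta>" if n: "N \<le> n" for n
    proof -
      interpret M: prob_space "cost_space n D" by (rule prob_cost_space[OF D])
      obtain B where B: "B \<in> sets (cost_space n D)" "measure (cost_space n D) B \<le> e"
        "\<forall>c\<in>space (cost_space n D) - B. \<exists>w. wT k n c = ereal w \<and> \<bar>w - \<gamma>\<bar> \<le> e"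
        using N[rule_format, OF n] unfolding wp_def by blast
      have "?A n \<subseteq> B"
      proof
        fix c assume c: "c \<in> ?A n"
        show "c \<in> B"
        proof (rule ccontr)
          assume "c \<notin> B"
          then obtain w where w: "wT k n c = ereal w" "\<bar>w - \<gamma>\<bar> \<le> e" using B(3) c by blast
          then have "\<gamma> - \<epsilon> < w" "w < \<gamma> + \<epsilon>" using e by linarith+
          then show False using c w by simp
        qed
      qed
      then have "measure (cost_space n D) (?A n) \<le> measure (cost_space n D) B" using B(1) by (rule M.finite_measure_mono)
      then show ?thesis using B(2) e measure_nonneg[of "cost_space n D" "?A n"] by simp
    qed
    then show "\<exists>no. \<forall>n\<ge>no. norm (measure (cost_space n D) (?A n) - 0) < \<eta>" by blast
  qed
qed

theorem theorem1p1:
  fixes k :: nat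
  assumes "k \<ge> 1"
  shows "\<exists>\<gamma>::real.
           conv_in_prob (\<lambda>n. cost_space n unif01) (\<lambda>n. wT k n) \<gamma> \<and>
           conv_in_prob (\<lambda>n. cost_space n exp1) (\<lambda>n. wT k n) \<gamma>"
proof -
  obtain j where k: "k = Suc j" using assms by (cases k) auto
  obtain \<gamma> where \<gamma>: "\<forall>\<epsilon>>0. \<exists>N. \<forall>n\<ge>N. \<forall>D. cost_dist D \<longrightarrow>
    wp D n \<epsilon> (\<lambda>c. \<exists>w. wT (Suc j) n c = ereal w \<and> \<bar>w - \<gamma>\<bar> \<le> \<epsilon>)"
    using wT_near_constant[of j] by (elim exE) (rule that)
  \<comment> \<open>The constant was obtained before the quantifier over \<open>D\<close>, so the
    same one serves every \<open>cost_dist\<close>.\<close>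
  have "conv_in_prob (\<lambda>n. cost_space n D) (\<lambda>n. wT k n) \<gamma>" if D: "cost_dist D" for D
    unfolding k
  proof (rule conv_in_prob_wp[OF D], intro allI impI)
    fix \<epsilon> :: real assume "0 < \<epsilon>"
    from \<gamma>[rule_format, OF this] obtain N where "\<forall>n\<ge>N. \<forall>D. cost_dist D \<longrightarrow>
      wp D n \<epsilon> (\<lambda>c. \<exists>w. wT (Suc j) n c = ereal w \<and> \<bar>w - \<gamma>\<bar> \<le> \<epsilon>)" by (elim exE) (rule that)
    then show "\<exists>N. \<forall>n\<ge>N. wp D n \<epsilon> (\<lambda>c. \<exists>w. wT (Suc j) n c = ereal w \<and> \<bar>w - \<gamma>\<bar> \<le> \<epsilon>)"
      using D by (intro exI[of _ N]) simp
  qed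
  then show ?thesis using cost_dist_unif01 cost_dist_exp1 by blast
qed

end
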